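(* Let $\tau,z\in\mathbb{C}$ with $\mathrm{Im}\,\tau>|\mathrm{Im}\,z|\ge 0$, put $\Omega=\begin{pmatrix}\tau & z\\ z&\tau\end{pmatrix}$, and suppose that both $\mathrm{Im}\,\tau$ and $\mathrm{Im}\,z$ are integers. Let $L_\Omega=\mathbb{Z}^{(1,2)}\Omega+\mathbb{Z}^{(1,2)}\subset\mathbb{C}^2$ and $A_\Omega=\mathbb{C}^2/L_\Omega$. Let $H_\Omega:\mathbb{C}^2\times\mathbb{C}^2\to\mathbb{C}$ be the Hermitian form on $\mathbb{C}^2$ defined by $$H_\Omega((z_1,z_2),(w_1,w_2)):=z_1\overline{w}_1+z_2\overline{w}_2,\qquad (z_1,z_2),(w_1,w_2)\in\mathbb{C}^2.$$ Let $\chi_\Omega$ be the semi-character of $L_\Omega$ determined uniquely by $H_\Omega$. Then: (i) $H_\Omega$ is a positive definite Riemann form for $A_\Omega$. (ii) The line bundle $L(H_\Omega,\chi_\Omega)$ is an ample line bundle over $A_\Omega$, and hence the global sections of $L(H_\Omega,\chi_\Omega)^{\otimes n}$ $(n\ge 3)$ give an embedding of $A_\Omega$ into a projective space. (iii) $$\dim H^0(A_\Omega,L(H_\Omega,\chi_\Omega))=\sqrt{\det E_\Omega}=(\mathrm{Im}\,\tau)^2-(\mathrm{Im}\,z)^2,$$ where $E_\Omega$ is the imaginary part of $H_\Omega$.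
   Context: $\mathbb{Z}^{(1,2)}$ denotes integer row vectors of length 2, and $\mathbb{C}^2$ consists of row vectors. The rows of $\Omega$ together with $(1,0),(0,1)$ form a $\mathbb{Z}$-basis of $L_\Omega$, which is a lattice of rank 4 in $\mathbb{C}^2$. Hermitian forms are $\mathbb{C}$-linear in the first variable and antilinear in the second. For a lattice $L\subset\mathbb{C}^2$ and $A=\mathbb{C}^2/L$ an abelian surface, a Riemann form for $A$ is a nondegenerate Hermitian form $H$ on $\mathbb{C}^2$ whose imaginary part $E=\mathrm{Im}\,H$ is integral valued on $L\times L$. Let $T=\{t\in\mathbb{C}: |t|=1\}$. A semi-character of $L$ with respect to $E$ is a map $\chi:L\to T$ with $\chi(\alpha+\beta)=\chi(\alpha)\chi(\beta)\exp\{i\pi E(\alpha,\beta)\}$ for all $\alpha,\beta\in L$. It is taken as given that for any Riemann form $H$ such a semi-character $\chi_H$ with respect to $\mathrm{Im}\,H$ always exists uniquely; this is the sense of "the semi-character determined uniquely by" the form. Given $H$ and $\chi$, put $J_{H,\chi}(\alpha,z)=\chi(\alpha)\exp\{\pi H(z,\alpha)+\frac{\pi}{2}H(\alpha,\alpha)\}$ for $\alpha\in L$, $z\in\mathbb{C}^2$. $L(H,\chi)$ denotes the holomorphic line bundle over $A$ obtained as the quotient of $\mathbb{C}^2\times\mathbb{C}$ by the action of $L$ given by $\alpha\cdot(z,\xi)=(z+\alpha,J_{H,\chi}(\alpha,z)\xi)$. Its space of global sections $H^0(A,L(H,\chi))$ is identified with the space of holomorphic functions $\theta$ on $\mathbb{C}^2$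 such that $\theta(z+\alpha)=J_{H,\chi}(\alpha,z)\theta(z)$ for all $\alpha\in L$, $z\in\mathbb{C}^2$. Ampleness of $L(H,\chi)$ is understood to mean that the holomorphic sections of $L(H,\chi)^{\otimes n}$ $(n\ge 3)$ give an embedding of $A$ as a closed complex submanifold into a projective space. $\det E$ denotes the determinant of the $4\times4$ matrix $(E(e_i,e_j))$ for a $\mathbb{Z}$-basis $e_1,\dots,e_4$ of $L$. *)

theory Defs
  imports "HOL-Analysis.Analysis" "HOL-Library.Function_Algebras"
begin

section \<open>Lattices in \<open>\<complex>\<^sup>2\<close>\<close>

text \<open>A family is a \<open>\<int>\<close>-basis of \<open>L\<close> iff integer coordinates identify \<open>\<int>\<^sup>n\<close> with \<open>L\<close>.\<close>

definition zbasis :: "(complex^2) set \<Rightarrow> ('n::finite \<Rightarrow> complex^2) \<Rightarrow> bool" where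
  "zbasis L e \<longleftrightarrow> bij_betw (\<lambda>k::'n \<Rightarrow> int. \<Sum>i\<in>UNIV. of_int (k i) *s e i) UNIV L"

definition is_lattice :: "(complex^2) set \<Rightarrow> bool" where
  "is_lattice L \<longleftrightarrow> (\<exists>e :: 4 \<Rightarrow> complex^2. zbasis L e \<and>
     (\<forall>c :: 4 \<Rightarrow> real. (\<Sum>i\<in>UNIV. c i *\<^sub>R e i) = 0 \<longrightarrow> (\<forall>i. c i = 0)))"

definition form_det :: "(complex^2) set \<Rightarrow> (complex^2 \<Rightarrow> complex^2 \<Rightarrow> real) \<Rightarrow> real" where
  "form_det L E =
     (THE d. \<exists>e :: 4 \<Rightarrow> complex^2. zbasis L e \<and> d = det (\<chi> i j. E (e i) (e j)))"

definition period_matrix :: "complex \<Rightarrow> complex \<Rightarrow> complex^2^2" where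
  "period_matrix \<tau> z = vector [vector [\<tau>, z], vector [z, \<tau>]]"

definition period_lattice :: "complex^2^2 \<Rightarrow> (complex^2) set" where
  "period_lattice \<Omega> =
     {(\<chi> i. of_int (m $ i)) v* \<Omega> + (\<chi> i. of_int (n $ i)) | m n :: int^2. True}"


section \<open>Riemann forms and semi-characters\<close>

definition hermitian_form :: "(complex^2 \<Rightarrow> complex^2 \<Rightarrow> complex) \<Rightarrow> bool" where
  "hermitian_form H \<longleftrightarrow>
     (\<forall>u v w. H (u + v) w = H u w + H v w) \<and>
     (\<forall>c v w. H (c *s v) w = c * H v w) \<and>
     (\<forall>v w. H w v = cnj (H v w))"

definition riemann_form :: "(complex^2) set \<Rightarrow> (complex^2 \<Rightarrow> complex^2 \<Rightarrow> complex) \<Rightarrow> bool" where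
  "riemann_form L H \<longleftrightarrow> is_lattice L \<and> hermitian_form H \<and>
     (\<forall>v. (\<forall>w. H v w = 0) \<longrightarrow> v = 0) \<and>
     (\<forall>\<alpha>\<in>L. \<forall>\<beta>\<in>L. Im (H \<alpha> \<beta>) \<in> \<int>)"

definition pos_definite :: "(complex^2 \<Rightarrow> complex^2 \<Rightarrow> complex) \<Rightarrow> bool" where
  "pos_definite H \<longleftrightarrow> (\<forall>v. v \<noteq> 0 \<longrightarrow> Im (H v v) = 0 \<and> Re (H v v) > 0)"

text \<open>Only the values on \<open>L\<close> are relevant.\<close>

definition semicharacter ::
    "(complex^2) set \<Rightarrow> (complex^2 \<Rightarrow> complex^2 \<Rightarrow> real) \<Rightarrow> (complex^2 \<Rightarrow> complex) \<Rightarrow> bool" where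
  "semicharacter L E chi \<longleftrightarrow>
     (\<forall>\<alpha>\<in>L. cmod (chi \<alpha>) = 1) \<and>
     (\<forall>\<alpha>\<in>L. \<forall>\<beta>\<in>L. chi (\<alpha> + \<beta>) = chi \<alpha> * chi \<beta> * exp (\<i> * of_real pi * of_real (E \<alpha> \<beta>)))"

definition H_Omega :: "complex^2 \<Rightarrow> complex^2 \<Rightarrow> complex" where
  "H_Omega v w = v $ 1 * cnj (w $ 1) + v $ 2 * cnj (w $ 2)"

definition E_Omega :: "complex^2 \<Rightarrow> complex^2 \<Rightarrow> real" where
  "E_Omega v w = Im (H_Omega v w)"


section \<open>Line bundles given by factors of automorphy\<close>

text \<open>Differentiability over \<open>\<complex>\<close>: the Frechet derivative exists and is \<open>\<complex>\<close>-linear.\<close>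

definition holomorphic_on2 :: "(complex^2 \<Rightarrow> complex) \<Rightarrow> (complex^2) set \<Rightarrow> bool" where
  "holomorphic_on2 f S \<longleftrightarrow>
     (\<forall>z\<in>S. \<exists>D. (f has_derivative D) (at z) \<and> (\<forall>c v. D (c *s v) = c * D v))"

text \<open>
  A factor of automorphy \<open>J\<close> stands for the holomorphic line bundle over \<open>\<complex>\<^sup>2/L\<close> which is the
  quotient of \<open>\<complex>\<^sup>2 \<times> \<complex>\<close> by \<open>\<alpha> \<cdot> (z, \<xi>) = (z + \<alpha>, J \<alpha> z * \<xi>)\<close>; the cocycle identity below says that
  this is an action of \<open>L\<close>. Its global sections are identified with the holomorphic functions
  \<open>\<theta>\<close> on \<open>\<complex>\<^sup>2\<close> for which \<open>z \<mapsto> (z, \<theta> z)\<close> is equivariant, and the \<open>n\<close>-th tensor power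
  of the bundle has the factor of automorphy \<open>J\<^sup>n\<close>.
\<close>

definition automorphy_factor :: "(complex^2) set \<Rightarrow> (complex^2 \<Rightarrow> complex^2 \<Rightarrow> complex) \<Rightarrow> bool" where
  "automorphy_factor L J \<longleftrightarrow>
     (\<forall>\<alpha>\<in>L. holomorphic_on2 (J \<alpha>) UNIV \<and> (\<forall>z. J \<alpha> z \<noteq> 0)) \<and>
     (\<forall>\<alpha>\<in>L. \<forall>\<beta>\<in>L. \<forall>z. J (\<alpha> + \<beta>) z = J \<alpha> (z + \<beta>) * J \<beta> z)"

definition sections ::
    "(complex^2) set \<Rightarrow> (complex^2 \<Rightarrow> complex^2 \<Rightarrow> complex) \<Rightarrow> (complex^2 \<Rightarrow> complex) set" where
  "sections L J =
     {\<theta>. holomorphic_on2 \<theta> UNIV \<and> (\<forall>\<alpha>\<in>L. \<forall>z. \<theta> (z + \<alpha>) = J \<alpha> z * \<theta> z)}"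

definition tensor_power ::
    "(complex^2 \<Rightarrow> complex^2 \<Rightarrow> complex) \<Rightarrow> nat \<Rightarrow> complex^2 \<Rightarrow> complex^2 \<Rightarrow> complex" where
  "tensor_power J n = (\<lambda>\<alpha> z. J \<alpha> z ^ n)"

definition J_factor ::
    "(complex^2 \<Rightarrow> complex^2 \<Rightarrow> complex) \<Rightarrow> (complex^2 \<Rightarrow> complex) \<Rightarrow>
     complex^2 \<Rightarrow> complex^2 \<Rightarrow> complex" where
  "J_factor H chi = (\<lambda>\<alpha> z. chi \<alpha> * exp (of_real pi * H z \<alpha> + of_real pi / 2 * H \<alpha> \<alpha>))"

definition fscale :: "complex \<Rightarrow> ('a \<Rightarrow> complex) \<Rightarrow> 'a \<Rightarrow> complex" where
  "fscale c f = (\<lambda>x. c * f x)"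

interpretation cfun: vector_space "fscale :: complex \<Rightarrow> ('a \<Rightarrow> complex) \<Rightarrow> 'a \<Rightarrow> complex"
  by unfold_locales (auto simp: fscale_def fun_eq_iff algebra_simps)

definition section_basis ::
    "(complex^2 \<Rightarrow> complex) set \<Rightarrow> nat \<Rightarrow> (nat \<Rightarrow> complex^2 \<Rightarrow> complex) \<Rightarrow> bool" where
  "section_basis V N \<theta> \<longleftrightarrow> inj_on \<theta> {..N} \<and>
     cfun.independent (\<theta> ` {..N}) \<and> cfun.span (\<theta> ` {..N}) = V"


section \<open>The torus \<open>\<complex>\<^sup>2/L\<close> and projective space\<close>

definition quotient_top :: "'a topology \<Rightarrow> ('a \<Rightarrow> 'b) \<Rightarrow> 'b topology" where
  "quotient_top X f =
     topology (\<lambda>U. U \<subseteq> f ` topspace X \<and> openin X {x \<in> topspace X. f x \<in> U})"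

lemma openin_quotient_top:
  "openin (quotient_top X f) U \<longleftrightarrow>
     U \<subseteq> f ` topspace X \<and> openin X {x \<in> topspace X. f x \<in> U}"
proof -
  have "istopology (\<lambda>U. U \<subseteq> f ` topspace X \<and> openin X {x \<in> topspace X. f x \<in> U})"
    unfolding istopology_def
  proof (intro conjI allI impI)
    fix S T
    assume S: "S \<subseteq> f ` topspace X \<and> openin X {x \<in> topspace X. f x \<in> S}"
      and T: "T \<subseteq> f ` topspace X \<and> openin X {x \<in> topspace X. f x \<in> T}"
    show "S \<inter> T \<subseteq> f ` topspace X" using S by blast
    have "{x \<in> topspace X. f x \<in> S \<inter> T}
        = {x \<in> topspace X. f x \<in> S} \<inter> {x \<in> topspace X. f x \<in> T}" by blast
    then show "openin X {x \<in> topspace X. f x \<in> S \<inter> T}"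
      using S T by (simp add: openin_Int)
  next
    fix K
    assume K: "\<forall>S\<in>K. S \<subseteq> f ` topspace X \<and> openin X {x \<in> topspace X. f x \<in> S}"
    show "\<Union>K \<subseteq> f ` topspace X" using K by blast
    have "{x \<in> topspace X. f x \<in> \<Union>K} = (\<Union>S\<in>K. {x \<in> topspace X. f x \<in> S})" by blast
    then show "openin X {x \<in> topspace X. f x \<in> \<Union>K}"
      using K by (metis (no_types, lifting) imageE openin_Union)
  qed
  then show ?thesis by (simp add: quotient_top_def)
qed

lemma topspace_quotient_top: "topspace (quotient_top X f) = f ` topspace X"
proof
  show "topspace (quotient_top X f) \<subseteq> f ` topspace X"
    using openin_quotient_top[of X f] by (meson openin_topspace)
  have "{x \<in> topspace X. f x \<in> f ` topspace X} = topspace X" by blast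
  then have "openin (quotient_top X f) (f ` topspace X)"
    by (simp add: openin_quotient_top)
  then show "f ` topspace X \<subseteq> topspace (quotient_top X f)"
    by (rule openin_subset)
qed

lemma quotient_map_quotient_top: "quotient_map X (quotient_top X f) f"
  unfolding quotient_map_def topspace_quotient_top openin_quotient_top by blast

definition coset :: "(complex^2) set \<Rightarrow> complex^2 \<Rightarrow> (complex^2) set" where
  "coset L z = (\<lambda>\<alpha>. z + \<alpha>) ` L"

definition torus_top :: "(complex^2) set \<Rightarrow> (complex^2) set topology" where
  "torus_top L = quotient_top euclidean (coset L)"

text \<open>
  \<open>\<complex>\<^sup>N\<^sup>+\<^sup>1\<close> is realised as the space of sequences supported on \<open>{..N}\<close>, and a point of projective
  \<open>N\<close>-space as the set of all homogeneous coordinate vectors of that point.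
\<close>

definition homog_vectors :: "nat \<Rightarrow> (nat \<Rightarrow> complex) set" where
  "homog_vectors N = {v. (\<exists>i. v i \<noteq> 0) \<and> (\<forall>i>N. v i = 0)}"

definition proj_point :: "(nat \<Rightarrow> complex) \<Rightarrow> (nat \<Rightarrow> complex) set" where
  "proj_point v = {fscale c v | c. c \<noteq> 0}"

definition proj_top :: "nat \<Rightarrow> (nat \<Rightarrow> complex) set topology" where
  "proj_top N = quotient_top (top_of_set (homog_vectors N)) proj_point"

definition chart_domain :: "nat \<Rightarrow> nat \<Rightarrow> (nat \<Rightarrow> complex) set set" where
  "chart_domain N i = proj_point ` {v \<in> homog_vectors N. v i \<noteq> 0}"

definition chart :: "nat \<Rightarrow> (nat \<Rightarrow> complex) set \<Rightarrow> nat \<Rightarrow> complex" where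
  "chart i p j = the_elem ((\<lambda>v. v j / v i) ` p)"

text \<open>
  The projection \<open>\<complex>\<^sup>2 \<rightarrow> \<complex>\<^sup>2/L\<close> is locally biholomorphic, so a map on \<open>\<complex>\<^sup>2/L\<close> is
  holomorphic, or an immersion, iff its pullback \<open>F\<close> to \<open>\<complex>\<^sup>2\<close> is. This is tested in the
  standard charts of projective space; the coordinate \<open>j = i\<close> of the \<open>i\<close>-th chart is constantly 1.
\<close>

definition holomorphic_to_proj :: "nat \<Rightarrow> (complex^2 \<Rightarrow> (nat \<Rightarrow> complex) set) \<Rightarrow> bool" where
  "holomorphic_to_proj N F \<longleftrightarrow> range F \<subseteq> topspace (proj_top N) \<and>
     (\<forall>i\<le>N. open (F -` chart_domain N i) \<and>
        (\<forall>j\<le>N. holomorphic_on2 (\<lambda>z. chart i (F z) j) (F -` chart_domain N i)))"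

definition immersion_to_proj :: "nat \<Rightarrow> (complex^2 \<Rightarrow> (nat \<Rightarrow> complex) set) \<Rightarrow> bool" where
  "immersion_to_proj N F \<longleftrightarrow> holomorphic_to_proj N F \<and>
     (\<forall>i\<le>N. \<forall>z \<in> F -` chart_domain N i. \<forall>h.
        (\<forall>j\<le>N. frechet_derivative (\<lambda>w. chart i (F w) j) (at z) h = 0) \<longrightarrow> h = 0)"

text \<open>
  An embedding onto a closed complex submanifold: a holomorphic immersion that is a homeomorphism
  onto its image, with closed image.
\<close>

definition closed_embedding ::
    "(complex^2) set \<Rightarrow> nat \<Rightarrow> ((complex^2) set \<Rightarrow> (nat \<Rightarrow> complex) set) \<Rightarrow> bool" where
  "closed_embedding L N \<phi> \<longleftrightarrow>
     immersion_to_proj N (\<phi> \<circ> coset L) \<and>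
     embedding_map (torus_top L) (proj_top N) \<phi> \<and>
     closedin (proj_top N) (\<phi> ` topspace (torus_top L))"

text \<open>
  The map \<open>z + L \<mapsto> [\<theta>\<^sub>0 z : \<dots> : \<theta>\<^sub>N z]\<close>. Where the \<open>\<theta>\<^sub>i\<close> are sections of one line bundle,
  the value does not depend on the representative \<open>z\<close>. At a common zero of the \<open>\<theta>\<^sub>i\<close> it is
  not a point of projective space, so that \<open>closed_embedding\<close> excludes base points.
\<close>

definition section_map ::
    "nat \<Rightarrow> (nat \<Rightarrow> complex^2 \<Rightarrow> complex) \<Rightarrow> (complex^2) set \<Rightarrow> (nat \<Rightarrow> complex) set" where
  "section_map N \<theta> C = the_elem ((\<lambda>z. proj_point (\<lambda>i. if i \<le> N then \<theta> i z else 0)) ` C)"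

definition sections_give_embedding ::
    "(complex^2) set \<Rightarrow> (complex^2 \<Rightarrow> complex^2 \<Rightarrow> complex) \<Rightarrow> bool" where
  "sections_give_embedding L J \<longleftrightarrow>
     (\<exists>N \<theta>. section_basis (sections L J) N \<theta>) \<and>
     (\<forall>N \<theta>. section_basis (sections L J) N \<theta> \<longrightarrow> closed_embedding L N (section_map N \<theta>))"

definition ample_line_bundle ::
    "(complex^2) set \<Rightarrow> (complex^2 \<Rightarrow> complex^2 \<Rightarrow> complex) \<Rightarrow> bool" where
  "ample_line_bundle L J \<longleftrightarrow> automorphy_factor L J \<and>
     (\<forall>n\<ge>3. sections_give_embedding L (tensor_power J n))"


section \<open>Existence of bases and semi-characters\<close>

definition period_basis :: "complex^2^2 \<Rightarrow> 4 \<Rightarrow> complex^2" where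
  "period_basis \<Omega> i = (if i = 1 then \<Omega> $ 1 else if i = 2 then \<Omega> $ 2
     else if i = 3 then axis 1 1 else axis 2 1)"

lemma sum_period_basis:
  "(\<Sum>i\<in>UNIV. k i *s period_basis \<Omega> i) =
     (\<chi> i. if i = 1 then k 1 else k 2) v* \<Omega> + (\<chi> i. if i = 1 then k 3 else k (4::4))"
  by (simp add: period_basis_def vec_eq_iff forall_2 sum_4 sum_2 vector_matrix_mult_def axis_def
      algebra_simps)

lemma period_basis_independent:
  fixes c :: "4 \<Rightarrow> real"
  assumes "\<bar>Im z\<bar> < Im \<tau>"
    and "(\<Sum>i\<in>UNIV. of_real (c i) *s period_basis (period_matrix \<tau> z) i) = 0"
  shows "c i = 0"
proof -
  have eq: "c 1 * \<tau> + c 2 * z + c 3 = 0" "c 1 * z + c 2 * \<tau> + c 4 = 0"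
    using assms(2) unfolding sum_period_basis
    by (simp_all add: vec_eq_iff forall_2 vector_matrix_mult_def sum_2 period_matrix_def
        algebra_simps)
  have im: "c 1 * Im \<tau> + c 2 * Im z = 0" "c 1 * Im z + c 2 * Im \<tau> = 0"
    using eq[THEN arg_cong[where f = Im]] by simp_all
  have d: "(Im \<tau> + Im z) * (Im \<tau> - Im z) \<noteq> 0" using assms(1) by auto
  have "c 1 * ((Im \<tau> + Im z) * (Im \<tau> - Im z)) = 0" "c 2 * ((Im \<tau> + Im z) * (Im \<tau> - Im z)) = 0"
    using im by algebra+
  then have c12: "c 1 = 0" "c 2 = 0" using d by auto
  then have "c 3 = 0" "c 4 = 0" using eq by simp_all
  then show ?thesis using c12 exhaust_4[of i] by auto
qed

lemma zbasis_period_basis: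
  assumes "\<bar>Im z\<bar> < Im \<tau>"
  shows "zbasis (period_lattice (period_matrix \<tau> z)) (period_basis (period_matrix \<tau> z))"
  unfolding zbasis_def bij_betw_def
proof
  let ?\<Omega> = "period_matrix \<tau> z"
  let ?f = "\<lambda>k::4 \<Rightarrow> int. \<Sum>i\<in>UNIV. of_int (k i) *s period_basis ?\<Omega> i"
  show "inj ?f"
  proof (rule injI)
    fix k l assume "?f k = ?f l"
    then have "(\<Sum>i\<in>UNIV. of_real (of_int (k i) - of_int (l i)) *s period_basis ?\<Omega> i) = 0"
      by (simp add: sum_subtractf vector_ssub_ldistrib vector_sub_rdistrib)
    then have "real_of_int (k i) - of_int (l i) = 0" for i
      using period_basis_independent[OF assms, where c = "\<lambda>i. of_int (k i) - of_int (l i)"] by blast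
    then show "k = l" by (auto simp: fun_eq_iff)
  qed
  show "range ?f = period_lattice ?\<Omega>"
  proof
    show "range ?f \<subseteq> period_lattice ?\<Omega>"
    proof
      fix v assume "v \<in> range ?f"
      then obtain k where "v = ?f k" by blast
      then have "v = (\<chi> i. of_int ((\<chi> i. if i = 1 then k 1 else k 2) $ i)) v* ?\<Omega>
          + (\<chi> i. of_int ((\<chi> i. if i = 1 then k 3 else k 4) $ i))"
        unfolding sum_period_basis by (simp add: if_distrib cong: if_cong)
      then show "v \<in> period_lattice ?\<Omega>" unfolding period_lattice_def by blast
    qed
    show "period_lattice ?\<Omega> \<subseteq> range ?f"
    proof
      fix v assume "v \<in> period_lattice ?\<Omega>"
      then obtain m n :: "int^2" where v:
        "v = (\<chi> i. of_int (m $ i)) v* ?\<Omega> + (\<chi> i. of_int (n $ i))"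
        unfolding period_lattice_def by blast
      define k :: "4 \<Rightarrow> int" where "k i = (if i = 1 then m $ 1 else if i = 2 then m $ 2
        else if i = 3 then n $ 1 else n $ 2)" for i
      have "v = ?f k"
        unfolding sum_period_basis v k_def
        by (simp add: vec_eq_iff forall_2 vector_matrix_mult_def sum_2)
      then show "v \<in> range ?f" by blast
    qed
  qed
qed

lemma is_lattice_period_lattice:
  assumes "\<bar>Im z\<bar> < Im \<tau>"
  shows "is_lattice (period_lattice (period_matrix \<tau> z))"
proof -
  have "c *\<^sub>R v = of_real c *s v" for c and v :: "complex^2"
    by (simp add: vec_eq_iff scaleR_conv_of_real[where ?'a = complex])
  then show ?thesis
    unfolding is_lattice_def
    using zbasis_period_basis[OF assms] period_basis_independent[OF assms] by auto
qed

lemma E_Omega_period_basis: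
  fixes k l :: "4 \<Rightarrow> int"
  shows "E_Omega (\<Sum>i\<in>UNIV. of_int (k i) *s period_basis (period_matrix \<tau> z) i)
      (\<Sum>i\<in>UNIV. of_int (l i) *s period_basis (period_matrix \<tau> z) i) =
    of_int (k 1 * l 3 + k 2 * l 4 - k 3 * l 1 - k 4 * l 2) * Im \<tau> +
    of_int (k 1 * l 4 + k 2 * l 3 - k 3 * l 2 - k 4 * l 1) * Im z"
  unfolding sum_period_basis
  by (simp add: E_Omega_def H_Omega_def vector_matrix_mult_def sum_2 period_matrix_def)
     (simp add: algebra_simps)

text \<open>
  A semi-character exists, but it is unique only up to multiplication by homomorphisms from
  the lattice to the unit circle.
\<close>

lemma semicharacter_exists:
  assumes "\<bar>Im z\<bar> < Im \<tau>" and "Im \<tau> \<in> \<int>" and "Im z \<in> \<int>"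
  shows "\<exists>chi. semicharacter (period_lattice (period_matrix \<tau> z)) E_Omega chi"
proof -
  obtain a b :: int where ab: "Im \<tau> = of_int a" "Im z = of_int b"
    using assms by (auto elim!: Ints_cases)
  let ?L = "period_lattice (period_matrix \<tau> z)"
  define f where
    "f = (\<lambda>k::4 \<Rightarrow> int. \<Sum>i\<in>UNIV. of_int (k i) *s period_basis (period_matrix \<tau> z) i)"
  have bij: "bij_betw f UNIV ?L"
    using zbasis_period_basis[OF assms(1)] by (simp add: zbasis_def f_def)
  define B :: "(4 \<Rightarrow> int) \<Rightarrow> (4 \<Rightarrow> int) \<Rightarrow> int" where
    "B k l = (k 1 * l 3 + k 2 * l 4) * a + (k 1 * l 4 + k 2 * l 3) * b" for k l
  define chi where "chi v = cis (pi * of_int (B (inv f v) (inv f v)))" for v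
  have chi_f: "chi (f k) = cis (pi * of_int (B k k))" for k
    using bij by (simp add: chi_def bij_betw_def inv_f_f)
  have E: "E_Omega (f k) (f l) = of_int (B k l - B l k)" for k l
    by (simp add: f_def E_Omega_period_basis ab B_def algebra_simps)
  have add: "f k + f l = f (\<lambda>i. k i + l i)" for k l
    by (simp add: f_def sum.distrib vector_sadd_rdistrib)
  have "chi (f k + f l) = chi (f k) * chi (f l) * exp (\<i> * of_real pi * of_real (E_Omega (f k) (f l)))"
    for k l
  proof -
    have "B (\<lambda>i. k i + l i) (\<lambda>i. k i + l i) = (B k k + B l l + (B k l - B l k)) + 2 * B l k"
      by (simp add: B_def algebra_simps)
    then have "chi (f k + f l) =
        cis (pi * of_int (B k k + B l l + (B k l - B l k))) * cis (2 * pi * of_int (B l k))"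
      by (simp add: add chi_f cis_mult algebra_simps)
    also have "cis (2 * pi * of_int (B l k)) = 1" by (rule cis_multiple_2pi) simp
    also have "cis (pi * of_int (B k k + B l l + (B k l - B l k))) * 1 =
        chi (f k) * chi (f l) * cis (pi * E_Omega (f k) (f l))"
      by (simp add: chi_f E cis_mult algebra_simps)
    finally show ?thesis by (simp add: cis_conv_exp mult.assoc)
  qed
  moreover have "cmod (chi v) = 1" for v by (simp add: chi_def)
  moreover have "?L = range f" using bij by (simp add: bij_betw_def)
  ultimately have "semicharacter ?L E_Omega chi" unfolding semicharacter_def by auto
  then show ?thesis by blast
qed

end

theory Submission
  imports Defs "HOL-Complex_Analysis.Complex_Analysis"
begin

text \<open>
  Write \<open>A = Im \<tau>\<close> and \<open>B = Im z\<close>, and let \<open>Y\<close> be the circulant matrix with rows \<open>(A, B)\<close>, \<open>(B, A)\<close>, so that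
  \<open>Y = Im \<Omega>\<close>. In the basis formed by the rows of \<open>\<Omega>\<close> and the unit vectors, \<open>E\<close> has the Gram matrix with
  blocks \<open>0, Y, -Y, 0\<close>. This gives the integrality of \<open>E\<close> and \<open>det E = (A\<^sup>2 - B\<^sup>2)\<^sup>2\<close>.

  \<^bold>\<open>Sections.\<close> A section \<open>\<theta>\<close> of the \<open>N\<close>-th power becomes, after multiplication by
  \<open>exp (- N \<pi> z \<cdot> z / 2)\<close>, periodic under \<open>\<int>\<^sup>2\<close> up to a character, and thus has Fourier coefficients indexed
  by \<open>k \<in> \<int>\<^sup>2\<close>. Translation by \<open>m \<Omega>\<close> turns the automorphy condition into a recursion that relates the
  coefficients at \<open>k\<close> and at \<open>k + N m Y\<close> (\<open>theta_coefficients_coeff\<close>). Solutions of the recursion decay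
  like \<open>exp (- \<pi> |k|\<^sup>2 / N)\<close> and hence define sections (\<open>theta_series_section\<close>). So a section is determined by
  arbitrary coefficients on representatives of \<open>\<int>\<^sup>2\<close> modulo \<open>N \<int>\<^sup>2 Y\<close>, of which there are
  \<open>N\<^sup>2 (A\<^sup>2 - B\<^sup>2)\<close> (\<open>circ_representatives\<close>). This is the dimension formula \<open>dim_V\<close>.

  \<^bold>\<open>Embedding.\<close> The argument is that of Lefschetz. For \<open>a\<^sub>1 + \<dots> + a\<^sub>n = 0\<close> the product of the translates
  \<open>\<theta> (z + a\<^sub>i)\<close> of a section \<open>\<theta>\<close> of the bundle is a section of its \<open>n\<close>-th power (\<open>product_section\<close>). For
  \<open>n \<ge> 3\<close> one translation is free while another avoids the zeros of \<open>\<theta>\<close>. If \<open>z\<^sub>1\<close> and \<open>z\<^sub>2\<close> are not separated,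
  the quotient \<open>\<theta> (z\<^sub>1 + a) / \<theta> (z\<^sub>2 + a)\<close> is therefore entire without zeros as a function of \<open>a\<close>, and
  periodicity forces it to be the exponential of an affine function (\<open>unseparated_translation\<close>). So
  translation by \<open>w = z\<^sub>1 - z\<^sub>2\<close> preserves every section of the bundle up to an exponential factor. In terms of
  Fourier coefficients this is only possible for \<open>w \<in> L\<close> (\<open>translation_in_lattice\<close>). The logarithmic
  derivative of \<open>\<theta>\<close> in place of the quotient deals with tangent vectors. The resulting injective immersion
  is a closed embedding, because the torus is compact and projective space is Hausdorff.
\<close>

no_notation fps_nth (infixl \<open>$\<close> 75)
no_notation Infinite_Set_Sum.abs_summable_on (infix \<open>abs'_summable'_on\<close> 50)

section \<open>Holomorphic functions of two variables\<close>

lemma scaleR_eq_smult: "r *\<^sub>R (v :: complex^2) = complex_of_real r *s v"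
  by (simp add: vec_eq_iff scaleR_conv_of_real[where ?'a = complex])

lemma holomorphic_on2I:
  assumes "\<And>z. z \<in> S \<Longrightarrow> (f has_derivative D z) (at z)" "\<And>z c v. z \<in> S \<Longrightarrow> D z (c *s v) = c * D z v"
  shows "holomorphic_on2 f S"
  using assms unfolding holomorphic_on2_def by blast

lemma holomorphic_on2E:
  assumes "holomorphic_on2 f S" "z \<in> S"
  obtains D where "(f has_derivative D) (at z)" "\<And>c v. D (c *s v) = c * D v"
  using assms unfolding holomorphic_on2_def by blast

lemma holomorphic_on2_subset: "holomorphic_on2 f S \<Longrightarrow> T \<subseteq> S \<Longrightarrow> holomorphic_on2 f T"
  unfolding holomorphic_on2_def by blast

lemma holomorphic_on2_const [intro]: "holomorphic_on2 (\<lambda>z. c) S"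
  by (rule holomorphic_on2I[of S _ "\<lambda>_ _. 0"]) auto

lemma holomorphic_on2_linear:
  assumes "\<And>u v. l (u + v) = l u + l v" "\<And>c v. l (c *s v) = c * l v"
  shows "holomorphic_on2 l S"
proof (rule holomorphic_on2I[of S _ "\<lambda>_. l"])
  have "linear l" by (rule linearI) (auto simp: assms scaleR_eq_smult scaleR_conv_of_real)
  then show "(l has_derivative l) (at z)" for z
    by (simp add: bounded_linear_imp_has_derivative linear_conv_bounded_linear)
qed (simp add: assms)

lemma holomorphic_on2_add [intro]:
  assumes "holomorphic_on2 f S" "holomorphic_on2 g S"
  shows "holomorphic_on2 (\<lambda>z. f z + g z) S"
  unfolding holomorphic_on2_def
proof
  fix z assume z: "z \<in> S"
  obtain D where D: "(f has_derivative D) (at z)" "\<And>c v. D (c *s v) = c * D v"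
    using assms(1) z by (rule holomorphic_on2E) blast
  obtain D' where D': "(g has_derivative D') (at z)" "\<And>c v. D' (c *s v) = c * D' v"
    using assms(2) z by (rule holomorphic_on2E) blast
  show "\<exists>D. ((\<lambda>z. f z + g z) has_derivative D) (at z) \<and> (\<forall>c v. D (c *s v) = c * D v)"
    by (rule exI[of _ "\<lambda>h. D h + D' h"]) (simp add: D D' has_derivative_add distrib_left)
qed

lemma holomorphic_on2_mult [intro]:
  assumes "holomorphic_on2 f S" "holomorphic_on2 g S"
  shows "holomorphic_on2 (\<lambda>z. f z * g z) S"
  unfolding holomorphic_on2_def
proof
  fix z assume z: "z \<in> S"
  obtain D where D: "(f has_derivative D) (at z)" "\<And>c v. D (c *s v) = c * D v"
    using assms(1) z by (rule holomorphic_on2E) blast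
  obtain D' where D': "(g has_derivative D') (at z)" "\<And>c v. D' (c *s v) = c * D' v"
    using assms(2) z by (rule holomorphic_on2E) blast
  show "\<exists>D. ((\<lambda>z. f z * g z) has_derivative D) (at z) \<and> (\<forall>c v. D (c *s v) = c * D v)"
    by (rule exI[of _ "\<lambda>h. f z * D' h + D h * g z"])
      (use has_derivative_mult[OF D(1) D'(1)] in \<open>auto simp: D(2) D'(2) distrib_left mult_ac\<close>)
qed

lemma holomorphic_on2_compose:
  assumes "holomorphic_on2 f S" "\<And>z. z \<in> S \<Longrightarrow> g field_differentiable at (f z)"
  shows "holomorphic_on2 (\<lambda>z. g (f z)) S"
  unfolding holomorphic_on2_def
proof
  fix z assume z: "z \<in> S"
  obtain D where D: "(f has_derivative D) (at z)" "\<And>c v. D (c *s v) = c * D v"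
    using assms(1) z by (rule holomorphic_on2E) blast
  have "(g has_field_derivative deriv g (f z)) (at (f z))"
    using assms(2)[OF z] by (simp add: field_differentiable_derivI)
  then have "(g has_derivative (\<lambda>x. deriv g (f z) * x)) (at (f z))"
    by (simp add: has_field_derivative_def)
  from has_derivative_compose[OF D(1) this]
  show "\<exists>D. ((\<lambda>z. g (f z)) has_derivative D) (at z) \<and> (\<forall>c v. D (c *s v) = c * D v)"
    by (intro exI[of _ "\<lambda>h. deriv g (f z) * D h"]) (auto simp: D)
qed

lemma holomorphic_on2_exp [intro]: "holomorphic_on2 f S \<Longrightarrow> holomorphic_on2 (\<lambda>z. exp (f z)) S"
  by (rule holomorphic_on2_compose[where g = exp]) (auto intro: field_differentiable_within_exp)

lemma holomorphic_on2_power [intro]: "holomorphic_on2 f S \<Longrightarrow> holomorphic_on2 (\<lambda>z. f z ^ n) S"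
  by (induction n) auto

lemma holomorphic_on2_inverse:
  "holomorphic_on2 f S \<Longrightarrow> (\<And>z. z \<in> S \<Longrightarrow> f z \<noteq> 0) \<Longrightarrow> holomorphic_on2 (\<lambda>z. inverse (f z)) S"
  by (rule holomorphic_on2_compose[where g = inverse]) (auto intro: field_differentiable_inverse field_differentiable_ident)

lemma holomorphic_on2_divide:
  "holomorphic_on2 f S \<Longrightarrow> holomorphic_on2 g S \<Longrightarrow> (\<And>z. z \<in> S \<Longrightarrow> g z \<noteq> 0) \<Longrightarrow>
    holomorphic_on2 (\<lambda>z. f z / g z) S"
  unfolding divide_inverse by (intro holomorphic_on2_mult holomorphic_on2_inverse)

lemma holomorphic_on2_minus [intro]: "holomorphic_on2 f S \<Longrightarrow> holomorphic_on2 (\<lambda>z. - f z) S"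
  using holomorphic_on2_mult[OF holomorphic_on2_const[of "-1"]] by fastforce

lemma holomorphic_on2_diff [intro]:
  "holomorphic_on2 f S \<Longrightarrow> holomorphic_on2 g S \<Longrightarrow> holomorphic_on2 (\<lambda>z. f z - g z) S"
  using holomorphic_on2_add[OF _ holomorphic_on2_minus] by fastforce

lemma holomorphic_on2_cong:
  assumes "open S" "\<And>z. z \<in> S \<Longrightarrow> f z = g z" "holomorphic_on2 g S"
  shows "holomorphic_on2 f S"
  unfolding holomorphic_on2_def
proof
  fix z assume z: "z \<in> S"
  obtain D where D: "(g has_derivative D) (at z)" "\<And>c v. D (c *s v) = c * D v"
    using assms(3) z by (rule holomorphic_on2E) blast
  have "(f has_derivative D) (at z)"
    by (rule has_derivative_transform_within_open[OF D(1) \<open>open S\<close> z]) (simp add: assms(2))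
  then show "\<exists>D. (f has_derivative D) (at z) \<and> (\<forall>c v. D (c *s v) = c * D v)" using D by blast
qed

lemma holomorphic_on2_continuous_at:
  "holomorphic_on2 f S \<Longrightarrow> z \<in> S \<Longrightarrow> isCont f z"
  by (meson has_derivative_continuous holomorphic_on2E)

lemma holomorphic_on2_continuous_on: "holomorphic_on2 f S \<Longrightarrow> continuous_on S f"
  by (simp add: continuous_at_imp_continuous_on holomorphic_on2_continuous_at)

lemma holomorphic_on2_affine:
  assumes "holomorphic_on2 f UNIV"
  shows "holomorphic_on2 (\<lambda>z. f (r *\<^sub>R z + u)) S"
  unfolding holomorphic_on2_def
proof
  fix z
  obtain D where D: "(f has_derivative D) (at (r *\<^sub>R z + u))" "\<And>c v. D (c *s v) = c * D v"
    using assms by (rule holomorphic_on2E) auto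
  have "((\<lambda>z. r *\<^sub>R z + u) has_derivative (\<lambda>h. r *\<^sub>R h)) (at z)"
    by (auto intro!: derivative_eq_intros)
  from has_derivative_compose[OF this D(1)]
  have "((\<lambda>z. f (r *\<^sub>R z + u)) has_derivative (\<lambda>h. D (r *\<^sub>R h))) (at z)" .
  moreover have "D (r *\<^sub>R (c *s v)) = c * D (r *\<^sub>R v)" for c v
    by (simp add: scaleR_eq_smult D vector_smult_assoc mult.commute)
  ultimately show "\<exists>D. ((\<lambda>z. f (r *\<^sub>R z + u)) has_derivative D) (at z) \<and> (\<forall>c v. D (c *s v) = c * D v)"
    by blast
qed

lemma holomorphic_on2_shift:
  assumes "holomorphic_on2 f UNIV"
  shows "holomorphic_on2 (\<lambda>z. f (z + u)) S" "holomorphic_on2 (\<lambda>z. f (u + z)) S"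
    "holomorphic_on2 (\<lambda>z. f (u - z)) S"
  using holomorphic_on2_affine[OF assms, of 1 u S] holomorphic_on2_affine[OF assms, of "-1" u S]
  by (simp_all add: add.commute)

lemma linear_smult_vector: "linear (\<lambda>t. t *s (h :: complex^2))"
  by (rule linearI) (simp_all add: vec_eq_iff algebra_simps)

text \<open>Restriction to a complex line reduces many questions to one variable.\<close>

lemma has_field_derivative_on_line:
  fixes f :: "complex^2 \<Rightarrow> complex"
  assumes "(f has_derivative D) (at (z + t *s h))" "\<And>c v. D (c *s v) = c * D v"
  shows "((\<lambda>t. f (z + t *s h)) has_field_derivative D h) (at t)"
proof -
  have "((\<lambda>t. t *s h) has_derivative (\<lambda>t. t *s h)) (at t)"
    by (intro bounded_linear_imp_has_derivative linear_conv_bounded_linear[THEN iffD1] linear_smult_vector)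
  then have "((\<lambda>t. z + t *s h) has_derivative (\<lambda>t. t *s h)) (at t)"
    using has_derivative_add[OF has_derivative_const] by fastforce
  from has_derivative_compose[OF this assms(1)]
  have "((\<lambda>t. f (z + t *s h)) has_derivative (\<lambda>t. t * D h)) (at t)"
    by (simp add: assms(2))
  then show ?thesis
    by (simp add: has_field_derivative_def mult.commute[of _ "D h"])
qed

lemma holomorphic_on_line:
  assumes "holomorphic_on2 f UNIV"
  shows "(\<lambda>t. f (z + t *s h)) holomorphic_on S"
proof -
  have "(\<lambda>t. f (z + t *s h)) field_differentiable at t" for t
  proof -
    obtain D where "(f has_derivative D) (at (z + t *s h))" "\<And>c v. D (c *s v) = c * D v"
      using assms by (rule holomorphic_on2E) auto
    then show ?thesis using has_field_derivative_on_line unfolding field_differentiable_def by blast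
  qed
  then show ?thesis by (simp add: holomorphic_on_def field_differentiable_at_within)
qed

text \<open>Liouville's theorem, by restriction to lines.\<close>

lemma bounded_entire_constant:
  assumes "holomorphic_on2 f UNIV" "\<And>z. norm (f z) \<le> B"
  shows "f z = f w"
proof -
  have "(\<lambda>t. f (w + t *s (z - w))) holomorphic_on UNIV" by (rule holomorphic_on_line[OF assms(1)])
  moreover have "bounded (range (\<lambda>t. f (w + t *s (z - w))))"
    using assms(2) by (auto simp: bounded_iff)
  ultimately obtain c where c: "\<And>t. f (w + t *s (z - w)) = c"
    using Liouville_theorem unfolding constant_on_def by blast
  from c[of 0] c[of 1] show ?thesis by simp
qed

text \<open>
  On the complex line through \<open>w\<close> and \<open>u\<close> the function does not vanish identically, so that the
  identity theorem in one variable applies.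
\<close>

lemma entire_nonzero_dense:
  assumes f: "holomorphic_on2 f UNIV" and u: "f u \<noteq> 0" and W: "open W" "w \<in> W"
  shows "\<exists>v\<in>W. f v \<noteq> 0"
proof (rule ccontr)
  assume "\<not> (\<exists>v\<in>W. f v \<noteq> 0)"
  then have zero: "\<And>v. v \<in> W \<Longrightarrow> f v = 0" by auto
  define g where "g t = f (w + t *s (u - w))" for t
  have hol: "g holomorphic_on UNIV" unfolding g_def by (rule holomorphic_on_line[OF f])
  have "continuous_on UNIV (\<lambda>t::complex. w + t *s (u - w))"
    by (intro continuous_intros linear_continuous_on
        linear_conv_bounded_linear[THEN iffD1] linear_smult_vector)
  then have op: "open ((\<lambda>t::complex. w + t *s (u - w)) -` W)"
    using W(1) by (rule open_vimage[rotated])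
  have "0 \<in> (\<lambda>t::complex. w + t *s (u - w)) -` W" using W(2) by simp
  with op obtain e where e: "e > 0" "ball 0 e \<subseteq> (\<lambda>t::complex. w + t *s (u - w)) -` W"
    by (rule openE)
  have "g 1 = 0"
  proof (rule analytic_continuation[OF hol open_UNIV connected_UNIV, of "ball 0 e" 0])
    show "(0::complex) islimpt ball 0 e" using e(1) by (intro interior_limit_point) simp
    show "g t = 0" if "t \<in> ball 0 e" for t
      unfolding g_def by (rule zero) (use that e(2) in blast)
  qed auto
  then show False using u by (simp add: g_def)
qed

lemma entire_product_nonzero:
  assumes "holomorphic_on2 f UNIV" "f u \<noteq> 0" "holomorphic_on2 g UNIV" "g v \<noteq> 0"
  shows "\<exists>w. f w \<noteq> 0 \<and> g w \<noteq> 0"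
proof -
  have "continuous_on UNIV g" using assms(3) by (rule holomorphic_on2_continuous_on)
  then have "open {w. g w \<noteq> 0}" by (intro open_Collect_neq) auto
  from entire_nonzero_dense[OF assms(1,2) this, of v] assms(4) show ?thesis by auto
qed

text \<open>Where \<open>G\<close> vanishes, the quotient \<open>F/G\<close> is determined by continuity.\<close>

lemma quotient_unique:
  assumes G: "holomorphic_on2 G UNIV" "G u \<noteq> 0" and W: "open W" "w \<in> W"
    and "holomorphic_on2 g W" "holomorphic_on2 g' W"
    and eq: "\<And>a. a \<in> W \<Longrightarrow> g a * G a = g' a * G a"
  shows "g w = g' w"
proof (rule ccontr)
  assume ne: "g w \<noteq> g' w"
  have "continuous_on W (\<lambda>a. g a - g' a)"
    by (intro holomorphic_on2_continuous_on holomorphic_on2_diff assms)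
  then have "open ((\<lambda>a. g a - g' a) -` (- {0}) \<inter> W)"
    using W(1) by (simp add: continuous_on_open_vimage open_Compl)
  moreover have "w \<in> (\<lambda>a. g a - g' a) -` (- {0}) \<inter> W" using ne W by auto
  ultimately obtain v where "v \<in> (\<lambda>a. g a - g' a) -` (- {0}) \<inter> W" "G v \<noteq> 0"
    using entire_nonzero_dense[OF G] by blast
  with eq[of v] show False by auto
qed

text \<open>
  Local divisibility by a fixed entire function implies global divisibility: the local quotients
  agree on overlaps by uniqueness. The predicate \<open>P\<close> carries a pointwise property of the local
  quotients, such as being nonzero, over to the global one.
\<close>

lemma quotient_patch:
  assumes G: "holomorphic_on2 G UNIV" "G u \<noteq> 0"
    and loc: "\<And>w. \<exists>W g. open W \<and> w \<in> W \<and> holomorphic_on2 g W \<and> (\<forall>a\<in>W. F a = g a * G a) \<and> P (g w)"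
  shows "\<exists>g. holomorphic_on2 g UNIV \<and> (\<forall>a. F a = g a * G a) \<and> (\<forall>a. P (g a))"
proof -
  from loc have "\<forall>w. \<exists>W g. open W \<and> w \<in> W \<and> holomorphic_on2 g W \<and> (\<forall>a\<in>W. F a = g a * G a) \<and> P (g w)"
    by blast
  then obtain W g where "\<forall>w. open (W w) \<and> w \<in> W w \<and> holomorphic_on2 (g w) (W w)
      \<and> (\<forall>a\<in>W w. F a = g w a * G a) \<and> P (g w w)"
    unfolding choice_iff by blast
  then have Wg: "\<And>w. open (W w)" "\<And>w. w \<in> W w" "\<And>w. holomorphic_on2 (g w) (W w)"
    "\<And>w a. a \<in> W w \<Longrightarrow> F a = g w a * G a" "\<And>w. P (g w w)"
    by blast+
  define q where "q w = g w w" for w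
  have q: "q a = g w a" if "a \<in> W w" for a w
    unfolding q_def
  proof (rule quotient_unique[OF G, of "W a \<inter> W w" a "g a" "g w"])
    show "open (W a \<inter> W w)" "a \<in> W a \<inter> W w" using Wg that by auto
    show "holomorphic_on2 (g a) (W a \<inter> W w)" "holomorphic_on2 (g w) (W a \<inter> W w)"
      using Wg(3) holomorphic_on2_subset by blast+
    show "g a x * G x = g w x * G x" if "x \<in> W a \<inter> W w" for x using Wg(4)[of x a] Wg(4)[of x w] that by auto
  qed
  have "holomorphic_on2 q (W w)" for w
    by (rule holomorphic_on2_cong[OF Wg(1) _ Wg(3)]) (simp add: q)
  then have "holomorphic_on2 q UNIV" using Wg(2) unfolding holomorphic_on2_def by blast
  moreover have "F a = q a * G a" "P (q a)" for a using Wg(2,4,5)[of a] by (auto simp: q_def)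
  ultimately show ?thesis by blast
qed


text \<open>
  An entire homomorphism from \<open>\<complex>\<^sup>2\<close> to the multiplicative (additive) group is the exponential of a
  linear form (a linear form): along each line it solves a linear differential equation.
\<close>

lemma entire_multiplicative:
  assumes f: "holomorphic_on2 f UNIV" and mult: "\<And>u v. f (u + v) = f u * f v" and one: "f 0 = 1"
  shows "\<exists>D. (\<forall>u v. D (u + v) = D u + D v) \<and> (\<forall>c v. D (c *s v) = c * D v) \<and> (\<forall>u. f u = exp (D u))"
proof -
  obtain D where D: "(f has_derivative D) (at 0)" "\<And>c v. D (c *s v) = c * D v"
    using f by (rule holomorphic_on2E) auto
  have "f u = exp (D u)" for u
  proof -
    define g where "g t = f (t *s u)" for t
    have g0: "(g has_field_derivative D u) (at 0)"
      using has_field_derivative_on_line[of f D 0 0 u] D by (simp add: g_def[abs_def])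
    have g: "(g has_field_derivative D u * g t) (at t)" for t
    proof -
      have "((\<lambda>s. g (s - t) * g t) has_field_derivative D u * g t) (at t)"
        using g0 DERIV_shift[of g "D u" t "- t"] by (intro DERIV_cmult_right) simp
      moreover have "g (s - t) * g t = g s" for s
        unfolding g_def mult[symmetric] by (simp add: vector_sadd_rdistrib[symmetric])
      ultimately show ?thesis by simp
    qed
    define k where "k t = g t * exp (- (t * D u))" for t
    have "(k has_field_derivative 0) (at t)" for t
      unfolding k_def by (auto intro!: derivative_eq_intros g simp: algebra_simps)
    then have "k 1 = k 0" using has_field_derivative_zero_constant[of UNIV k] by force
    then show ?thesis by (simp add: k_def g_def one exp_minus field_simps)
  qed
  moreover have "D (u + v) = D u + D v" for u v
    using D(1) has_derivative_linear linear_add by blast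
  ultimately show ?thesis using D(2) by blast
qed

lemma entire_additive:
  fixes f :: "complex^2 \<Rightarrow> complex"
  assumes f: "holomorphic_on2 f UNIV" and add: "\<And>u v. f (u + v) = f u + f v"
  shows "f (c *s v) = c * f v"
proof -
  obtain D where D: "(f has_derivative D) (at 0)" "\<And>c v. D (c *s v) = c * D v"
    using f by (rule holomorphic_on2E) auto
  have zero: "f 0 = 0" using add[of 0 0] by simp
  have "f u = D u" for u
  proof -
    define g where "g t = f (t *s u)" for t
    have g0: "(g has_field_derivative D u) (at 0)"
      using has_field_derivative_on_line[of f D 0 0 u] D by (simp add: g_def[abs_def])
    have g: "(g has_field_derivative D u) (at t)" for t
    proof -
      have "((\<lambda>s. g (s - t) + g t) has_field_derivative D u) (at t)"
        using g0 DERIV_shift[of g "D u" t "- t"] DERIV_add[OF _ DERIV_const] by fastforce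
      moreover have "g (s - t) + g t = g s" for s
        unfolding g_def add[symmetric] by (simp add: vector_sadd_rdistrib[symmetric])
      ultimately show ?thesis by simp
    qed
    define k where "k t = g t - t * D u" for t
    have "(k has_field_derivative 0) (at t)" for t
      unfolding k_def by (auto intro!: derivative_eq_intros g simp: algebra_simps)
    then have "k 1 = k 0" using has_field_derivative_zero_constant[of UNIV k] by force
    then show ?thesis by (simp add: k_def g_def zero)
  qed
  then show ?thesis using D(2) by simp
qed


section \<open>Fourier analysis of periodic entire functions\<close>

definition e2pi :: "complex \<Rightarrow> complex" where
  "e2pi t = exp (2 * of_real pi * \<i> * t)"

lemma e2pi_add: "e2pi (s + t) = e2pi s * e2pi t"
  by (simp add: e2pi_def distrib_left exp_add)

lemma e2pi_0 [simp]: "e2pi 0 = 1"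
  by (simp add: e2pi_def)

lemma e2pi_nonzero [simp]: "e2pi t \<noteq> 0"
  by (simp add: e2pi_def)

lemma e2pi_minus: "e2pi (- t) = inverse (e2pi t)"
  by (simp add: e2pi_def exp_minus)

lemma e2pi_diff: "e2pi (s - t) = e2pi s / e2pi t"
  by (simp add: e2pi_def right_diff_distrib exp_diff)

lemma e2pi_eq_1_iff: "e2pi t = 1 \<longleftrightarrow> t \<in> \<int>"
proof
  assume "e2pi t = 1"
  then obtain n :: int where "Im t = 0" "2 * pi * Re t = of_int (2 * n) * pi"
    unfolding e2pi_def exp_eq_1 by auto
  then have "t = of_int n" by (simp add: complex_eq_iff)
  then show "t \<in> \<int>" by simp
next
  assume "t \<in> \<int>"
  then obtain n where "t = of_int n" by (auto elim: Ints_cases)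
  then show "e2pi t = 1" using exp_integer_2pi[of "of_int n"] by (simp add: e2pi_def mult_ac)
qed

lemma e2pi_of_int [simp]: "e2pi (of_int n) = 1"
  by (simp add: e2pi_eq_1_iff)

lemma norm_e2pi: "norm (e2pi t) = exp (- (2 * pi * Im t))"
  by (simp add: e2pi_def)

lemma e2pi_power: "e2pi t ^ n = e2pi (of_nat n * t)"
  by (simp add: e2pi_def exp_of_nat_mult[symmetric] mult_ac)

lemma continuous_on_e2pi [continuous_intros]:
  "continuous_on S f \<Longrightarrow> continuous_on S (\<lambda>x. e2pi (f x))"
  unfolding e2pi_def by (intro continuous_intros)

lemma holomorphic_on2_e2pi: "holomorphic_on2 f S \<Longrightarrow> holomorphic_on2 (\<lambda>z. e2pi (f z)) S"
  unfolding e2pi_def by (intro holomorphic_on2_exp holomorphic_on2_mult holomorphic_on2_const)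


subsection \<open>One variable\<close>

text \<open>
  An entire function of period 1 has a primitive \<open>P\<close>, and \<open>P (t + 1) - P t\<close> does not depend on
  \<open>t\<close>. So the mean over a period does not change when the path is shifted, even off the real axis.
\<close>

lemma periodic_entire_mean_shift:
  assumes g: "g holomorphic_on UNIV" and per: "\<And>t. g (t + 1) = g t"
  shows "integral {0..1} (\<lambda>x. g (of_real x + v)) = integral {0..1} (\<lambda>x. g (of_real x))"
proof -
  obtain P where P: "\<And>t. (P has_field_derivative g t) (at t)"
    using holomorphic_convex_primitive'[of UNIV g] g by auto
  have int: "integral {0..1} (\<lambda>x. g (of_real x + v)) = P (1 + v) - P v" for v
  proof (rule integral_unique)
    have "((\<lambda>x. P (of_real x + v)) has_vector_derivative g (of_real x + v)) (at x within {0..1})"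
      for x :: real
      using has_vector_derivative_real_field[of "\<lambda>t. P (t + v)" "g (of_real x + v)" x]
        P[of "of_real x + v"] DERIV_shift[of P] by blast
    then have "((\<lambda>x. g (of_real x + v)) has_integral (P (of_real 1 + v) - P (of_real 0 + v))) {0..1}"
      by (intro fundamental_theorem_of_calculus) auto
    then show "((\<lambda>x. g (of_real x + v)) has_integral (P (1 + v) - P v)) {0..1}" by simp
  qed
  have "((\<lambda>v. P (1 + v) - P v) has_field_derivative 0) (at v)" for v
  proof -
    have "((\<lambda>v. P (1 + v)) has_field_derivative g (1 + v)) (at v)"
      using P[of "1 + v"] DERIV_shift[of P "g (1 + v)" v 1] by (simp add: add.commute)
    from DERIV_diff[OF this P[of v]] show ?thesis using per[of v] by (simp add: add.commute)
  qed
  then obtain c where c: "\<And>v. P (1 + v) - P v = c"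
    using has_field_derivative_zero_constant[of UNIV "\<lambda>v. P (1 + v) - P v"] by auto
  then show ?thesis using int[of v] int[of 0] c[of 0] by simp
qed

lemma entire_zero_of_unit_interval:
  assumes g: "g holomorphic_on UNIV" and zero: "\<And>x. x \<in> {0..1} \<Longrightarrow> g (of_real x) = 0"
  shows "g t = 0"
proof (rule analytic_continuation[OF g open_UNIV connected_UNIV, of "of_real ` {0..1}" 0])
  show "(0::complex) islimpt of_real ` {0..1}"
    unfolding islimpt_approachable
  proof (intro allI impI)
    fix e :: real assume "e > 0"
    then have "min (e / 2) 1 \<in> {0..1}" "0 < min (e / 2) 1" "min (e / 2) 1 < e" by auto
    then show "\<exists>x'\<in>of_real ` {0..1}. x' \<noteq> (0::complex) \<and> dist x' 0 < e"
      by (intro bexI[of _ "of_real (min (e / 2) 1)"] imageI) (simp_all only: dist_0_norm dist_commute[of _ 0]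
        norm_of_real of_real_eq_0_iff, auto)
  qed
qed (use zero in auto)

text \<open>On the circle these include the restrictions of all real polynomials in two variables.\<close>

inductive trig_poly :: "(real \<Rightarrow> complex) \<Rightarrow> bool" where
  trig_monomial: "trig_poly (\<lambda>x. c * e2pi (of_int k * of_real x))"
| trig_add: "trig_poly f \<Longrightarrow> trig_poly g \<Longrightarrow> trig_poly (\<lambda>x. f x + g x)"

lemma trig_poly_monomial_mult:
  "trig_poly g \<Longrightarrow> trig_poly (\<lambda>x. c * e2pi (of_int k * of_real x) * g x)"
proof (induction rule: trig_poly.induct)
  case (trig_monomial d l)
  have "(\<lambda>x. c * e2pi (of_int k * of_real x) * (d * e2pi (of_int l * of_real x)))
    = (\<lambda>x. (c * d) * e2pi (of_int (k + l) * of_real x))"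
    by (simp add: e2pi_add algebra_simps)
  then show ?case using trig_poly.trig_monomial by metis
next
  case (trig_add f g)
  then show ?case using trig_poly.trig_add by (simp add: distrib_left)
qed

lemma trig_poly_mult: "trig_poly f \<Longrightarrow> trig_poly g \<Longrightarrow> trig_poly (\<lambda>x. f x * g x)"
  by (induction rule: trig_poly.induct)
    (auto simp: distrib_right intro: trig_poly_monomial_mult trig_poly.trig_add)

lemma trig_poly_const: "trig_poly (\<lambda>x. c)"
  using trig_monomial[of c 0] by simp

lemma trig_poly_of_real_polynomial:
  fixes p :: "complex \<Rightarrow> real"
  shows "real_polynomial_function p \<Longrightarrow> trig_poly (\<lambda>x. of_real (p (e2pi (of_real x))))"
proof (induction rule: real_polynomial_function.induct)
  case (linear f)
  define u v where "u = complex_of_real (f 1)" and "v = complex_of_real (f \<i>)"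
  have "of_real (f (e2pi (of_real x))) = (u - \<i> * v) / 2 * e2pi (of_int 1 * of_real x)
      + (u + \<i> * v) / 2 * e2pi (of_int (-1) * of_real x)" for x
  proof -
    define w where "w = e2pi (of_real x)"
    have "norm w = 1" by (simp add: w_def norm_e2pi)
    then have cnj: "e2pi (- of_real x) = cnj w"
      unfolding w_def[symmetric] e2pi_minus by (simp add: inverse_complex_def cmod_def complex_eq_iff)
    have "f w = f (Re w *\<^sub>R 1 + Im w *\<^sub>R \<i>)"
      by (rule arg_cong[where f = f]) (simp add: complex_eq_iff)
    also have "\<dots> = Re w * f 1 + Im w * f \<i>"
      using linear by (simp add: bounded_linear.linear linear_add linear_scale)
    finally show ?thesis
      by (simp add: cnj w_def[symmetric] u_def v_def complex_eq_iff algebra_simps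
          add_divide_distrib[symmetric])
  qed
  then show ?case using trig_monomial trig_add by presburger
next
  case (const c)
  show ?case by (rule trig_poly_const)
next
  case (add f g)
  then show ?case using trig_add by simp
next
  case (mult f g)
  then show ?case using trig_poly_mult by simp
qed

lemma trig_poly_of_polynomial:
  fixes p :: "complex \<Rightarrow> complex"
  assumes "polynomial_function p"
  shows "trig_poly (\<lambda>x. p (e2pi (of_real x)))"
proof -
  have "real_polynomial_function (Re \<circ> p)" "real_polynomial_function (Im \<circ> p)"
    using assms bounded_linear_Re bounded_linear_Im unfolding polynomial_function_def by blast+
  then have "trig_poly (\<lambda>x. of_real (Re (p (e2pi (of_real x)))) + \<i> * of_real (Im (p (e2pi (of_real x)))))"
    using trig_poly_of_real_polynomial trig_add trig_poly_mult trig_poly_const by (fastforce simp: o_def)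
  then show ?thesis by (simp flip: complex_eq)
qed

lemma trig_poly_continuous: "trig_poly f \<Longrightarrow> continuous_on S f"
  by (induction rule: trig_poly.induct) (auto intro!: continuous_intros)

text \<open>
  The parametrisation of the circle by \<open>{0..1}\<close> is a quotient map, as a continuous surjection from a
  compact space to a Hausdorff space. So the continuity of \<open>g\<close> passes to the function it induces.
\<close>

lemma continuous_on_circle:
  fixes g :: "real \<Rightarrow> complex"
  assumes g: "continuous_on {0..1} g" "g 0 = g 1"
  obtains G where "continuous_on (sphere 0 1) G" "\<And>x. x \<in> {0..1} \<Longrightarrow> G (e2pi (of_real x)) = g x"
proof -
  let ?\<phi> = "\<lambda>x. e2pi (of_real x)"
  define G where "G w = g (SOME x. x \<in> {0..1} \<and> ?\<phi> x = w)" for w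
  have G: "G (?\<phi> x) = g x" if x: "x \<in> {0..1}" for x
  proof -
    define y where "y = (SOME y. y \<in> {0..1} \<and> ?\<phi> y = ?\<phi> x)"
    have y: "y \<in> {0..1} \<and> ?\<phi> y = ?\<phi> x"
      unfolding y_def by (rule someI[of _ x]) (use x in auto)
    then have "e2pi (of_real (y - x)) = 1" by (simp add: e2pi_diff)
    then have "of_real (y - x) \<in> (\<int> :: complex set)" by (simp only: e2pi_eq_1_iff)
    then obtain n :: int where n: "y - x = of_int n"
      by (auto elim!: Ints_cases simp: complex_eq_iff)
    have "-1 \<le> n" "n \<le> 1" using n x y by auto
    then have "n = -1 \<or> n = 0 \<or> n = 1" by auto
    then have "y = x \<or> x = 1 \<and> y = 0 \<or> x = 0 \<and> y = 1" using n x y by auto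
    then have "g y = g x" using g(2) by auto
    then show ?thesis by (simp add: G_def y_def)
  qed
  have img: "?\<phi> ` {0..1} = sphere 0 1"
  proof
    show "?\<phi> ` {0..1} \<subseteq> sphere 0 1" by (auto simp: norm_e2pi)
    show "sphere 0 1 \<subseteq> ?\<phi> ` {0..1}"
    proof
      fix w :: complex assume "w \<in> sphere 0 1"
      then have "w = ?\<phi> (Arg2pi w / (2 * pi))"
        using Arg2pi_eq[of w] by (simp add: e2pi_def mult_ac)
      moreover have "Arg2pi w / (2 * pi) \<in> {0..1}"
        using Arg2pi_ge_0[of w] Arg2pi_lt_2pi[of w] by simp
      ultimately show "w \<in> ?\<phi> ` {0..1}" by blast
    qed
  qed
  have "quotient_map (top_of_set {0..1}) (top_of_set (sphere 0 1)) ?\<phi>"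
  proof (rule T1_Spaces.continuous_imp_quotient_map)
    show "continuous_map (top_of_set {0..1}) (top_of_set (sphere 0 1)) ?\<phi>"
      using img by (auto intro!: continuous_intros)
    show "compact_space (top_of_set {0..1::real})" by (simp add: compact_space_subtopology)
    show "Hausdorff_space (top_of_set (sphere 0 1 :: complex set))" by (simp add: Hausdorff_space_subtopology)
  qed (use img in auto)
  moreover have "continuous_map (top_of_set {0..1}) euclidean (G \<circ> ?\<phi>)"
    using continuous_on_eq[OF g(1), of "G \<circ> ?\<phi>"] G by (simp add: continuous_map_iff_continuous)
  ultimately have "continuous_map (top_of_set (sphere 0 1)) euclidean G"
    by (rule continuous_compose_quotient_map)
  then show ?thesis using that G by (simp add: continuous_map_iff_continuous)
qed

text \<open>
  By the Stone-Weierstrass theorem the conjugate of \<open>g\<close> is a uniform limit of trigonometric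
  polynomials. Hence \<open>g\<close> is orthogonal to itself if it is orthogonal to all characters.
\<close>

lemma fourier_coefficients_zero:
  fixes g :: "real \<Rightarrow> complex"
  assumes g: "continuous_on {0..1} g" "g 0 = g 1"
    and coeff: "\<And>k::int. integral {0..1} (\<lambda>x. g x * e2pi (of_int k * of_real x)) = 0"
    and x: "x \<in> {0..1}"
  shows "g x = 0"
proof -
  obtain G where G: "continuous_on (sphere 0 1) G" "\<And>x. x \<in> {0..1} \<Longrightarrow> G (e2pi (of_real x)) = g x"
    using continuous_on_circle[OF g] by blast
  have orth: "integral {0..1} (\<lambda>x. g x * h x) = 0" if "trig_poly h" for h
    using that
  proof (induction rule: trig_poly.induct)
    case (trig_monomial c k)
    have "integral {0..1} (\<lambda>x. g x * (c * e2pi (of_int k * of_real x)))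
      = integral {0..1} (\<lambda>x. c * (g x * e2pi (of_int k * of_real x)))" by (simp add: mult_ac)
    then show ?case using coeff[of k] by simp
  next
    case (trig_add p q)
    have "(\<lambda>x. g x * p x) integrable_on {0..1}" "(\<lambda>x. g x * q x) integrable_on {0..1}"
      by (intro integrable_continuous_real continuous_on_mult g(1)
          trig_poly_continuous[OF trig_add.hyps(1)] trig_poly_continuous[OF trig_add.hyps(2)])+
    then show ?case using trig_add.IH by (simp add: distrib_left integral_add)
  qed
  define I where "I = integral {0..1} (\<lambda>x. (norm (g x))\<^sup>2)"
  obtain B where B: "\<And>x. x \<in> {0..1} \<Longrightarrow> norm (g x) \<le> B"
    using compact_imp_bounded[OF compact_continuous_image[OF g(1)]] unfolding bounded_iff
    by (metis compact_Icc imageI)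
  have B0: "B \<ge> 0" using order_trans[OF norm_ge_zero B[of 0]] by simp
  have cont2: "continuous_on {0..1} (\<lambda>x. (norm (g x))\<^sup>2)" by (intro continuous_intros g)
  \<comment> \<open>Subtracting the integral against an approximating trigonometric polynomial changes nothing.\<close>
  have small: "\<bar>I\<bar> \<le> B * e" if "e > 0" for e
  proof -
    have "continuous_on (sphere 0 1) (\<lambda>w. cnj (G w))" by (intro continuous_intros G)
    then obtain p where p: "polynomial_function p" "\<And>w. w \<in> sphere 0 1 \<Longrightarrow> norm (cnj (G w) - p w) < e"
      using Stone_Weierstrass_polynomial_function[of "sphere 0 1" "\<lambda>w. cnj (G w)" e] \<open>e > 0\<close> by auto
    let ?p = "\<lambda>x. p (e2pi (of_real x))"
    have tp: "trig_poly ?p" by (rule trig_poly_of_polynomial[OF p(1)])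
    have ci: "continuous_on {0..1} ?p" by (rule trig_poly_continuous[OF tp])
    have "complex_of_real I = integral {0..1} (\<lambda>x. of_real ((norm (g x))\<^sup>2))"
      unfolding I_def
      using integral_linear[OF integrable_continuous_real[OF cont2] bounded_linear_of_real[where 'a = complex]]
      by (simp add: o_def)
    also have "\<dots> = integral {0..1} (\<lambda>x. g x * cnj (g x))"
      by (simp add: complex_norm_square del: of_real_power)
    also have "\<dots> = integral {0..1} (\<lambda>x. g x * cnj (g x)) - integral {0..1} (\<lambda>x. g x * ?p x)"
      using orth[OF tp] by simp
    also have "\<dots> = integral {0..1} (\<lambda>x. g x * cnj (g x) - g x * ?p x)"
      by (intro integral_diff[symmetric] integrable_continuous_real continuous_intros g ci)
    finally have "norm (complex_of_real I) \<le> B * e * (1 - 0)"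
    proof (simp only:, intro integral_bound)
      show "norm (g t * cnj (g t) - g t * ?p t) \<le> B * e" if "t \<in> {0..1}" for t
      proof -
        have "norm (cnj (g t) - ?p t) < e"
          using p(2)[of "e2pi (of_real t)"] G(2)[OF that] by (simp add: norm_e2pi)
        then show ?thesis
          using B[OF that] B0 unfolding right_diff_distrib[symmetric] norm_mult
          by (intro mult_mono) auto
      qed
    qed (auto intro!: continuous_intros g ci)
    then show ?thesis by simp
  qed
  have "I = 0"
  proof (rule ccontr)
    assume "I \<noteq> 0"
    then have "\<bar>I\<bar> \<le> B * (\<bar>I\<bar> / (2 * (B + 1)))" using B0 by (intro small) simp
    also have "\<dots> \<le> (B + 1) * (\<bar>I\<bar> / (2 * (B + 1)))" using B0 by (intro mult_right_mono) auto
    also have "\<dots> = \<bar>I\<bar> / 2" using B0 by (simp add: divide_simps)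
    also have "\<dots> < \<bar>I\<bar>" using \<open>I \<noteq> 0\<close> by simp
    finally show False by simp
  qed
  then have "\<forall>x\<in>{0..1}. (norm (g x))\<^sup>2 = 0"
    using integral_eq_0_iff[OF cont2] unfolding I_def by auto
  then show ?thesis using x by simp
qed


subsection \<open>Two variables\<close>

definition cpoint :: "complex \<Rightarrow> complex \<Rightarrow> complex^2" where
  "cpoint x y = (\<chi> i. if i = 1 then x else y)"

lemma cpoint_nth [simp]: "cpoint x y $ 1 = x" "cpoint x y $ 2 = y"
  by (simp_all add: cpoint_def)

lemma cpoint_eta: "cpoint (z $ 1) (z $ 2) = z"
  by (simp add: vec_eq_iff forall_2)

lemma cpoint_add: "cpoint x y + cpoint x' y' = cpoint (x + x') (y + y')"
  by (simp add: vec_eq_iff forall_2)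

lemma continuous_on_cpoint [continuous_intros]:
  "continuous_on S f \<Longrightarrow> continuous_on S g \<Longrightarrow> continuous_on S (\<lambda>x. cpoint (f x) (g x))"
  unfolding cpoint_def
proof (rule continuous_on_vec_lambda)
  show "continuous_on S f \<Longrightarrow> continuous_on S g \<Longrightarrow> continuous_on S (\<lambda>x. if i = 1 then f x else g x)" for i :: 2
    by (cases "i = 1") auto
qed

text \<open>The \<open>\<complex>\<close>-bilinear product; it pairs frequencies with points.\<close>

definition dotc :: "complex^2 \<Rightarrow> complex^2 \<Rightarrow> complex" where
  "dotc u v = u $ 1 * v $ 1 + u $ 2 * v $ 2"

lemma dotc_add: "dotc (u + u') v = dotc u v + dotc u' v" "dotc u (v + v') = dotc u v + dotc u v'"
  by (simp_all add: dotc_def algebra_simps)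

lemma dotc_diff: "dotc (u - u') v = dotc u v - dotc u' v" "dotc u (v - v') = dotc u v - dotc u v'"
  by (simp_all add: dotc_def algebra_simps)

lemma dotc_minus: "dotc (- u) v = - dotc u v" "dotc u (- v) = - dotc u v"
  by (simp_all add: dotc_def)

lemma dotc_smult: "dotc (c *s u) v = c * dotc u v" "dotc u (c *s v) = c * dotc u v"
  by (simp_all add: dotc_def algebra_simps)

lemma dotc_commute: "dotc u v = dotc v u"
  by (simp add: dotc_def mult.commute)

lemma dotc_0 [simp]: "dotc 0 v = 0" "dotc u 0 = 0"
  by (simp_all add: dotc_def)

lemma norm_dotc_le: "norm (dotc u v) \<le> 2 * norm u * norm v"
proof -
  have "norm (dotc u v) \<le> norm (u $ 1) * norm (v $ 1) + norm (u $ 2) * norm (v $ 2)"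
    unfolding dotc_def norm_mult[symmetric] by (rule norm_triangle_ineq)
  also have "\<dots> \<le> norm u * norm v + norm u * norm v"
    by (intro add_mono mult_mono Finite_Cartesian_Product.norm_nth_le) auto
  finally show ?thesis by simp
qed

lemma holomorphic_on2_dotc_self: "holomorphic_on2 (\<lambda>z. dotc z z) S"
  unfolding dotc_def by (intro holomorphic_on2_add holomorphic_on2_mult holomorphic_on2_linear) auto

lemma holomorphic_on2_dotc: "holomorphic_on2 (dotc u) S" "holomorphic_on2 (\<lambda>z. dotc z u) S"
  by (intro holomorphic_on2_linear dotc_add dotc_smult)+

definition ivec :: "int \<times> int \<Rightarrow> complex^2" where
  "ivec k = cpoint (of_int (fst k)) (of_int (snd k))"

lemma ivec_nth [simp]: "ivec k $ 1 = of_int (fst k)" "ivec k $ 2 = of_int (snd k)"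
  by (simp_all add: ivec_def)

lemma ivec_add: "ivec (k + l) = ivec k + ivec l"
  by (simp add: vec_eq_iff forall_2)

lemma ivec_minus: "ivec (- k) = - ivec k"
  by (simp add: vec_eq_iff forall_2)

lemma ivec_diff: "ivec (k - l) = ivec k - ivec l"
  by (simp add: vec_eq_iff forall_2)

lemma ivec_0 [simp]: "ivec 0 = 0"
  by (simp add: vec_eq_iff forall_2)

lemma e2pi_dotc_ivec [simp]: "e2pi (dotc (ivec k) (ivec l)) = 1"
  by (simp add: dotc_def e2pi_eq_1_iff)

text \<open>
  An iterated integral, so that the results in one variable apply to each variable in turn.
\<close>

definition mean :: "(complex^2 \<Rightarrow> complex) \<Rightarrow> complex" where
  "mean F = integral {0..1} (\<lambda>y. integral {0..1} (\<lambda>x. F (cpoint (of_real x) (of_real y))))"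

lemma continuous_on_square:
  fixes F :: "complex^2 \<Rightarrow> complex"
  assumes "continuous_on UNIV F"
  shows "continuous_on S (\<lambda>(x, y). F (cpoint (of_real x) (of_real y)))"
    "continuous_on S (\<lambda>(y, x). F (cpoint (of_real x) (of_real y)))"
  unfolding case_prod_unfold
  by (auto intro!: continuous_on_compose2[OF assms] continuous_intros)

lemma continuous_on_inner_mean:
  fixes F :: "complex^2 \<Rightarrow> complex"
  assumes "continuous_on UNIV F"
  shows "continuous_on U (\<lambda>y::real. integral {0..1} (\<lambda>x::real. F (cpoint (of_real x) (of_real y))))"
  using integral_continuous_on_param[of U 0 1 "\<lambda>y x. F (cpoint (of_real x) (of_real y))"]
    continuous_on_square(2)[OF assms] by simp

lemma continuous_on_slice:
  fixes F :: "complex^2 \<Rightarrow> complex"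
  assumes "continuous_on UNIV F"
  shows "continuous_on S (\<lambda>x::real. F (cpoint (of_real x) w))" "continuous_on S (\<lambda>y::real. F (cpoint w (of_real y)))"
  by (auto intro!: continuous_on_compose2[OF assms] continuous_intros)

lemma mean_add:
  assumes "continuous_on UNIV F" "continuous_on UNIV G"
  shows "mean (\<lambda>z. F z + G z) = mean F + mean G"
  unfolding mean_def
  by (simp add: integral_add integrable_continuous_real continuous_on_slice continuous_on_inner_mean assms)

lemma mean_cmult: "mean (\<lambda>z. c * F z) = c * mean F"
  unfolding mean_def by simp

lemma mean_diff:
  assumes "continuous_on UNIV F" "continuous_on UNIV G"
  shows "mean (\<lambda>z. F z - G z) = mean F - mean G"
  unfolding mean_def
  by (simp add: integral_diff integrable_continuous_real continuous_on_slice continuous_on_inner_mean assms)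

lemma mean_sum:
  assumes "finite I" "\<And>i. i \<in> I \<Longrightarrow> continuous_on UNIV (F i)"
  shows "mean (\<lambda>z. \<Sum>i\<in>I. F i z) = (\<Sum>i\<in>I. mean (F i))"
  using assms
proof (induction I rule: finite_induct)
  case empty
  show ?case by (simp add: mean_def)
next
  case (insert i I)
  then show ?case
    using mean_add[of "F i" "\<lambda>z. \<Sum>i\<in>I. F i z"] by (simp add: continuous_on_sum)
qed

lemma norm_mean_le:
  assumes "continuous_on UNIV F"
    and B: "\<And>x y. x \<in> {0..1} \<Longrightarrow> y \<in> {0..1} \<Longrightarrow> norm (F (cpoint (of_real x) (of_real y))) \<le> B"
  shows "norm (mean F) \<le> B"
proof -
  have "norm (integral {0..1} (\<lambda>x. F (cpoint (of_real x) (of_real y)))) \<le> B * (1 - 0)"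
    if "y \<in> {0..1}" for y
    using B that by (intro integral_bound continuous_on_slice assms) auto
  then have "norm (mean F) \<le> B * (1 - 0)"
    unfolding mean_def by (intro integral_bound continuous_on_inner_mean assms) auto
  then show ?thesis by simp
qed

lemma mean_swap:
  fixes F :: "complex^2 \<Rightarrow> complex"
  assumes "continuous_on UNIV F"
  shows "mean F = integral {0..1} (\<lambda>x. integral {0..1} (\<lambda>y. F (cpoint (of_real x) (of_real y))))"
  unfolding mean_def
  using integral_swap_continuous[of 0 0 1 1 "\<lambda>y x. F (cpoint (of_real x) (of_real y))"]
    continuous_on_square(2)[OF assms] by simp

lemma holomorphic_on_slice:
  assumes "holomorphic_on2 F UNIV"
  shows "(\<lambda>t. F (cpoint t w)) holomorphic_on S" "(\<lambda>t. F (cpoint w t)) holomorphic_on S"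
proof -
  have eq: "(\<lambda>t. F (cpoint t w)) = (\<lambda>t. F (cpoint 0 w + t *s cpoint 1 0))"
    "(\<lambda>t. F (cpoint w t)) = (\<lambda>t. F (cpoint w 0 + t *s cpoint 0 1))"
    by (intro ext arg_cong[where f = F]; simp add: vec_eq_iff forall_2)+
  show "(\<lambda>t. F (cpoint t w)) holomorphic_on S" "(\<lambda>t. F (cpoint w t)) holomorphic_on S"
    unfolding eq by (rule holomorphic_on_line[OF assms])+
qed

text \<open>
  Shift one coordinate at a time, exchanging the order of integration for the second one.
\<close>

lemma mean_shift:
  assumes F: "holomorphic_on2 F UNIV"
    and per: "\<And>z. F (z + cpoint 1 0) = F z" "\<And>z. F (z + cpoint 0 1) = F z"
  shows "mean (\<lambda>z. F (z + v)) = mean F"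
proof -
  define G where "G z = F (z + cpoint 0 (v $ 2))" for z
  have G: "holomorphic_on2 G UNIV" unfolding G_def by (rule holomorphic_on2_shift[OF F])
  have per': "F (cpoint (s + 1) t) = F (cpoint s t)" "F (cpoint s (t + 1)) = F (cpoint s t)" for s t
    using per(1)[of "cpoint s t"] per(2)[of "cpoint s t"] by (simp_all add: cpoint_add)
  have "F (z + v) = G (z + cpoint (v $ 1) 0)" for z
    unfolding G_def by (rule arg_cong[where f = F]) (simp add: vec_eq_iff forall_2)
  then have "mean (\<lambda>z. F (z + v)) =
      integral {0..1} (\<lambda>y. integral {0..1} (\<lambda>x. G (cpoint (of_real x + v $ 1) (of_real y))))"
    by (simp add: mean_def cpoint_add)
  also have "\<dots> = mean G"
  proof -
    have "integral {0..1} (\<lambda>x. G (cpoint (of_real x + v $ 1) w)) = integral {0..1} (\<lambda>x. G (cpoint (of_real x) w))"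
      for w
      using holomorphic_on_slice(1)[OF G, of w UNIV]
      by (intro periodic_entire_mean_shift[of "\<lambda>t. G (cpoint t w)"])
        (simp_all add: G_def cpoint_add per')
    then show ?thesis by (simp add: mean_def)
  qed
  also have "\<dots> = integral {0..1} (\<lambda>x. integral {0..1} (\<lambda>y. F (cpoint (of_real x) (of_real y + v $ 2))))"
    by (subst mean_swap[OF holomorphic_on2_continuous_on[OF G]]) (simp add: G_def cpoint_add)
  also have "\<dots> = mean F"
  proof -
    have "integral {0..1} (\<lambda>y. F (cpoint w (of_real y + v $ 2))) = integral {0..1} (\<lambda>y. F (cpoint w (of_real y)))"
      for w
      using holomorphic_on_slice(2)[OF F, of w UNIV]
      by (intro periodic_entire_mean_shift[of "\<lambda>t. F (cpoint w t)"]) (simp_all add: per')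
    then show ?thesis by (simp add: mean_swap[OF holomorphic_on2_continuous_on[OF F]])
  qed
  finally show ?thesis .
qed

lemma holomorphic_on2_character: "holomorphic_on2 (\<lambda>z. e2pi (dotc u z)) S"
  by (intro holomorphic_on2_e2pi holomorphic_on2_dotc)

text \<open>Shifting by a point where the character is not 1 shows that its mean vanishes.\<close>

lemma mean_character:
  "mean (\<lambda>z. e2pi (dotc (ivec k) z)) = (if k = 0 then 1 else 0)"
proof (cases "k = 0")
  case True
  then show ?thesis by (simp add: mean_def)
next
  case False
  obtain v where v: "dotc (ivec k) v = 1 / 2"
  proof (cases "fst k = 0")
    case True
    then have "dotc (ivec k) (cpoint 0 (1 / (2 * of_int (snd k)))) = 1 / 2"
      using False by (cases k) (simp add: dotc_def zero_prod_def)
    then show ?thesis using that by blast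
  next
    case False
    then have "dotc (ivec k) (cpoint (1 / (2 * of_int (fst k))) 0) = 1 / 2"
      by (simp add: dotc_def)
    then show ?thesis using that by blast
  qed
  define E where "E z = e2pi (dotc (ivec k) z)" for z
  have "(1 / 2 :: complex) \<notin> \<int>"
  proof
    assume "(1 / 2 :: complex) \<in> \<int>"
    then obtain n :: int where "(1 / 2 :: complex) = of_int n" by (auto elim: Ints_cases)
    then have "of_int (n * 2) = (1 :: complex)" by simp
    then show False unfolding of_int_eq_1_iff by presburger
  qed
  then have ne: "e2pi (1 / 2) \<noteq> 1" by (simp add: e2pi_eq_1_iff)
  have "mean (\<lambda>z. E (z + v)) = mean E"
  proof (rule mean_shift)
    show "holomorphic_on2 E UNIV" unfolding E_def by (rule holomorphic_on2_character)
    have "ivec (1, 0) = cpoint 1 0" "ivec (0, 1) = cpoint 0 1" by (simp_all add: ivec_def)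
    then show "E (z + cpoint 1 0) = E z" "E (z + cpoint 0 1) = E z" for z
      by (simp_all add: E_def dotc_add e2pi_add flip: \<open>ivec (1, 0) = _\<close> \<open>ivec (0, 1) = _\<close>)
  qed
  also have "(\<lambda>z. E (z + v)) = (\<lambda>z. e2pi (1 / 2) * E z)"
    by (simp add: E_def dotc_add e2pi_add v mult.commute)
  finally have "e2pi (1 / 2) * mean E = mean E" by (simp add: mean_cmult)
  then show ?thesis using ne False by (simp add: E_def[abs_def])
qed

text \<open>
  Uniqueness in one variable, used in each real direction, shows that \<open>F\<close> vanishes on the real unit
  square; by the identity theorem it then vanishes on every slice.
\<close>

lemma fourier_coefficients_zero2:
  assumes F: "holomorphic_on2 F UNIV"
    and per: "\<And>z. F (z + cpoint 1 0) = F z" "\<And>z. F (z + cpoint 0 1) = F z"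
    and coeff: "\<And>k. mean (\<lambda>z. F z * e2pi (dotc (ivec k) z)) = 0"
  shows "F z = 0"
proof -
  have per': "F (cpoint 1 t) = F (cpoint 0 t)" "F (cpoint s 1) = F (cpoint s 0)" for s t
    using per(1)[of "cpoint 0 t"] per(2)[of "cpoint s 0"] by (simp_all add: cpoint_add)
  have cF: "continuous_on UNIV F" by (rule holomorphic_on2_continuous_on[OF F])
  have square: "F (cpoint (of_real x) (of_real y)) = 0" if x: "x \<in> {0..1}" and y: "y \<in> {0..1}" for x y
  proof (rule fourier_coefficients_zero[of "\<lambda>x. F (cpoint (of_real x) (of_real y))" x])
    fix k :: int
    define F' where "F' z = F z * e2pi (of_int k * z $ 1)" for z
    have cF': "continuous_on UNIV F'"
      unfolding F'_def by (intro continuous_intros cF)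
    have "integral {0..1} (\<lambda>x. F' (cpoint (of_real x) (of_real y))) = 0"
    proof (rule fourier_coefficients_zero[OF _ _ _ y])
      show "continuous_on {0..1} (\<lambda>y. integral {0..1} (\<lambda>x. F' (cpoint (of_real x) (of_real y))))"
        by (rule continuous_on_inner_mean[OF cF'])
      show "integral {0..1} (\<lambda>x. F' (cpoint (complex_of_real x) (complex_of_real 0))) =
          integral {0..1} (\<lambda>x. F' (cpoint (complex_of_real x) (complex_of_real 1)))"
        by (simp add: F'_def per')
      fix l :: int
      have "integral {0..1} (\<lambda>x. F' (cpoint (of_real x) (of_real y)) ) * e2pi (of_int l * of_real y)
        = integral {0..1} (\<lambda>x. F (cpoint (of_real x) (of_real y)) * e2pi (dotc (ivec (k, l)) (cpoint (of_real x) (of_real y))))"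
        for y
      proof -
        have "integral {0..1} (\<lambda>x. F (cpoint (of_real x) (of_real y)) * e2pi (dotc (ivec (k, l)) (cpoint (of_real x) (of_real y))))
          = integral {0..1} (\<lambda>x. F' (cpoint (of_real x) (of_real y)) * e2pi (of_int l * of_real y))"
          by (intro integral_cong) (simp add: F'_def dotc_def e2pi_add)
        then show ?thesis by simp
      qed
      then show "integral {0..1} (\<lambda>y. integral {0..1} (\<lambda>x. F' (cpoint (complex_of_real x) (complex_of_real y))) *
          e2pi (of_int l * complex_of_real y)) = 0"
        using coeff[of "(k, l)"] by (simp add: mean_def)
    qed
    then show "integral {0..1} (\<lambda>x. F (cpoint (of_real x) (of_real y)) * e2pi (of_int k * of_real x)) = 0"
      by (simp add: F'_def)
  qed (use x per' in \<open>auto intro: continuous_on_slice[OF cF]\<close>)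
  have strip: "F (cpoint s (of_real y)) = 0" if "y \<in> {0..1}" for s y
    by (rule entire_zero_of_unit_interval[OF holomorphic_on_slice(1)[OF F]]) (rule square[OF _ that])
  have "F (cpoint s t) = 0" for s t
    by (rule entire_zero_of_unit_interval[OF holomorphic_on_slice(2)[OF F]]) (rule strip)
  from this[of "z $ 1" "z $ 2"] show ?thesis by (simp add: cpoint_eta)
qed


section \<open>Exponential series\<close>

text \<open>
  Decay of the coefficients faster than every exponential in the frequencies. The series and all
  its derivatives then converge absolutely at every point of \<open>\<complex>\<^sup>2\<close>.
\<close>

definition rapid :: "('i \<Rightarrow> complex) \<Rightarrow> ('i \<Rightarrow> complex^2) \<Rightarrow> bool" where
  "rapid a \<kappa> \<longleftrightarrow> (\<forall>R. (\<lambda>i. norm (a i) * exp (R * norm (\<kappa> i))) summable_on UNIV)"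

definition fseries :: "('i \<Rightarrow> complex) \<Rightarrow> ('i \<Rightarrow> complex^2) \<Rightarrow> complex^2 \<Rightarrow> complex" where
  "fseries a \<kappa> z = (\<Sum>\<^sub>\<infinity>i. a i * e2pi (dotc (\<kappa> i) z))"

lemma rapid_dominates:
  assumes "rapid a \<kappa>" and le: "\<And>i. norm (b i) \<le> C * (norm (a i) * exp (R * norm (\<kappa> i)))"
  shows "b abs_summable_on UNIV"
proof (rule Infinite_Sum.abs_summable_on_comparison_test)
  have "(\<lambda>i. C * (norm (a i) * exp (R * norm (\<kappa> i)))) summable_on UNIV"
    using assms(1) unfolding rapid_def by (intro summable_on_cmult_right) blast
  then show "(\<lambda>i. C * (norm (a i) * exp (R * norm (\<kappa> i)))) abs_summable_on UNIV"
    by (rule summable_on_iff_abs_summable_on_real[THEN iffD1])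
  show "norm (b i) \<le> norm (C * (norm (a i) * exp (R * norm (\<kappa> i))))" for i
    using le[of i] by simp
qed

lemma norm_fseries_term_le:
  "norm (a * e2pi (dotc \<kappa> z)) \<le> norm a * exp (4 * pi * norm z * norm \<kappa>)"
proof -
  have "- (2 * pi * Im (dotc \<kappa> z)) \<le> 2 * pi * norm (dotc \<kappa> z)"
    using mult_left_mono[of "- Im (dotc \<kappa> z)" "norm (dotc \<kappa> z)" "2 * pi"]
      abs_Im_le_cmod[of "dotc \<kappa> z"] by (simp add: abs_le_iff)
  also have "\<dots> \<le> 2 * pi * (2 * norm \<kappa> * norm z)"
    using norm_dotc_le by (intro mult_left_mono) auto
  finally show ?thesis by (simp add: norm_mult norm_e2pi mult_left_mono mult_ac)
qed

lemma fseries_summable: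
  assumes "rapid a \<kappa>"
  shows "(\<lambda>i. a i * e2pi (dotc (\<kappa> i) z)) abs_summable_on UNIV"
  by (rule rapid_dominates[OF assms, of _ 1 "4 * pi * norm z"]) (simp add: norm_fseries_term_le)

text \<open>
  Differentiation multiplies the coefficients by such a linear form in the frequencies, which grows
  slower than the exponential of the frequency.
\<close>

lemma rapid_derivative:
  assumes "rapid a \<kappa>"
  shows "rapid (\<lambda>i. a i * (c * dotc (\<kappa> i) h)) \<kappa>"
  unfolding rapid_def
proof
  fix R :: real
  have "(\<lambda>i. a i * (c * dotc (\<kappa> i) h) * exp (of_real (R * norm (\<kappa> i)))) abs_summable_on UNIV"
  proof (rule rapid_dominates[OF assms])
    fix i
    have e: "norm (\<kappa> i) \<le> exp (norm (\<kappa> i))"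
      using exp_ge_add_one_self[of "norm (\<kappa> i)"] by linarith
    have "norm (dotc (\<kappa> i) h) \<le> 2 * norm (\<kappa> i) * norm h" by (rule norm_dotc_le)
    also have "\<dots> \<le> 2 * exp (norm (\<kappa> i)) * norm h"
      by (intro mult_right_mono mult_left_mono e) auto
    finally have "norm (a i) * (norm c * norm (dotc (\<kappa> i) h)) * exp (R * norm (\<kappa> i))
      \<le> norm (a i) * (norm c * (2 * exp (norm (\<kappa> i)) * norm h)) * exp (R * norm (\<kappa> i))"
      by (intro mult_right_mono mult_left_mono norm_ge_zero exp_ge_zero)
    then show "norm (a i * (c * dotc (\<kappa> i) h) * exp (of_real (R * norm (\<kappa> i))))
      \<le> (2 * norm c * norm h) * (norm (a i) * exp ((R + 1) * norm (\<kappa> i)))"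
      by (simp add: norm_mult exp_add distrib_right mult_ac)
  qed
  then show "(\<lambda>i. norm (a i * (c * dotc (\<kappa> i) h)) * exp (R * norm (\<kappa> i))) summable_on UNIV"
    by (simp add: norm_mult)
qed

text \<open>
  Termwise differentiation: the second order Taylor remainders of the exponentials, divided by
  \<open>|h|\<^sup>2\<close>, are summable uniformly in \<open>|h| \<le> 1\<close>.
\<close>

lemma fseries_has_derivative:
  assumes a: "rapid a \<kappa>"
  shows "(fseries a \<kappa> has_derivative
    (\<lambda>h. fseries (\<lambda>i. a i * (2 * of_real pi * \<i> * dotc (\<kappa> i) h)) \<kappa> z)) (at z)"
proof -
  define x where "x i h = 2 * of_real pi * \<i> * dotc (\<kappa> i) h" for i h
  define D where "D h = fseries (\<lambda>i. a i * x i h) \<kappa> z" for h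
  have rx: "rapid (\<lambda>i. a i * x i h) \<kappa>" for h
    unfolding x_def by (rule rapid_derivative[OF a])
  note summ = abs_summable_summable[OF fseries_summable]
  have "linear D"
  proof (rule linearI)
    show "D (h + h') = D h + D h'" for h h'
      unfolding D_def fseries_def infsum_add[OF summ[OF rx] summ[OF rx], symmetric]
      by (simp add: x_def dotc_add algebra_simps)
    show "D (r *\<^sub>R h) = r *\<^sub>R D h" for r h
      unfolding scaleR_eq_smult[of r h]
      unfolding D_def fseries_def scaleR_conv_of_real infsum_cmult_right'[symmetric]
      by (simp add: x_def dotc_smult mult_ac)
  qed
  then have bl: "bounded_linear D" by (simp add: linear_conv_bounded_linear)
  define R where "R = 4 * pi * norm z + 4 * pi + 2"
  define M where "M i = norm (a i) * exp (R * norm (\<kappa> i))" for i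
  have M: "M summable_on UNIV" using a unfolding M_def rapid_def by blast
  define C where "C = 16 * pi\<^sup>2 * infsum M UNIV"
  have bound: "norm (fseries a \<kappa> (z + h) - fseries a \<kappa> z - D h) \<le> C * (norm h)\<^sup>2" if h: "norm h \<le> 1" for h
  proof -
    define t where "t i = a i * e2pi (dotc (\<kappa> i) z) * (exp (x i h) - 1 - x i h)" for i
    have "((\<lambda>i. a i * e2pi (dotc (\<kappa> i) (z + h)) + - (a i * e2pi (dotc (\<kappa> i) z))
        + - (a i * x i h * e2pi (dotc (\<kappa> i) z)))
      has_sum fseries a \<kappa> (z + h) + - fseries a \<kappa> z + - D h) UNIV"
      unfolding D_def fseries_def
      by (intro has_sum_add has_sum_uminusI has_sum_infsum summ[OF a] summ[OF rx])
    moreover have "a i * e2pi (dotc (\<kappa> i) (z + h)) + - (a i * e2pi (dotc (\<kappa> i) z))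
        + - (a i * x i h * e2pi (dotc (\<kappa> i) z)) = t i" for i
      unfolding t_def dotc_add e2pi_add
      by (simp add: x_def algebra_simps e2pi_def[of "dotc (\<kappa> _) h"])
    ultimately have eq: "fseries a \<kappa> (z + h) - fseries a \<kappa> z - D h = infsum t UNIV"
      by (simp add: infsumI)
    have tle: "norm (t i) \<le> 16 * pi\<^sup>2 * (norm h)\<^sup>2 * M i" for i
    proof -
      have nx: "norm (x i h) \<le> 4 * pi * norm (\<kappa> i) * norm h"
        using norm_dotc_le[of "\<kappa> i" h] pi_gt_zero by (simp add: x_def norm_mult mult_ac)
      have "norm (exp (x i h) - 1 - x i h) \<le> exp \<bar>Re (x i h)\<bar> * (norm (x i h))\<^sup>2"
        using Taylor_exp[of "x i h" 1] by (simp add: diff_diff_eq numeral_2_eq_2)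
      also have "\<dots> \<le> exp (4 * pi * norm (\<kappa> i)) * (4 * pi * norm (\<kappa> i) * norm h)\<^sup>2"
      proof (intro mult_mono power_mono nx)
        have "\<bar>Re (x i h)\<bar> \<le> 4 * pi * norm (\<kappa> i) * norm h" using abs_Re_le_cmod nx order_trans by blast
        also have "\<dots> \<le> 4 * pi * norm (\<kappa> i) * 1" using h by (intro mult_left_mono) auto
        finally show "exp \<bar>Re (x i h)\<bar> \<le> exp (4 * pi * norm (\<kappa> i))" by simp
      qed auto
      also have "\<dots> = 16 * pi\<^sup>2 * (norm h)\<^sup>2 * (exp (4 * pi * norm (\<kappa> i)) * (norm (\<kappa> i))\<^sup>2)"
        by (simp add: power_mult_distrib mult_ac)
      also have "\<dots> \<le> 16 * pi\<^sup>2 * (norm h)\<^sup>2 * (exp (4 * pi * norm (\<kappa> i)) * exp (2 * norm (\<kappa> i)))"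
      proof -
        have "norm (\<kappa> i) \<le> exp (norm (\<kappa> i))" using exp_ge_add_one_self[of "norm (\<kappa> i)"] by linarith
        then have "(norm (\<kappa> i))\<^sup>2 \<le> (exp (norm (\<kappa> i)))\<^sup>2" by (intro power_mono) auto
        then have "(norm (\<kappa> i))\<^sup>2 \<le> exp (2 * norm (\<kappa> i))" by (simp add: exp_double)
        then show ?thesis by (intro mult_left_mono) auto
      qed
      finally have rem: "norm (exp (x i h) - 1 - x i h)
        \<le> 16 * pi\<^sup>2 * (norm h)\<^sup>2 * (exp (4 * pi * norm (\<kappa> i)) * exp (2 * norm (\<kappa> i)))" .
      have R_exp: "exp (R * norm (\<kappa> i)) =
        exp (4 * pi * norm z * norm (\<kappa> i)) * (exp (4 * pi * norm (\<kappa> i)) * exp (2 * norm (\<kappa> i)))"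
        unfolding R_def exp_add[symmetric] by (simp add: algebra_simps)
      have "norm (t i) \<le> (norm (a i) * exp (4 * pi * norm z * norm (\<kappa> i))) *
        (16 * pi\<^sup>2 * (norm h)\<^sup>2 * (exp (4 * pi * norm (\<kappa> i)) * exp (2 * norm (\<kappa> i))))"
        unfolding t_def norm_mult[of "a i * e2pi (dotc (\<kappa> i) z)"]
        by (intro mult_mono norm_fseries_term_le rem) auto
      also have "\<dots> = 16 * pi\<^sup>2 * (norm h)\<^sup>2 * M i"
        unfolding M_def R_exp by (simp add: mult_ac)
      finally show ?thesis .
    qed
    have sM: "(\<lambda>i. 16 * pi\<^sup>2 * (norm h)\<^sup>2 * M i) summable_on UNIV"
      by (intro summable_on_cmult_right M)
    have st: "t abs_summable_on UNIV"
      by (rule rapid_dominates[OF a, of _ "16 * pi\<^sup>2 * (norm h)\<^sup>2" R]) (use tle in \<open>simp add: M_def\<close>)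
    have "norm (infsum t UNIV) \<le> (\<Sum>\<^sub>\<infinity>i. norm (t i))" by (rule norm_infsum_bound[OF st])
    also have "\<dots> \<le> (\<Sum>\<^sub>\<infinity>i. 16 * pi\<^sup>2 * (norm h)\<^sup>2 * M i)" by (rule infsum_mono[OF st sM tle])
    also have "\<dots> = C * (norm h)\<^sup>2" by (simp add: infsum_cmult_right' C_def)
    finally show ?thesis unfolding eq .
  qed
  have "(\<lambda>h. norm (fseries a \<kappa> (z + h) - fseries a \<kappa> z - D h) / norm h) \<midarrow>0\<rightarrow> 0"
  proof (rule tendsto_sandwich[of "\<lambda>_. 0" _ _ "\<lambda>h. C * norm h"])
    show "\<forall>\<^sub>F h in at 0. norm (fseries a \<kappa> (z + h) - fseries a \<kappa> z - D h) / norm h \<le> C * norm h"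
      unfolding eventually_at
    proof (intro exI[of _ 1] conjI ballI impI)
      fix h :: "complex^2" assume h: "h \<noteq> 0 \<and> dist h 0 < 1"
      then show "norm (fseries a \<kappa> (z + h) - fseries a \<kappa> z - D h) / norm h \<le> C * norm h"
        using bound[of h] by (simp add: divide_le_eq power2_eq_square mult_ac)
    qed simp
    show "((\<lambda>h. C * norm h) \<longlongrightarrow> 0) (at (0::complex^2))"
      by (auto intro!: tendsto_eq_intros)
  qed auto
  then have "(fseries a \<kappa> has_derivative D) (at z)" using bl by (simp add: has_derivative_at)
  then show ?thesis by (simp add: D_def[abs_def] x_def)
qed

lemma holomorphic_on2_fseries:
  assumes "rapid a \<kappa>"
  shows "holomorphic_on2 (fseries a \<kappa>) S"
proof (rule holomorphic_on2I[OF fseries_has_derivative[OF assms]])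
  show "fseries (\<lambda>i. a i * (2 * of_real pi * \<i> * dotc (\<kappa> i) (c *s v))) \<kappa> z
    = c * fseries (\<lambda>i. a i * (2 * of_real pi * \<i> * dotc (\<kappa> i) v)) \<kappa> z" for c v z
    unfolding fseries_def infsum_cmult_right'[symmetric] by (simp add: dotc_smult mult_ac)
qed

text \<open>
  Only the term with frequency \<open>\<kappa> j\<close> has nonzero mean after multiplication by the opposite character,
  and the finite partial sums converge uniformly on the unit square.
\<close>

lemma fseries_coefficient:
  assumes a: "rapid a \<kappa>" and freq: "\<And>i. i \<noteq> j \<Longrightarrow> \<exists>k. k \<noteq> 0 \<and> \<kappa> i - \<kappa> j = ivec k"
  shows "mean (\<lambda>z. fseries a \<kappa> z * e2pi (- dotc (\<kappa> j) z)) = a j"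
proof -
  define E where "E z = e2pi (- dotc (\<kappa> j) z)" for z
  define T where "T i z = a i * e2pi (dotc (\<kappa> i) z)" for i z
  define M where "M i = norm (a i) * exp (8 * pi * norm (\<kappa> i))" for i
  define K where "K = exp (8 * pi * norm (\<kappa> j))"
  have M: "M summable_on UNIV" using a unfolding M_def rapid_def by blast
  have small: "norm (cpoint (of_real x) (of_real y)) \<le> 2" if "x \<in> {0..1}" "y \<in> {0..1}" for x y
  proof -
    have "norm (cpoint (of_real x) (of_real y)) \<le> (\<Sum>i\<in>UNIV. norm (cpoint (of_real x) (of_real y) $ i))"
      unfolding norm_vec_def by (rule L2_set_le_sum) simp
    then show ?thesis using that by (simp add: sum_2)
  qed
  have T: "norm (T i z) \<le> M i" if "norm z \<le> 2" for i z
  proof -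
    have "norm (T i z) \<le> norm (a i) * exp (4 * pi * norm z * norm (\<kappa> i))"
      unfolding T_def by (rule norm_fseries_term_le)
    also have "\<dots> \<le> M i" unfolding M_def using that by (auto intro!: mult_left_mono mult_right_mono)
    finally show ?thesis .
  qed
  have E: "norm (E z) \<le> K" if "norm z \<le> 2" for z
  proof -
    have "norm (1 * e2pi (dotc (- \<kappa> j) z)) \<le> norm (1 :: complex) * exp (4 * pi * norm z * norm (- \<kappa> j))"
      by (rule norm_fseries_term_le)
    also have "\<dots> \<le> K" unfolding K_def using that by (auto intro!: mult_left_mono mult_right_mono)
    finally show ?thesis by (simp add: E_def dotc_minus)
  qed
  have cE: "continuous_on UNIV E" unfolding E_def dotc_minus(1)[symmetric]
    by (rule holomorphic_on2_continuous_on[OF holomorphic_on2_character])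
  have cT: "continuous_on UNIV (T i)" for i unfolding T_def
    by (intro continuous_intros holomorphic_on2_continuous_on[OF holomorphic_on2_character])
  have cF: "continuous_on UNIV (fseries a \<kappa>)"
    by (rule holomorphic_on2_continuous_on[OF holomorphic_on2_fseries[OF a]])
  have mT: "mean (\<lambda>z. T i z * E z) = (if i = j then a j else 0)" for i
  proof -
    have "(\<lambda>z. T i z * E z) = (\<lambda>z. a i * e2pi (dotc (\<kappa> i - \<kappa> j) z))"
      by (simp add: T_def E_def dotc_diff e2pi_diff e2pi_minus divide_inverse mult_ac)
    then have "mean (\<lambda>z. T i z * E z) = a i * mean (\<lambda>z. e2pi (dotc (\<kappa> i - \<kappa> j) z))"
      by (simp add: mean_cmult)
    moreover have "mean (\<lambda>z. e2pi (dotc (\<kappa> i - \<kappa> j) z)) = (if i = j then 1 else 0)"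
    proof (cases "i = j")
      case True
      then show ?thesis using mean_character[of 0] by simp
    next
      case False
      then show ?thesis using freq[OF False] mean_character by auto
    qed
    ultimately show ?thesis by simp
  qed
  have "norm (mean (\<lambda>z. fseries a \<kappa> z * E z) - a j) \<le> K * e" if "e > 0" for e
  proof -
    have "(sum M \<longlongrightarrow> infsum M UNIV) (finite_subsets_at_top UNIV)"
      using M by (simp add: infsum_tendsto)
    then have "\<forall>\<^sub>F I in finite_subsets_at_top UNIV. dist (sum M I) (infsum M UNIV) < e"
      using \<open>e > 0\<close> by (rule tendstoD)
    moreover have "\<forall>\<^sub>F I in finite_subsets_at_top UNIV. finite I \<and> {j} \<subseteq> I"
      unfolding eventually_finite_subsets_at_top by (rule exI[of _ "{j}"]) auto
    ultimately have "\<forall>\<^sub>F I in finite_subsets_at_top UNIV.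
        dist (sum M I) (infsum M UNIV) < e \<and> finite I \<and> {j} \<subseteq> I"
      by (rule eventually_conj)
    then obtain I where I: "dist (sum M I) (infsum M UNIV) < e" "finite I" "j \<in> I"
      using eventually_happens'[OF finite_subsets_at_top_neq_bot] by blast
    have split: "infsum f UNIV = sum f I + infsum f (- I)" if "f summable_on UNIV"
      for f :: "'a \<Rightarrow> 'c::banach"
    proof -
      have "infsum f (I \<union> - I) = infsum f I + infsum f (- I)"
        using that by (intro infsum_Un_disjoint) (auto intro: summable_on_subset_banach)
      then show ?thesis using I(2) by simp
    qed
    have tail: "norm (infsum (\<lambda>i. T i z) (- I)) \<le> e" if z: "norm z \<le> 2" for z
    proof -
      have s: "(\<lambda>i. T i z) abs_summable_on UNIV"
        unfolding T_def by (rule fseries_summable[OF a])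
      then have s': "(\<lambda>i. T i z) abs_summable_on - I"
        by (rule summable_on_subset_banach) simp
      have "norm (infsum (\<lambda>i. T i z) (- I)) \<le> (\<Sum>\<^sub>\<infinity>i\<in>-I. norm (T i z))"
        by (rule norm_infsum_bound[OF s'])
      also have "\<dots> \<le> infsum M (- I)"
        by (rule infsum_mono[OF s' summable_on_subset_banach[OF M]]) (auto intro: T z)
      also have "\<dots> \<le> e" using split[OF M] I(1) by (simp add: dist_norm)
      finally show ?thesis .
    qed
    have "mean (\<lambda>z. \<Sum>i\<in>I. T i z * E z) = (\<Sum>i\<in>I. mean (\<lambda>z. T i z * E z))"
      using I(2) by (intro mean_sum continuous_intros cT cE)
    also have "\<dots> = a j" using I(2,3) by (simp add: mT)
    finally have "mean (\<lambda>z. fseries a \<kappa> z * E z) - a j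
      = mean (\<lambda>z. fseries a \<kappa> z * E z - (\<Sum>i\<in>I. T i z * E z))"
      by (subst mean_diff) (auto intro!: continuous_intros cT cE cF)
    also have "norm \<dots> \<le> K * e"
    proof (rule norm_mean_le)
      show "continuous_on UNIV (\<lambda>z. fseries a \<kappa> z * E z - (\<Sum>i\<in>I. T i z * E z))"
        by (intro continuous_intros cT cE cF)
      fix x y :: real assume "x \<in> {0..1}" "y \<in> {0..1}"
      define z where "z = cpoint (of_real x) (of_real y)"
      have z: "norm z \<le> 2" unfolding z_def by (rule small) fact+
      have "fseries a \<kappa> z = (\<Sum>i\<in>I. T i z) + infsum (\<lambda>i. T i z) (- I)"
        unfolding fseries_def T_def by (rule split[OF abs_summable_summable[OF fseries_summable[OF a]]])
      then have "fseries a \<kappa> z * E z - (\<Sum>i\<in>I. T i z * E z) = E z * infsum (\<lambda>i. T i z) (- I)"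
        by (simp add: sum_distrib_left algebra_simps)
      also have "norm \<dots> \<le> K * e"
        unfolding norm_mult using E[OF z] tail[OF z] by (intro mult_mono) (auto simp: K_def)
      finally show "norm (fseries a \<kappa> (cpoint (of_real x) (of_real y)) * E (cpoint (of_real x) (of_real y))
          - (\<Sum>i\<in>I. T i (cpoint (of_real x) (of_real y)) * E (cpoint (of_real x) (of_real y)))) \<le> K * e"
        by (simp only: z_def)
    qed
    finally show ?thesis .
  qed
  from this[of "e / K" for e] have "norm (mean (\<lambda>z. fseries a \<kappa> z * E z) - a j) \<le> e" if "e > 0" for e
    using that by (simp add: K_def)
  then have "norm (mean (\<lambda>z. fseries a \<kappa> z * E z) - a j) \<le> 0" by (rule field_le_epsilon[of _ 0, simplified])
  then show ?thesis by (simp add: E_def)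
qed

lemma summable_on_exp_neg_abs: "(\<lambda>n::int. exp (- \<bar>real_of_int n\<bar>)) summable_on UNIV"
proof -
  have "(\<lambda>n::nat. exp (- real n)) summable_on UNIV"
  proof (rule summable_nonneg_imp_summable_on)
    have "summable (\<lambda>n. exp (- 1) ^ n :: real)" by (rule summable_geometric) simp
    then show "summable (\<lambda>n. exp (- real n))" by (simp flip: exp_of_nat_mult)
  qed simp
  then have s: "(\<lambda>n::int. exp (- \<bar>real_of_int n\<bar>)) summable_on range int"
    "(\<lambda>n::int. exp (- \<bar>real_of_int n\<bar>)) summable_on range (\<lambda>n. - int n)"
    by (subst summable_on_reindex; simp add: inj_on_def o_def)+
  have "(\<lambda>n::int. exp (- \<bar>real_of_int n\<bar>)) summable_on (range int \<union> (range (\<lambda>n. - int n) - range int))"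
    by (intro summable_on_Un_disjoint s summable_on_subset_banach[OF s(2)]) auto
  moreover have "range int \<union> (range (\<lambda>n. - int n) - range int) = UNIV"
    using int_cases2 by blast
  ultimately show ?thesis by simp
qed

text \<open>Gaussian decay beats every exponential \<open>exp (R t)\<close>: \<open>- \<delta> t\<^sup>2 + R t \<le> (R + 2)\<^sup>2 / (4 \<delta>) - 2 t\<close>.\<close>

lemma gaussian_rapid:
  assumes decay: "\<And>k. norm (a k) \<le> C * exp (- \<delta> * (norm (ivec k + u))\<^sup>2)" and \<delta>: "\<delta> > 0"
  shows "rapid a (\<lambda>k. ivec k + u)"
  unfolding rapid_def
proof
  fix R :: real
  have C: "C \<ge> 0"
    using order_trans[OF norm_ge_zero decay[of 0]] by (simp add: zero_le_mult_iff)
  define B where "B = C * exp ((R + 2)\<^sup>2 / (4 * \<delta>) + 2 * norm u)"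
  let ?g = "\<lambda>k::int \<times> int. exp (- \<bar>real_of_int (fst k)\<bar>) * exp (- \<bar>real_of_int (snd k)\<bar>)"
  have le: "norm (a k) * exp (R * norm (ivec k + u)) \<le> B * ?g k" for k
  proof -
    define t where "t = norm (ivec k + u)"
    have "0 \<le> (2 * \<delta> * t - (R + 2))\<^sup>2" by simp
    then have "4 * \<delta> * (- \<delta> * t\<^sup>2 + R * t + 2 * t) \<le> (R + 2)\<^sup>2"
      by (simp add: power2_eq_square algebra_simps)
    then have quad: "- \<delta> * t\<^sup>2 + R * t \<le> (R + 2)\<^sup>2 / (4 * \<delta>) - 2 * t"
      using \<delta> by (simp add: field_simps)
    have "norm (ivec k) \<le> t + norm u"
      using norm_triangle_ineq4[of "ivec k + u" u] by (simp add: t_def)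
    moreover have "\<bar>real_of_int (fst k)\<bar> \<le> norm (ivec k)" "\<bar>real_of_int (snd k)\<bar> \<le> norm (ivec k)"
      using Finite_Cartesian_Product.norm_nth_le[of "ivec k" 1] Finite_Cartesian_Product.norm_nth_le[of "ivec k" 2] by simp_all
    ultimately have "\<bar>real_of_int (fst k)\<bar> + \<bar>real_of_int (snd k)\<bar> \<le> 2 * t + 2 * norm u" by linarith
    with quad have "- \<delta> * t\<^sup>2 + R * t \<le> ((R + 2)\<^sup>2 / (4 * \<delta>) + 2 * norm u)
        + (- \<bar>real_of_int (fst k)\<bar> + - \<bar>real_of_int (snd k)\<bar>)" by linarith
    then have "exp (- \<delta> * t\<^sup>2) * exp (R * t) \<le> exp ((R + 2)\<^sup>2 / (4 * \<delta>) + 2 * norm u) * ?g k"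
      unfolding exp_add[symmetric] by simp
    then have "C * (exp (- \<delta> * t\<^sup>2) * exp (R * t)) \<le> B * ?g k"
      unfolding B_def mult.assoc using C by (intro mult_left_mono)
    moreover have "norm (a k) * exp (R * t) \<le> C * exp (- \<delta> * t\<^sup>2) * exp (R * t)"
      using decay[of k] by (intro mult_right_mono) (auto simp: t_def)
    ultimately show ?thesis unfolding t_def mult.assoc by linarith
  qed
  have "?g summable_on UNIV \<times> UNIV"
  proof (rule summable_on_SigmaI)
    show "((\<lambda>y. ?g (x, y)) has_sum exp (- \<bar>real_of_int x\<bar>) * (\<Sum>\<^sub>\<infinity>n::int. exp (- \<bar>real_of_int n\<bar>))) UNIV" for x
      using has_sum_cmult_right[OF has_sum_infsum[OF summable_on_exp_neg_abs]] by simp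
    show "(\<lambda>x. exp (- \<bar>real_of_int x\<bar>) * (\<Sum>\<^sub>\<infinity>n::int. exp (- \<bar>real_of_int n\<bar>))) summable_on UNIV"
      by (intro summable_on_cmult_left summable_on_exp_neg_abs)
  qed simp
  then have "(\<lambda>k. B * ?g k) summable_on UNIV" by (intro summable_on_cmult_right) simp
  then have "(\<lambda>k. B * ?g k) abs_summable_on UNIV" by (rule summable_on_iff_abs_summable_on_real[THEN iffD1])
  then have "(\<lambda>k. norm (a k) * exp (R * norm (ivec k + u))) abs_summable_on UNIV"
    by (rule Infinite_Sum.abs_summable_on_comparison_test) (use le in \<open>auto intro: order_trans[OF _ abs_ge_self]\<close>)
  then show "(\<lambda>k. norm (a k) * exp (R * norm (ivec k + u))) summable_on UNIV"
    by (rule summable_on_iff_abs_summable_on_real[THEN iffD2])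
qed


section \<open>Representatives modulo a circulant sublattice\<close>

text \<open>
  The row vector \<open>m\<close> times the circulant matrix with rows \<open>(A, B)\<close> and \<open>(B, A)\<close>.
\<close>

definition circ :: "int \<Rightarrow> int \<Rightarrow> int \<times> int \<Rightarrow> int \<times> int" where
  "circ A B m = (fst m * A + snd m * B, fst m * B + snd m * A)"

lemma circ_add: "circ A B (m + n) = circ A B m + circ A B n"
  by (simp add: circ_def algebra_simps)

lemma circ_diff: "circ A B (m - n) = circ A B m - circ A B n"
  by (simp add: circ_def algebra_simps)

lemma circ_eq_0_iff:
  assumes "\<bar>B\<bar> < A"
  shows "circ A B m = 0 \<longleftrightarrow> m = 0"
proof
  assume 0: "circ A B m = 0"
  obtain x y where m: "m = (x, y)" by (cases m)
  have eq: "x * A + y * B = 0" "x * B + y * A = 0"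
    using 0 by (simp_all add: m circ_def zero_prod_def)
  have "x * ((A - B) * (A + B)) = 0" "y * ((A - B) * (A + B)) = 0"
    using eq by algebra+
  moreover have "(A - B) * (A + B) \<noteq> 0" using assms by auto
  ultimately show "m = 0" by (simp add: m zero_prod_def)
qed (simp add: circ_def zero_prod_def)

text \<open>
  The sublattice has a basis in Hermite normal form, \<open>(D, 0)\<close> and \<open>(e, g)\<close> with \<open>g = gcd A B\<close> and
  \<open>D g = A\<^sup>2 - B\<^sup>2\<close>; the \<open>D \<times> g\<close> box is a system of representatives.
\<close>

lemma circ_representatives:
  assumes AB: "\<bar>B\<bar> < A"
  shows "\<exists>Q. finite Q \<and> int (card Q) = A\<^sup>2 - B\<^sup>2 \<and> (\<forall>k. \<exists>!p. fst p \<in> Q \<and> k = fst p + circ A B (snd p))"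
proof -
  define g where "g = gcd A B"
  have A0: "A > 0" using AB by linarith
  then have g0: "g > 0" by (simp add: g_def)
  obtain a' b' where ab: "A = g * a'" "B = g * b'" "coprime a' b'"
    using gcd_coprime_exists[of A B] A0 unfolding g_def by (metis gcd_eq_0_iff less_irrefl mult.commute)
  obtain x y where xy: "x * B + y * A = g" using bezout_int[of B A] by (auto simp: g_def gcd.commute)
  define D where "D = a' * A - b' * B"
  have Dg: "D * g = A\<^sup>2 - B\<^sup>2" by (simp add: D_def ab power2_eq_square algebra_simps)
  have "(A - B) * (A + B) > 0" using AB by (intro mult_pos_pos) auto
  then have "D * g > 0" unfolding Dg by (simp add: power2_eq_square algebra_simps)
  then have D0: "D > 0" using g0 by (simp add: zero_less_mult_iff)
  have a'0: "a' \<noteq> 0" using A0 ab by auto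
  have cD: "circ A B (t * a', - t * b') = (t * D, 0)" for t
    by (simp add: circ_def D_def ab algebra_simps)
  have ce: "circ A B (t * x, t * y) = (t * (x * A + y * B), t * g)" for t
    by (simp add: circ_def xy[symmetric] algebra_simps)
  \<comment> \<open>The elements of the sublattice on the first axis are the multiples of \<open>(D, 0)\<close>.\<close>
  have ker: "\<exists>t. fst (circ A B m) = t * D" if "snd (circ A B m) = 0" for m
  proof -
    have "g * (fst m * b' + snd m * a') = 0" using that by (simp add: circ_def ab algebra_simps)
    then have 0: "fst m * b' + snd m * a' = 0" using g0 by simp
    then have "a' dvd fst m * b'" by (metis add_eq_0_iff dvd_minus_iff dvd_triv_right)
    then have "a' dvd fst m" using ab(3) by (simp add: coprime_dvd_mult_left_iff)
    then obtain t where t: "fst m = t * a'" by (metis dvd_def mult.commute)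
    have "a' * (t * b' + snd m) = 0" using 0 by (simp add: t algebra_simps)
    then have "snd m = - t * b'" using a'0 by (simp add: add_eq_0_iff)
    then have "m = (t * a', - t * b')" using t by (simp add: prod_eq_iff)
    then show ?thesis using cD[of t] by auto
  qed
  define Q where "Q = {0..<D} \<times> {0..<g}"
  have "\<exists>!p. fst p \<in> Q \<and> k = fst p + circ A B (snd p)" for k
  proof (rule ex_ex1I)
    define q where "q = snd k div g"
    define k' where "k' = fst k - q * (x * A + y * B)"
    define p where "p = k' div D"
    show "\<exists>p. fst p \<in> Q \<and> k = fst p + circ A B (snd p)"
    proof (intro exI conjI)
      show "fst ((k' mod D, snd k mod g), (p * a', - p * b') + (q * x, q * y)) \<in> Q"
        using D0 g0 by (simp add: Q_def)
      have "k' mod D + p * D = k'" "snd k mod g + q * g = snd k"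
        by (simp_all add: p_def q_def)
      then show "k = fst ((k' mod D, snd k mod g), (p * a', - p * b') + (q * x, q * y))
          + circ A B (snd ((k' mod D, snd k mod g), (p * a', - p * b') + (q * x, q * y)))"
        unfolding fst_conv snd_conv circ_add cD ce by (simp add: prod_eq_iff k'_def algebra_simps)
    qed
  next
    fix p p' assume p: "fst p \<in> Q \<and> k = fst p + circ A B (snd p)"
      and p': "fst p' \<in> Q \<and> k = fst p' + circ A B (snd p')"
    define m where "m = snd p - snd p'"
    have m: "circ A B m = fst p' - fst p"
      using p p' unfolding m_def circ_diff by (simp add: algebra_simps)
    have small: "\<bar>fst (circ A B m)\<bar> < D" "\<bar>snd (circ A B m)\<bar> < g"
      using p p' unfolding m Q_def by (auto simp: mem_Times_iff)
    have "g dvd snd (circ A B m)" by (simp add: circ_def ab)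
    then have s0: "snd (circ A B m) = 0" using small(2) by (metis abs_ge_zero abs_of_pos dvd_imp_le_int g0 not_le)
    then obtain t where t: "fst (circ A B m) = t * D" using ker by blast
    then have "D dvd fst (circ A B m)" by simp
    then have "fst (circ A B m) = 0" using small(1) by (metis abs_ge_zero abs_of_pos dvd_imp_le_int D0 not_le)
    then have z: "circ A B m = 0" using s0 by (simp add: prod_eq_iff)
    then have "m = 0" using circ_eq_0_iff[OF AB] by simp
    then show "p = p'" using z m by (simp add: prod_eq_iff m_def)
  qed
  moreover have "int (card Q) = A\<^sup>2 - B\<^sup>2" using D0 g0 by (simp add: Q_def Dg)
  moreover have "finite Q" by (simp add: Q_def)
  ultimately show ?thesis by blast
qed


section \<open>Sections as theta functions\<close>

lemma H_Omega_add: "H_Omega (u + v) w = H_Omega u w + H_Omega v w" "H_Omega u (v + w) = H_Omega u v + H_Omega u w"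
  by (simp_all add: H_Omega_def algebra_simps)

lemma H_Omega_smult: "H_Omega (c *s u) w = c * H_Omega u w" "H_Omega u (c *s w) = cnj c * H_Omega u w"
  by (simp_all add: H_Omega_def algebra_simps)

lemma H_Omega_commute: "H_Omega w v = cnj (H_Omega v w)"
  by (simp add: H_Omega_def)

lemma holomorphic_on2_H_Omega: "holomorphic_on2 (\<lambda>z. H_Omega z w) S"
  by (intro holomorphic_on2_linear H_Omega_add H_Omega_smult)

lemma norm_sq_vec2: "(norm v)\<^sup>2 = (cmod (v $ 1))\<^sup>2 + (cmod (v $ 2))\<^sup>2" for v :: "complex^2"
  by (simp add: norm_vec_def L2_set_def sum_2)

lemma H_Omega_self: "H_Omega v v = of_real ((norm v)\<^sup>2)"
  by (simp add: H_Omega_def norm_sq_vec2 complex_norm_square[symmetric] del: of_real_power)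

lemma H_Omega_ivec: "H_Omega z (ivec n) = dotc z (ivec n)"
  by (simp add: H_Omega_def dotc_def)

lemma norm_sq_real_vec:
  fixes v :: "complex^2"
  assumes "Im (v $ 1) = 0" "Im (v $ 2) = 0"
  shows "(norm v)\<^sup>2 = Re (dotc v v)"
  unfolding norm_sq_vec2 cmod_power2 using assms by (simp add: dotc_def power2_eq_square)

lemma Im_dotc_real:
  fixes v :: "complex^2"
  assumes "Im (v $ 1) = 0" "Im (v $ 2) = 0"
  shows "Im (dotc v w) = Re (v $ 1) * Im (w $ 1) + Re (v $ 2) * Im (w $ 2)"
  using assms by (simp add: dotc_def)

text \<open>
  Here \<open>A = Im \<tau>\<close>, \<open>B = Im \<zeta>\<close>, and \<open>c\<close> is the characteristic: the restriction of the semi-character to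
  \<open>\<int>\<^sup>2\<close>, where the form \<open>E\<close> vanishes, is the character \<open>n \<mapsto> exp (2 \<pi> i c \<cdot> n)\<close>.
\<close>

locale circulant_torus =
  fixes \<tau> \<zeta> :: complex and A B :: int and chi :: "complex^2 \<Rightarrow> complex" and c :: "complex^2"
  assumes Im_tau: "Im \<tau> = of_int A" and Im_zeta: "Im \<zeta> = of_int B" and AB: "\<bar>B\<bar> < A"
    and semichar: "semicharacter (period_lattice (period_matrix \<tau> \<zeta>)) E_Omega chi"
    and c_real: "Im (c $ 1) = 0" "Im (c $ 2) = 0"
    and chi_ivec: "chi (ivec n) = e2pi (dotc c (ivec n))"
begin

abbreviation "L \<equiv> period_lattice (period_matrix \<tau> \<zeta>)"

definition per :: "int \<times> int \<Rightarrow> complex^2" where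
  "per m = cpoint (of_int (fst m) * \<tau> + of_int (snd m) * \<zeta>) (of_int (fst m) * \<zeta> + of_int (snd m) * \<tau>)"

definition Jf :: "complex^2 \<Rightarrow> complex^2 \<Rightarrow> complex" where
  "Jf = J_factor H_Omega chi"

lemma per_nth [simp]:
  "per m $ 1 = of_int (fst m) * \<tau> + of_int (snd m) * \<zeta>"
  "per m $ 2 = of_int (fst m) * \<zeta> + of_int (snd m) * \<tau>"
  by (simp_all add: per_def)

lemma per_add: "per (m + n) = per m + per n"
  by (simp add: vec_eq_iff forall_2 algebra_simps)

lemma L_eq: "L = {per m + ivec n | m n. True}"
proof -
  have *: "(\<chi> i. of_int (m $ i)) v* period_matrix \<tau> \<zeta> + (\<chi> i. of_int (n $ i))
      = per (m $ 1, m $ 2) + ivec (n $ 1, n $ 2)" for m n :: "int^2"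
    by (simp add: vec_eq_iff forall_2 vector_matrix_mult_def sum_2 period_matrix_def mult.commute)
  show ?thesis
  proof (intro set_eqI iffI)
    fix v assume "v \<in> L"
    then show "v \<in> {per m + ivec n | m n. True}" unfolding period_lattice_def using * by blast
  next
    fix v assume "v \<in> {per m + ivec n | m n. True}"
    then obtain m n where v: "v = per m + ivec n" by blast
    have "v = (\<chi> i. of_int ((\<chi> i::2. if i = 1 then fst m else snd m) $ i)) v* period_matrix \<tau> \<zeta>
        + (\<chi> i. of_int ((\<chi> i::2. if i = 1 then fst n else snd n) $ i))"
      unfolding v * by simp
    then show "v \<in> L" unfolding period_lattice_def by blast
  qed
qed

lemma per_in_L: "per m \<in> L" and ivec_in_L: "ivec n \<in> L"
proof -
  have "per 0 = 0" by (simp add: vec_eq_iff forall_2)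
  moreover have "per m + ivec 0 \<in> L" "per 0 + ivec n \<in> L" unfolding L_eq by blast+
  ultimately show "per m \<in> L" "ivec n \<in> L" by simp_all
qed

lemma L_cases:
  assumes "\<alpha> \<in> L"
  obtains m n where "\<alpha> = per m + ivec n"
  using assms unfolding L_eq by blast

lemma H_Omega_per: "H_Omega z (per m) = dotc z (per m) - 2 * \<i> * dotc z (ivec (circ A B m))"
proof -
  have cnj: "cnj \<tau> = \<tau> - 2 * \<i> * of_int A" "cnj \<zeta> = \<zeta> - 2 * \<i> * of_int B"
    by (simp_all add: complex_eq_iff Im_tau Im_zeta)
  show ?thesis by (simp add: H_Omega_def dotc_def circ_def cnj) (simp add: algebra_simps)
qed

text \<open>
  Circulant matrices commute, so the product of \<open>\<Omega>\<close> and \<open>Im \<Omega>\<close> is symmetric.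
\<close>

lemma dotc_per_circ: "dotc (per m) (ivec (circ A B n)) = dotc (per n) (ivec (circ A B m))"
  by (simp add: dotc_def circ_def algebra_simps)

lemma E_per_per: "E_Omega (per m) (per n) = 0"
  by (simp add: E_Omega_def H_Omega_def Im_tau Im_zeta algebra_simps)

lemma E_integral:
  assumes "\<alpha> \<in> L" "\<beta> \<in> L"
  shows "E_Omega \<alpha> \<beta> \<in> \<int>"
proof -
  obtain m n where \<alpha>: "\<alpha> = per m + ivec n" using assms(1) by (rule L_cases)
  obtain m' n' where \<beta>: "\<beta> = per m' + ivec n'" using assms(2) by (rule L_cases)
  have "E_Omega \<alpha> \<beta> = E_Omega (per m) (per m') + E_Omega (per m) (ivec n')
      + E_Omega (ivec n) (per m') + E_Omega (ivec n) (ivec n')"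
    by (simp add: \<alpha> \<beta> E_Omega_def H_Omega_add)
  also have "E_Omega (per m) (ivec n') \<in> \<int>" "E_Omega (ivec n) (per m') \<in> \<int>" "E_Omega (ivec n) (ivec n') \<in> \<int>"
    by (auto simp: E_Omega_def H_Omega_def Im_tau Im_zeta)
  then have "E_Omega (per m) (per m') + E_Omega (per m) (ivec n')
      + E_Omega (ivec n) (per m') + E_Omega (ivec n) (ivec n') \<in> \<int>"
    by (simp add: E_per_per)
  finally show ?thesis .
qed

lemma chi_nonzero: "\<alpha> \<in> L \<Longrightarrow> chi \<alpha> \<noteq> 0" "\<alpha> \<in> L \<Longrightarrow> norm (chi \<alpha>) = 1"
  using semichar unfolding semicharacter_def by auto

lemma chi_per_add: "chi (per (m + n)) = chi (per m) * chi (per n)"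
  using semichar per_in_L unfolding semicharacter_def by (simp add: per_add E_per_per)

text \<open>
  The cocycle identity holds up to the factor \<open>exp (2 \<pi> i E(\<alpha>, \<beta>))\<close>, which is 1 as \<open>E\<close> is integral on the lattice.
\<close>

lemma automorphy: "automorphy_factor L Jf"
  unfolding automorphy_factor_def
proof (intro conjI ballI allI)
  fix \<alpha> z assume \<alpha>: "\<alpha> \<in> L"
  show "holomorphic_on2 (Jf \<alpha>) UNIV"
    unfolding Jf_def J_factor_def
    by (intro holomorphic_on2_mult holomorphic_on2_const holomorphic_on2_exp holomorphic_on2_add
        holomorphic_on2_H_Omega)
  show "Jf \<alpha> z \<noteq> 0" using chi_nonzero[OF \<alpha>] by (simp add: Jf_def J_factor_def)
  fix \<beta> assume \<beta>: "\<beta> \<in> L"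
  have diff: "H_Omega \<alpha> \<beta> - H_Omega \<beta> \<alpha> = 2 * \<i> * of_real (E_Omega \<alpha> \<beta>)"
    by (simp add: E_Omega_def H_Omega_commute[of \<beta>] complex_eq_iff)
  obtain n :: int where n: "E_Omega \<alpha> \<beta> = of_int n" using E_integral[OF \<alpha> \<beta>] by (auto elim: Ints_cases)
  have "exp (\<i> * of_real pi * of_real (E_Omega \<alpha> \<beta>)) * exp (of_real pi / 2 * (H_Omega \<alpha> \<beta> - H_Omega \<beta> \<alpha>))
      = e2pi (of_int n)"
    unfolding diff n e2pi_def exp_add[symmetric] by (rule arg_cong[where f = exp]) (simp add: algebra_simps)
  then have one: "exp (\<i> * of_real pi * of_real (E_Omega \<alpha> \<beta>))
      * exp (of_real pi / 2 * (H_Omega \<alpha> \<beta> - H_Omega \<beta> \<alpha>)) = 1" by simp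
  have "Jf (\<alpha> + \<beta>) z = chi \<alpha> * chi \<beta> * (exp (\<i> * of_real pi * of_real (E_Omega \<alpha> \<beta>))
      * exp (of_real pi * H_Omega z (\<alpha> + \<beta>) + of_real pi / 2 * H_Omega (\<alpha> + \<beta>) (\<alpha> + \<beta>)))"
    using semichar \<alpha> \<beta> unfolding semicharacter_def Jf_def J_factor_def by simp
  also have "of_real pi * H_Omega z (\<alpha> + \<beta>) + of_real pi / 2 * H_Omega (\<alpha> + \<beta>) (\<alpha> + \<beta>)
      = of_real pi / 2 * (H_Omega \<alpha> \<beta> - H_Omega \<beta> \<alpha>)
        + ((of_real pi * H_Omega (z + \<beta>) \<alpha> + of_real pi / 2 * H_Omega \<alpha> \<alpha>)
          + (of_real pi * H_Omega z \<beta> + of_real pi / 2 * H_Omega \<beta> \<beta>))"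
    by (simp add: H_Omega_add algebra_simps)
  also have "exp (\<i> * of_real pi * of_real (E_Omega \<alpha> \<beta>)) * exp \<dots>
      = exp (of_real pi * H_Omega (z + \<beta>) \<alpha> + of_real pi / 2 * H_Omega \<alpha> \<alpha>)
          * exp (of_real pi * H_Omega z \<beta> + of_real pi / 2 * H_Omega \<beta> \<beta>)"
    using one by (simp only: exp_add mult.assoc[symmetric] mult_1_left)
  finally show "Jf (\<alpha> + \<beta>) z = Jf \<alpha> (z + \<beta>) * Jf \<beta> z"
    by (simp add: Jf_def J_factor_def)
qed

lemma Jf_nonzero: "\<alpha> \<in> L \<Longrightarrow> Jf \<alpha> z \<noteq> 0"
  using automorphy unfolding automorphy_factor_def by blast

abbreviation V :: "nat \<Rightarrow> (complex^2 \<Rightarrow> complex) set" where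
  "V N \<equiv> sections L (tensor_power Jf N)"

text \<open>Multiplication by this entire function makes a section quasi-periodic for \<open>\<int>\<^sup>2\<close>.\<close>

definition nrm :: "nat \<Rightarrow> (complex^2 \<Rightarrow> complex) \<Rightarrow> complex^2 \<Rightarrow> complex" where
  "nrm N \<theta> z = exp (- (of_nat N * of_real pi / 2 * dotc z z)) * \<theta> z"

definition quasi_periodic :: "nat \<Rightarrow> (complex^2 \<Rightarrow> complex) \<Rightarrow> bool" where
  "quasi_periodic N f \<longleftrightarrow>
     (\<forall>n z. f (z + ivec n) = e2pi (of_nat N * dotc c (ivec n)) * f z) \<and>
     (\<forall>m z. f (z + per m) = chi (per m) ^ N *
       e2pi (- of_nat N * dotc z (ivec (circ A B m)) - of_nat N / 2 * dotc (per m) (ivec (circ A B m))) * f z)"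

text \<open>
  The normalisation subtracts from \<open>H\<close> the symmetric bilinear form that agrees with it on \<open>\<real>\<^sup>2\<close>.
\<close>

lemma nrm_shift_iff:
  assumes K: "Jf \<alpha> z = K * exp (of_real pi * dotc z \<alpha> + of_real pi / 2 * dotc \<alpha> \<alpha>)"
  shows "\<theta> (z + \<alpha>) = tensor_power Jf N \<alpha> z * \<theta> z \<longleftrightarrow> nrm N \<theta> (z + \<alpha>) = K ^ N * nrm N \<theta> z"
proof -
  define q where "q z = of_nat N * of_real pi / 2 * dotc z z" for z
  have "q (z + \<alpha>) = q z + of_nat N * (of_real pi * dotc z \<alpha> + of_real pi / 2 * dotc \<alpha> \<alpha>)"
    unfolding q_def dotc_add dotc_commute[of \<alpha> z] by (simp add: field_simps)
  then have q: "exp (q (z + \<alpha>)) = exp (q z) * exp (of_real pi * dotc z \<alpha> + of_real pi / 2 * dotc \<alpha> \<alpha>) ^ N"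
    by (simp only: exp_add exp_of_nat_mult)
  have cancel: "t / (e * x) = k * s / e \<longleftrightarrow> t = k * x * s" if "e \<noteq> 0" "x \<noteq> 0" for t e x k s :: complex
    using that by (simp add: divide_eq_eq eq_divide_eq mult_ac)
  have "nrm N \<theta> (z + \<alpha>) = K ^ N * nrm N \<theta> z \<longleftrightarrow> \<theta> (z + \<alpha>) / exp (q (z + \<alpha>)) = K ^ N * \<theta> z / exp (q z)"
    unfolding nrm_def q_def exp_minus divide_inverse by (simp only: mult_ac)
  also have "\<dots> \<longleftrightarrow> \<theta> (z + \<alpha>) = tensor_power Jf N \<alpha> z * \<theta> z"
    unfolding q tensor_power_def K power_mult_distrib by (rule cancel) simp_all
  finally show ?thesis by simp
qed

lemma nrm_shift_ivec:
  "\<theta> (z + ivec n) = tensor_power Jf N (ivec n) z * \<theta> z \<longleftrightarrow>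
    nrm N \<theta> (z + ivec n) = e2pi (of_nat N * dotc c (ivec n)) * nrm N \<theta> z"
proof -
  have "Jf (ivec n) z = e2pi (dotc c (ivec n)) * exp (of_real pi * dotc z (ivec n) + of_real pi / 2 * dotc (ivec n) (ivec n))"
    by (simp add: Jf_def J_factor_def chi_ivec H_Omega_ivec)
  from nrm_shift_iff[OF this] show ?thesis by (simp add: e2pi_power)
qed

lemma nrm_shift_per:
  "\<theta> (z + per m) = tensor_power Jf N (per m) z * \<theta> z \<longleftrightarrow>
    nrm N \<theta> (z + per m) = chi (per m) ^ N *
       e2pi (- of_nat N * dotc z (ivec (circ A B m)) - of_nat N / 2 * dotc (per m) (ivec (circ A B m))) * nrm N \<theta> z"
proof -
  let ?k = "ivec (circ A B m)"
  let ?e = "e2pi (- dotc z ?k - 1 / 2 * dotc (per m) ?k)"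
  have "of_real pi * H_Omega z (per m) + of_real pi / 2 * H_Omega (per m) (per m)
    = 2 * of_real pi * \<i> * (- dotc z ?k - 1 / 2 * dotc (per m) ?k)
      + (of_real pi * dotc z (per m) + of_real pi / 2 * dotc (per m) (per m))"
    by (simp add: H_Omega_per algebra_simps)
  then have "Jf (per m) z = chi (per m) * ?e * exp (of_real pi * dotc z (per m) + of_real pi / 2 * dotc (per m) (per m))"
    unfolding Jf_def J_factor_def e2pi_def by (simp only: exp_add mult.assoc)
  from nrm_shift_iff[OF this, of \<theta> N] show ?thesis
    by (simp add: power_mult_distrib e2pi_power algebra_simps)
qed

text \<open>
  By the cocycle identity, the automorphy condition for \<open>L\<close> follows from that for \<open>\<int>\<^sup>2 \<Omega>\<close> and for \<open>\<int>\<^sup>2\<close>.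
\<close>

lemma sections_iff:
  "\<theta> \<in> V N \<longleftrightarrow> holomorphic_on2 \<theta> UNIV \<and> quasi_periodic N (nrm N \<theta>)"
proof -
  have "(\<forall>\<alpha>\<in>L. \<forall>z. \<theta> (z + \<alpha>) = tensor_power Jf N \<alpha> z * \<theta> z) \<longleftrightarrow>
    (\<forall>n z. \<theta> (z + ivec n) = tensor_power Jf N (ivec n) z * \<theta> z) \<and>
    (\<forall>m z. \<theta> (z + per m) = tensor_power Jf N (per m) z * \<theta> z)" (is "?l \<longleftrightarrow> ?n \<and> ?m")
  proof
    assume ?l
    then show "?n \<and> ?m" using per_in_L ivec_in_L by blast
  next
    assume nm: "?n \<and> ?m"
    show ?l
    proof (intro ballI allI)
      fix \<alpha> z assume "\<alpha> \<in> L"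
      then obtain m n where \<alpha>: "\<alpha> = per m + ivec n" by (rule L_cases)
      have "\<theta> (z + \<alpha>) = \<theta> ((z + ivec n) + per m)" by (simp add: \<alpha> algebra_simps)
      also have "\<dots> = tensor_power Jf N (per m) (z + ivec n) * (tensor_power Jf N (ivec n) z * \<theta> z)"
        using nm by metis
      also have "\<dots> = tensor_power Jf N \<alpha> z * \<theta> z"
        using automorphy per_in_L[of m] ivec_in_L[of n]
        unfolding automorphy_factor_def tensor_power_def \<alpha> by (simp add: power_mult_distrib)
      finally show "\<theta> (z + \<alpha>) = tensor_power Jf N \<alpha> z * \<theta> z" .
    qed
  qed
  then show ?thesis
    unfolding sections_def quasi_periodic_def nrm_shift_ivec nrm_shift_per by blast
qed

lemma holomorphic_on2_nrm:
  "holomorphic_on2 \<theta> S \<Longrightarrow> holomorphic_on2 (nrm N \<theta>) S"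
  unfolding nrm_def[abs_def]
  by (intro holomorphic_on2_mult holomorphic_on2_exp holomorphic_on2_minus holomorphic_on2_const
      holomorphic_on2_dotc_self)


subsection \<open>The recursion for Fourier coefficients\<close>

definition freq :: "nat \<Rightarrow> int \<times> int \<Rightarrow> complex^2" where
  "freq N k = ivec k + of_nat N *s c"

definition circN :: "nat \<Rightarrow> int \<times> int \<Rightarrow> int \<times> int" where
  "circN N m = circ (int N * A) (int N * B) m"

definition fcoeff :: "nat \<Rightarrow> (complex^2 \<Rightarrow> complex) \<Rightarrow> int \<times> int \<Rightarrow> complex" where
  "fcoeff N f k = mean (\<lambda>z. f z * e2pi (- dotc (freq N k) z))"

text \<open>
  The factor by which the Fourier coefficients at \<open>k\<close> and \<open>k + N m Im \<Omega>\<close> of a section differ.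
\<close>

definition multiplier :: "nat \<Rightarrow> int \<times> int \<Rightarrow> int \<times> int \<Rightarrow> complex" where
  "multiplier N m k = e2pi (dotc (freq N k) (per m) + of_nat N / 2 * dotc (per m) (ivec (circ A B m))) / chi (per m) ^ N"

definition theta_coefficients :: "nat \<Rightarrow> (int \<times> int \<Rightarrow> complex) \<Rightarrow> bool" where
  "theta_coefficients N a \<longleftrightarrow> (\<forall>m k. a (k + circN N m) = multiplier N m k * a k)"

lemma ivec_circN: "ivec (circN N m) = of_nat N *s ivec (circ A B m)"
  by (simp add: vec_eq_iff forall_2 circN_def circ_def algebra_simps)

lemma circN_add: "circN N (m + n) = circN N m + circN N n"
  by (simp add: circN_def circ_add)

lemma circN_0: "circN N 0 = 0"
  by (simp add: circN_def circ_def zero_prod_def)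

lemma freq_add: "freq N (k + l) = freq N k + ivec l"
  by (simp add: freq_def ivec_add)

lemma freq_real: "Im (freq N k $ 1) = 0" "Im (freq N k $ 2) = 0"
  by (simp_all add: freq_def c_real)

lemma multiplier_nonzero: "multiplier N m k \<noteq> 0"
  by (simp add: multiplier_def chi_nonzero per_in_L)

text \<open>
  The recursions for different \<open>m\<close> are compatible because the period matrix is symmetric and \<open>chi\<close> is
  multiplicative on \<open>\<int>\<^sup>2 \<Omega>\<close>, where \<open>E\<close> vanishes.
\<close>

lemma multiplier_add: "multiplier N (m + n) k = multiplier N m (k + circN N n) * multiplier N n k"
proof -
  have "dotc (freq N k) (per (m + n)) + of_nat N / 2 * dotc (per (m + n)) (ivec (circ A B (m + n)))
    = (dotc (freq N (k + circN N n)) (per m) + of_nat N / 2 * dotc (per m) (ivec (circ A B m)))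
      + (dotc (freq N k) (per n) + of_nat N / 2 * dotc (per n) (ivec (circ A B n)))"
    using dotc_per_circ[of n m]
    by (simp add: freq_add ivec_circN per_add circ_add ivec_add dotc_add dotc_smult
        dotc_commute[of "ivec _" "per _"] field_simps)
  then show ?thesis
    by (simp add: multiplier_def chi_per_add power_mult_distrib e2pi_add)
qed

lemma quasi_periodic_character:
  assumes "quasi_periodic N f"
  shows "f (z + ivec n) * e2pi (- dotc (freq N k) (z + ivec n)) = f z * e2pi (- dotc (freq N k) z)"
proof -
  have "f (z + ivec n) = e2pi (of_nat N * dotc c (ivec n)) * f z"
    using assms unfolding quasi_periodic_def by blast
  moreover have "e2pi (- dotc (freq N k) (z + ivec n))
      = e2pi (- dotc (freq N k) z) / (e2pi (dotc (ivec k) (ivec n)) * e2pi (of_nat N * dotc c (ivec n)))"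
    unfolding e2pi_add[symmetric] e2pi_diff[symmetric]
    by (rule arg_cong[where f = e2pi]) (simp add: freq_def dotc_add dotc_smult algebra_simps)
  ultimately show ?thesis by simp
qed

lemma ivec_unit: "ivec (1, 0) = cpoint 1 0" "ivec (0, 1) = cpoint 0 1"
  by (simp_all add: ivec_def)

text \<open>
  Translation by a period does not change the mean; on the Fourier coefficients it multiplies by a
  constant and shifts the index by \<open>N m Im \<Omega>\<close>.
\<close>

lemma theta_coefficients_coeff:
  assumes f: "holomorphic_on2 f UNIV" and qp: "quasi_periodic N f"
  shows "theta_coefficients N (fcoeff N f)"
  unfolding theta_coefficients_def
proof (intro allI)
  fix m k
  let ?\<kappa> = "ivec (circ A B m)"
  define F where "F z = f z * e2pi (- dotc (freq N k) z)" for z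
  have F: "holomorphic_on2 F UNIV"
    unfolding F_def dotc_minus(1)[symmetric] by (intro holomorphic_on2_mult f holomorphic_on2_character)
  have "F (z + ivec n) = F z" for z n
    unfolding F_def by (rule quasi_periodic_character[OF qp])
  from this[of _ "(1, 0)"] this[of _ "(0, 1)"]
  have shift: "mean (\<lambda>z. F (z + per m)) = mean F"
    unfolding ivec_unit by (intro mean_shift F)
  have "F (z + per m) = inverse (multiplier N m k) * (f z * e2pi (- dotc (freq N (k + circN N m)) z))" for z
  proof -
    let ?X = "e2pi (- of_nat N * dotc z ?\<kappa> - of_nat N / 2 * dotc (per m) ?\<kappa>)"
    let ?M = "dotc (freq N k) (per m) + of_nat N / 2 * dotc (per m) ?\<kappa>"
    have f_shift: "f (z + per m) = chi (per m) ^ N * ?X * f z"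
      using qp unfolding quasi_periodic_def by blast
    have X: "?X * e2pi (- dotc (freq N k) (z + per m)) = e2pi (- ?M) * e2pi (- dotc (freq N (k + circN N m)) z)"
      unfolding e2pi_add[symmetric]
      by (rule arg_cong[where f = e2pi])
        (simp add: freq_add ivec_circN dotc_add dotc_smult dotc_commute[of z] algebra_simps)
    have "F (z + per m) = chi (per m) ^ N * f z * (?X * e2pi (- dotc (freq N k) (z + per m)))"
      unfolding F_def f_shift by (simp only: mult_ac)
    also have "\<dots> = inverse (e2pi ?M / chi (per m) ^ N) * (f z * e2pi (- dotc (freq N (k + circN N m)) z))"
      unfolding X e2pi_minus[of ?M]
      by (simp only: divide_inverse inverse_mult_distrib inverse_inverse_eq mult_ac)
    finally show ?thesis unfolding multiplier_def .
  qed
  then have "mean (\<lambda>z. F (z + per m)) = inverse (multiplier N m k) * fcoeff N f (k + circN N m)"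
    unfolding fcoeff_def mean_cmult[symmetric] by presburger
  moreover have "mean F = fcoeff N f k" unfolding fcoeff_def F_def ..
  ultimately have "fcoeff N f k = inverse (multiplier N m k) * fcoeff N f (k + circN N m)"
    using shift by simp
  then show "fcoeff N f (k + circN N m) = multiplier N m k * fcoeff N f k"
    using multiplier_nonzero[of N m k] by simp
qed

lemma zero_of_coeff_zero:
  assumes f: "holomorphic_on2 f UNIV" and qp: "quasi_periodic N f" and zero: "\<And>k. fcoeff N f k = 0"
  shows "f z = 0"
proof -
  define F where "F z = f z * e2pi (- dotc (freq N 0) z)" for z
  have F: "holomorphic_on2 F UNIV"
    unfolding F_def dotc_minus(1)[symmetric] by (intro holomorphic_on2_mult f holomorphic_on2_character)
  have per: "F (z + ivec n) = F z" for z n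
    unfolding F_def by (rule quasi_periodic_character[OF qp])
  have "F z * e2pi (dotc (ivec k) z) = f z * e2pi (- dotc (freq N (- k)) z)" for k z
    unfolding F_def mult.assoc e2pi_add[symmetric]
    by (simp add: freq_def ivec_minus dotc_add dotc_diff dotc_minus)
  then have "mean (\<lambda>z. F z * e2pi (dotc (ivec k) z)) = 0" for k
    using zero[of "- k"] by (simp add: fcoeff_def)
  then have "F z = 0"
    using per[of _ "(1, 0)"] per[of _ "(0, 1)"] unfolding ivec_unit
    by (intro fourier_coefficients_zero2[OF F]) auto
  then show ?thesis by (simp add: F_def)
qed

definition reps :: "nat \<Rightarrow> (int \<times> int) set" where
  "reps N = (SOME Q. finite Q \<and> int (card Q) = (int N * A)\<^sup>2 - (int N * B)\<^sup>2 \<and>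
     (\<forall>k. \<exists>!p. fst p \<in> Q \<and> k = fst p + circN N (snd p)))"

text \<open>
  The index \<open>k\<close> is written as a representative plus a shift; the pair consists of the representative and
  of the vector whose image under \<open>circN\<close> is the shift.
\<close>

definition decomp :: "nat \<Rightarrow> int \<times> int \<Rightarrow> (int \<times> int) \<times> (int \<times> int)" where
  "decomp N k = (THE p. fst p \<in> reps N \<and> k = fst p + circN N (snd p))"

context
  fixes N :: nat
  assumes N: "N > 0"
begin

lemma scaled_bound: "\<bar>int N * B\<bar> < int N * A"
  using AB N by (simp add: abs_mult)

lemma finite_reps: "finite (reps N)"
  and card_reps: "int (card (reps N)) = (int N * A)\<^sup>2 - (int N * B)\<^sup>2"
  and reps_unique: "\<exists>!p. fst p \<in> reps N \<and> k = fst p + circN N (snd p)"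
  using someI_ex[OF circ_representatives[OF scaled_bound, folded circN_def]] unfolding reps_def[symmetric] by blast+

lemma decomp: "fst (decomp N k) \<in> reps N" "k = fst (decomp N k) + circN N (snd (decomp N k))"
  using theI'[OF reps_unique[of k]] unfolding decomp_def by blast+

lemma decomp_eqI: "r \<in> reps N \<Longrightarrow> k = r + circN N m \<Longrightarrow> decomp N k = (r, m)"
  unfolding decomp_def using reps_unique[of k] by (intro the1_equality) auto

lemma decomp_rep: "r \<in> reps N \<Longrightarrow> decomp N r = (r, 0)"
  by (rule decomp_eqI) (simp_all add: circN_0)

lemma decomp_shift: "decomp N (k + circN N m) = (fst (decomp N k), snd (decomp N k) + m)"
  by (rule decomp_eqI) (use decomp[of k] in \<open>simp_all add: circN_add algebra_simps\<close>)

lemma reps_nonempty: "reps N \<noteq> {}"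
  using decomp(1) by blast

text \<open>
  The coefficients decay like a Gaussian: \<open>|a k| exp (\<pi> |k + N c|\<^sup>2 / N)\<close> is invariant under the
  recursion, hence takes only finitely many values.
\<close>

lemma norm_multiplier_gaussian:
  "norm (multiplier N m k) * exp (pi / N * (norm (freq N (k + circN N m)))\<^sup>2) = exp (pi / N * (norm (freq N k))\<^sup>2)"
proof -
  let ?\<kappa> = "ivec (circ A B m)" and ?f = "freq N k"
  have im: "Im (dotc ?f (per m)) = Re (dotc ?f ?\<kappa>)"
    by (simp add: Im_dotc_real[OF freq_real] dotc_def circ_def Im_tau Im_zeta freq_real)
  have im': "Im (dotc (per m) ?\<kappa>) = Re (dotc ?\<kappa> ?\<kappa>)"
    unfolding dotc_commute[of "per m"] by (simp add: Im_dotc_real dotc_def circ_def Im_tau Im_zeta)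
  have n: "norm (multiplier N m k) = exp (- (2 * pi * (Re (dotc ?f ?\<kappa>) + N / 2 * Re (dotc ?\<kappa> ?\<kappa>))))"
    by (simp add: multiplier_def norm_divide norm_power chi_nonzero(2)[OF per_in_L] norm_e2pi im im')
  have "(norm (freq N (k + circN N m)))\<^sup>2 = Re (dotc (?f + of_nat N *s ?\<kappa>) (?f + of_nat N *s ?\<kappa>))"
    unfolding norm_sq_real_vec[OF freq_real] by (simp add: freq_add ivec_circN)
  also have "\<dots> = (norm ?f)\<^sup>2 + 2 * N * Re (dotc ?f ?\<kappa>) + N * N * Re (dotc ?\<kappa> ?\<kappa>)"
    unfolding norm_sq_real_vec[OF freq_real]
    by (simp add: dotc_add dotc_smult dotc_commute[of ?\<kappa> ?f] algebra_simps)
  finally show ?thesis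
    unfolding n exp_add[symmetric] using N by (simp add: field_simps)
qed

lemma theta_coefficients_rapid:
  assumes a: "theta_coefficients N a"
  shows "rapid a (freq N)"
proof -
  define G where "G k = norm (a k) * exp (pi / N * (norm (freq N k))\<^sup>2)" for k
  have inv: "G (k + circN N m) = G k" for k m
    using arg_cong[OF norm_multiplier_gaussian[of m k], of "\<lambda>t. norm (a k) * t"]
      a[unfolded theta_coefficients_def, rule_format, of k m]
    unfolding G_def by (simp add: norm_mult mult_ac)
  obtain C where C: "\<And>r. r \<in> reps N \<Longrightarrow> G r \<le> C"
    using Max_ge[OF finite_imageI[OF finite_reps]] by blast
  have "G k \<le> C" for k
    using C[OF decomp(1)[of k]] inv[of "fst (decomp N k)" "snd (decomp N k)"] decomp(2)[of k] by simp
  then have "norm (a k) \<le> C * exp (- (pi / N) * (norm (ivec k + of_nat N *s c))\<^sup>2)" for k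
    unfolding G_def freq_def by (simp add: exp_minus field_simps)
  then have "rapid a (\<lambda>k. ivec k + of_nat N *s c)"
    by (rule gaussian_rapid) (use N in simp)
  then show ?thesis by (simp add: freq_def[abs_def])
qed

definition theta_series :: "(int \<times> int \<Rightarrow> complex) \<Rightarrow> complex^2 \<Rightarrow> complex" where
  "theta_series a z = exp (of_nat N * of_real pi / 2 * dotc z z) * fseries a (freq N) z"

lemma nrm_theta_series: "nrm N (theta_series a) = fseries a (freq N)"
  by (simp add: nrm_def theta_series_def fun_eq_iff exp_minus)

text \<open>Every solution of the recursion defines a section; translation by a period reindexes the series.\<close>

lemma quasi_periodic_fseries:
  assumes a: "theta_coefficients N a"
  shows "quasi_periodic N (fseries a (freq N))"
  unfolding quasi_periodic_def
proof (intro conjI allI)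
  fix n z
  have "e2pi (dotc (freq N k) (z + ivec n)) = e2pi (of_nat N * dotc c (ivec n)) * e2pi (dotc (freq N k) z)" for k
    by (simp add: freq_def dotc_add dotc_smult e2pi_add)
  then show "fseries a (freq N) (z + ivec n) = e2pi (of_nat N * dotc c (ivec n)) * fseries a (freq N) z"
    unfolding fseries_def infsum_cmult_right'[symmetric] by (simp add: mult_ac)
next
  fix m z
  let ?\<kappa> = "ivec (circ A B m)"
  let ?K = "chi (per m) ^ N * e2pi (- of_nat N * dotc z ?\<kappa> - of_nat N / 2 * dotc (per m) ?\<kappa>)"
  have bij: "bij_betw (\<lambda>k. k + circN N m) UNIV UNIV"
    by (rule bij_betw_byWitness[where f' = "\<lambda>k. k - circN N m"]) auto
  have shifted: "?K * (a (k + circN N m) * e2pi (dotc (freq N (k + circN N m)) z)) = a k * e2pi (dotc (freq N k) (z + per m))"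
    for k
  proof -
    have "e2pi (- of_nat N * dotc z ?\<kappa> - of_nat N / 2 * dotc (per m) ?\<kappa>)
      * e2pi (dotc (freq N k) (per m) + of_nat N / 2 * dotc (per m) ?\<kappa>) * e2pi (dotc (freq N (k + circN N m)) z)
      = e2pi (dotc (freq N k) (z + per m))"
      unfolding e2pi_add[symmetric]
      by (rule arg_cong[where f = e2pi])
        (simp add: freq_add ivec_circN dotc_add dotc_smult dotc_commute[of z] algebra_simps)
    moreover have "a (k + circN N m) = multiplier N m k * a k"
      using a unfolding theta_coefficients_def by blast
    ultimately show ?thesis
      using chi_nonzero(1)[OF per_in_L[of m]] by (simp add: multiplier_def mult_ac)
  qed
  have "?K * fseries a (freq N) z = (\<Sum>\<^sub>\<infinity>k. ?K * (a k * e2pi (dotc (freq N k) z)))"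
    unfolding fseries_def infsum_cmult_right'[symmetric] ..
  also have "\<dots> = (\<Sum>\<^sub>\<infinity>k. ?K * (a (k + circN N m) * e2pi (dotc (freq N (k + circN N m)) z)))"
    by (rule infsum_reindex_bij_betw[OF bij, symmetric])
  finally show "fseries a (freq N) (z + per m) = ?K * fseries a (freq N) z"
    unfolding shifted by (simp add: fseries_def)
qed

lemma theta_series_section:
  assumes a: "theta_coefficients N a"
  shows "theta_series a \<in> V N"
proof -
  have "holomorphic_on2 (theta_series a) UNIV"
    unfolding theta_series_def[abs_def]
    by (intro holomorphic_on2_dotc_self holomorphic_on2_mult holomorphic_on2_exp holomorphic_on2_const holomorphic_on2_fseries
        theta_coefficients_rapid[OF a])
  then show ?thesis unfolding sections_iff nrm_theta_series using quasi_periodic_fseries[OF a] by blast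
qed

lemma coeff_theta_series:
  assumes a: "theta_coefficients N a"
  shows "fcoeff N (nrm N (theta_series a)) = a"
proof
  fix j
  have "freq N i - freq N j = ivec (i - j)" for i by (simp add: freq_def ivec_diff)
  then have "i \<noteq> j \<Longrightarrow> \<exists>k. k \<noteq> 0 \<and> freq N i - freq N j = ivec k" for i
    by (metis right_minus_eq)
  then show "fcoeff N (nrm N (theta_series a)) j = a j"
    unfolding nrm_theta_series fcoeff_def
    by (rule fseries_coefficient[OF theta_coefficients_rapid[OF a]])
qed


subsection \<open>A basis of the space of sections\<close>

text \<open>
  The solution of the recursion that is 1 at \<open>r\<close> and 0 at all other representatives.
\<close>

definition basis_coefficients :: "int \<times> int \<Rightarrow> int \<times> int \<Rightarrow> complex" where
  "basis_coefficients r k = (if fst (decomp N k) = r then multiplier N (snd (decomp N k)) r else 0)"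

lemma theta_coefficients_basis: "theta_coefficients N (basis_coefficients r)"
  unfolding theta_coefficients_def
proof (intro allI)
  fix m k
  show "basis_coefficients r (k + circN N m) = multiplier N m k * basis_coefficients r k"
  proof (cases "fst (decomp N k) = r")
    case True
    then have "r + circN N (snd (decomp N k)) = k" using decomp(2)[of k] by simp
    then show ?thesis
      using multiplier_add[of N m "snd (decomp N k)" r] True
      by (simp add: basis_coefficients_def decomp_shift add.commute)
  qed (simp add: basis_coefficients_def decomp_shift)
qed

lemma multiplier_0: "multiplier N 0 r = 1"
proof -
  have "multiplier N 0 r = multiplier N 0 r * multiplier N 0 r"
    using multiplier_add[of N 0 0 r] by (simp add: circN_0)
  then show ?thesis using multiplier_nonzero[of N 0 r] by simp
qed

lemma basis_coefficients_rep: "r' \<in> reps N \<Longrightarrow> basis_coefficients r r' = (if r' = r then 1 else 0)"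
  by (auto simp: basis_coefficients_def decomp_rep multiplier_0)

definition basis_section :: "int \<times> int \<Rightarrow> complex^2 \<Rightarrow> complex" where
  "basis_section r = theta_series (basis_coefficients r)"

lemma basis_section_in_V: "basis_section r \<in> V N"
  unfolding basis_section_def by (rule theta_series_section[OF theta_coefficients_basis])

lemma subspace_V: "cfun.subspace (V N)"
  unfolding cfun.subspace_def sections_def fscale_def
  by (auto simp: distrib_left distrib_right mult_ac zero_fun_def plus_fun_def)

lemma coeff_nrm_add:
  assumes "holomorphic_on2 \<theta> UNIV" "holomorphic_on2 \<eta> UNIV"
  shows "fcoeff N (nrm N (\<theta> + \<eta>)) k = fcoeff N (nrm N \<theta>) k + fcoeff N (nrm N \<eta>) k"
proof -
  have "continuous_on UNIV (\<lambda>z. nrm N f z * e2pi (- dotc (freq N k) z))" if "holomorphic_on2 f UNIV" for f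
    unfolding dotc_minus(1)[symmetric]
    by (intro holomorphic_on2_continuous_on holomorphic_on2_mult holomorphic_on2_nrm that holomorphic_on2_character)
  from mean_add[OF this[OF assms(1)] this[OF assms(2)]] show ?thesis
    by (simp add: fcoeff_def nrm_def distrib_left distrib_right)
qed

lemma coeff_nrm_scale: "fcoeff N (nrm N (fscale s \<theta>)) k = s * fcoeff N (nrm N \<theta>) k"
proof -
  have "(\<lambda>z. nrm N (fscale s \<theta>) z * e2pi (- dotc (freq N k) z)) = (\<lambda>z. s * (nrm N \<theta> z * e2pi (- dotc (freq N k) z)))"
    by (simp add: nrm_def fscale_def mult_ac)
  then show ?thesis by (simp add: fcoeff_def mean_cmult)
qed

lemma combination_in_V:
  "finite Q \<Longrightarrow> (\<Sum>r\<in>Q. fscale (u r) (basis_section r)) \<in> V N"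
  by (intro cfun.subspace_sum[OF subspace_V] cfun.subspace_scale[OF subspace_V] basis_section_in_V)

lemma coeff_combination:
  assumes "finite Q"
  shows "fcoeff N (nrm N (\<Sum>r\<in>Q. fscale (u r) (basis_section r))) k = (\<Sum>r\<in>Q. u r * basis_coefficients r k)"
  using assms
proof (induction Q rule: finite_induct)
  case empty
  show ?case by (simp add: fcoeff_def nrm_def mean_def)
next
  case (insert r Q)
  have "holomorphic_on2 (fscale (u r) (basis_section r)) UNIV"
    using cfun.subspace_scale[OF subspace_V basis_section_in_V] by (auto simp: sections_def)
  moreover have "holomorphic_on2 (\<Sum>r\<in>Q. fscale (u r) (basis_section r)) UNIV"
    using combination_in_V[OF insert.hyps(1)] by (auto simp: sections_def)
  ultimately show ?case
    using insert by (simp add: coeff_nrm_add coeff_nrm_scale basis_section_def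
        coeff_theta_series[OF theta_coefficients_basis] del: plus_fun_apply)
qed

lemma section_zero_of_coeff_reps:
  assumes \<theta>: "\<theta> \<in> V N" and zero: "\<And>r. r \<in> reps N \<Longrightarrow> fcoeff N (nrm N \<theta>) r = 0"
  shows "\<theta> = 0"
proof -
  have hol: "holomorphic_on2 (nrm N \<theta>) UNIV" and qp: "quasi_periodic N (nrm N \<theta>)"
    using \<theta> holomorphic_on2_nrm unfolding sections_iff by blast+
  have "fcoeff N (nrm N \<theta>) k = 0" for k
    using theta_coefficients_coeff[OF hol qp] zero[OF decomp(1)[of k]] decomp(2)[of k]
    unfolding theta_coefficients_def by (metis mult_zero_right)
  from zero_of_coeff_zero[OF hol qp this] show ?thesis by (simp add: nrm_def fun_eq_iff)
qed

lemma sum_basis_coefficients_rep: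
  assumes "r \<in> reps N"
  shows "(\<Sum>r'\<in>reps N. u r' * basis_coefficients r' r) = u r"
  using assms finite_reps by (simp add: basis_coefficients_rep if_distrib cong: if_cong)

lemma inj_on_basis_section: "inj_on basis_section (reps N)"
proof (rule inj_onI)
  fix r r' assume rr: "r \<in> reps N" "r' \<in> reps N" and eq: "basis_section r = basis_section r'"
  then have "basis_coefficients r = basis_coefficients r'"
    unfolding basis_section_def using coeff_theta_series[OF theta_coefficients_basis] by metis
  then have "basis_coefficients r r = basis_coefficients r' r" by simp
  then show "r = r'" using rr by (simp add: basis_coefficients_rep split: if_splits)
qed

lemma independent_basis_section: "cfun.independent (basis_section ` reps N)"
  unfolding cfun.dependent_finite[OF finite_imageI[OF finite_reps]] not_ex
proof (intro allI notI)
  fix u assume u: "(\<exists>v\<in>basis_section ` reps N. u v \<noteq> 0) \<and> (\<Sum>v\<in>basis_section ` reps N. fscale (u v) v) = 0"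
  then have "(\<Sum>r\<in>reps N. fscale (u (basis_section r)) (basis_section r)) = 0"
    by (simp add: sum.reindex[OF inj_on_basis_section] o_def)
  then have "(\<Sum>r'\<in>reps N. u (basis_section r') * basis_coefficients r' r) = 0" for r
    using coeff_combination[OF finite_reps, of "\<lambda>r. u (basis_section r)" r]
    by (simp add: fcoeff_def nrm_def mean_def)
  then have "r \<in> reps N \<Longrightarrow> u (basis_section r) = 0" for r
    using sum_basis_coefficients_rep[of r "\<lambda>r. u (basis_section r)"] by simp
  then show False using u by blast
qed

lemma span_basis_section: "cfun.span (basis_section ` reps N) = V N"
proof
  show "cfun.span (basis_section ` reps N) \<subseteq> V N"
    by (rule cfun.span_minimal) (auto simp: basis_section_in_V subspace_V)
  show "V N \<subseteq> cfun.span (basis_section ` reps N)"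
  proof
    fix \<theta> assume \<theta>: "\<theta> \<in> V N"
    define u where "u r = - fcoeff N (nrm N \<theta>) r" for r
    define S where "S = (\<Sum>r\<in>reps N. fscale (u r) (basis_section r))"
    have S: "S \<in> V N" unfolding S_def by (rule combination_in_V[OF finite_reps])
    have "\<theta> + S = 0"
    proof (rule section_zero_of_coeff_reps)
      show "\<theta> + S \<in> V N" by (rule cfun.subspace_add[OF subspace_V \<theta> S])
      fix r assume r: "r \<in> reps N"
      have "fcoeff N (nrm N (\<theta> + S)) r = fcoeff N (nrm N \<theta>) r + fcoeff N (nrm N S) r"
        using \<theta> S by (intro coeff_nrm_add) (auto simp: sections_def)
      also have "fcoeff N (nrm N S) r = u r"
        unfolding S_def coeff_combination[OF finite_reps] by (rule sum_basis_coefficients_rep[OF r])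
      finally show "fcoeff N (nrm N (\<theta> + S)) r = 0" by (simp add: u_def del: plus_fun_apply)
    qed
    then have "\<theta> = - S" by (simp add: add_eq_0_iff2)
    moreover have "S \<in> cfun.span (basis_section ` reps N)"
      unfolding S_def by (intro cfun.span_sum cfun.span_scale cfun.span_base) auto
    ultimately show "\<theta> \<in> cfun.span (basis_section ` reps N)"
      using cfun.span_neg by blast
  qed
qed

lemma dim_V: "int (cfun.dim (V N)) = (int N * A)\<^sup>2 - (int N * B)\<^sup>2"
proof -
  have "cfun.dim (V N) = card (basis_section ` reps N)"
    unfolding span_basis_section[symmetric] cfun.dim_span
    by (rule cfun.dim_eq_card_independent[OF independent_basis_section])
  then show ?thesis by (simp add: card_image[OF inj_on_basis_section] card_reps)
qed

lemma section_basis_exists: "\<exists>M \<theta>. section_basis (V N) M \<theta>"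
proof -
  obtain M where M: "card (reps N) = Suc M"
    using finite_reps reps_nonempty by (cases "card (reps N)") auto
  then obtain h where h: "bij_betw h {..M} (reps N)"
    using ex_bij_betw_nat_finite[OF finite_reps] by (auto simp: atLeast0LessThan lessThan_Suc_atMost)
  have img: "(basis_section \<circ> h) ` {..M} = basis_section ` reps N"
    using h by (simp add: bij_betw_def flip: image_image)
  have "inj_on (basis_section \<circ> h) {..M}"
    using h inj_on_basis_section by (auto simp: bij_betw_def intro: comp_inj_on)
  then have "section_basis (V N) M (basis_section \<circ> h)"
    unfolding section_basis_def img using independent_basis_section span_basis_section by blast
  then show ?thesis by blast
qed

end

end


section \<open>Sections separate points and tangent vectors\<close>

text \<open>
  Each condition excludes only a set with dense open complement.
\<close>

lemma avoid_zeros: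
  assumes "holomorphic_on2 \<theta> UNIV" "\<theta> u \<noteq> 0"
  shows "\<exists>b. \<theta> (p + b) \<noteq> 0 \<and> \<theta> (q + b) \<noteq> 0 \<and> \<theta> (e - b) \<noteq> 0 \<and> \<theta> (e' - b) \<noteq> 0"
proof -
  have hol: "holomorphic_on2 (\<lambda>b. \<theta> (v + b)) UNIV" "holomorphic_on2 (\<lambda>b. \<theta> (v - b)) UNIV" for v
    by (rule holomorphic_on2_shift[OF assms(1)])+
  obtain x where x: "\<theta> (p + x) \<noteq> 0 \<and> \<theta> (q + x) \<noteq> 0"
    using entire_product_nonzero[OF hol(1)[of p] _ hol(1)[of q], of "u - p" "u - q"] assms(2) by auto
  obtain y where y: "\<theta> (e - y) \<noteq> 0 \<and> \<theta> (e' - y) \<noteq> 0"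
    using entire_product_nonzero[OF hol(2)[of e] _ hol(2)[of e'], of "e - u" "e' - u"] assms(2) by auto
  have "\<exists>b. \<theta> (p + b) * \<theta> (q + b) \<noteq> 0 \<and> \<theta> (e - b) * \<theta> (e' - b) \<noteq> 0"
    by (rule entire_product_nonzero[of _ x _ y]) (use x y in \<open>auto intro: hol holomorphic_on2_mult\<close>)
  then show ?thesis by auto
qed

context circulant_torus
begin

subsection \<open>Cocompactness of the lattice\<close>

text \<open>
  Solve for the real coordinates \<open>y\<close>, \<open>x\<close> of \<open>z\<close> with respect to the period basis, the former from the
  imaginary part of \<open>z\<close>, and round them down.
\<close>

lemma lattice_cobounded: "\<exists>R. \<forall>z. \<exists>\<alpha>\<in>L. norm (z - \<alpha>) \<le> R"
proof (intro exI allI)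
  fix z :: "complex^2"
  define D where "D = real_of_int (A\<^sup>2 - B\<^sup>2)"
  have "A\<^sup>2 - B\<^sup>2 = (A - B) * (A + B)" by (simp add: power2_eq_square algebra_simps)
  then have D0: "D \<noteq> 0" using AB by (auto simp: D_def simp del: of_int_diff)
  define y1 where "y1 = (of_int A * Im (z $ 1) - of_int B * Im (z $ 2)) / D"
  define y2 where "y2 = (of_int A * Im (z $ 2) - of_int B * Im (z $ 1)) / D"
  have "(y1 * of_int A + y2 * of_int B) * D = Im (z $ 1) * D"
    "(y1 * of_int B + y2 * of_int A) * D = Im (z $ 2) * D"
    using D0 by (simp_all add: y1_def y2_def distrib_right) (simp_all add: D_def power2_eq_square algebra_simps)
  then have y: "y1 * of_int A + y2 * of_int B = Im (z $ 1)" "y1 * of_int B + y2 * of_int A = Im (z $ 2)"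
    using D0 by simp_all
  define x1 where "x1 = Re (z $ 1 - (of_real y1 * \<tau> + of_real y2 * \<zeta>))"
  define x2 where "x2 = Re (z $ 2 - (of_real y1 * \<zeta> + of_real y2 * \<tau>))"
  have z: "z $ 1 = of_real y1 * \<tau> + of_real y2 * \<zeta> + of_real x1"
    "z $ 2 = of_real y1 * \<zeta> + of_real y2 * \<tau> + of_real x2"
    using y by (simp_all add: complex_eq_iff x1_def x2_def Im_tau Im_zeta)
  define \<alpha> where "\<alpha> = per (\<lfloor>y1\<rfloor>, \<lfloor>y2\<rfloor>) + ivec (\<lfloor>x1\<rfloor>, \<lfloor>x2\<rfloor>)"
  have "\<alpha> \<in> L" unfolding \<alpha>_def L_eq by blast
  moreover have "norm (z - \<alpha>) \<le> 2 * (norm \<tau> + norm \<zeta> + 1)"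
  proof -
    have fr: "norm (complex_of_real (frac t) * s) \<le> norm s" for t s
      using frac_ge_0[of t] frac_lt_1[of t] by (simp add: norm_mult mult_left_le_one_le)
    have comp: "(z - \<alpha>) $ 1 = of_real (frac y1) * \<tau> + of_real (frac y2) * \<zeta> + of_real (frac x1) * 1"
      "(z - \<alpha>) $ 2 = of_real (frac y1) * \<zeta> + of_real (frac y2) * \<tau> + of_real (frac x2) * 1"
      by (simp_all add: \<alpha>_def z frac_def algebra_simps)
    have bound: "norm (of_real (frac y1) * s + of_real (frac y2) * t + of_real (frac x) * 1) \<le> norm s + norm t + 1"
      for s t :: complex and x
    proof -
      have "norm (complex_of_real (frac x) * 1) \<le> 1" using fr[of x 1] by simp
      then show ?thesis
        using fr[of y1 s] fr[of y2 t] by (intro norm_triangle_le add_mono)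
    qed
    have "norm ((z - \<alpha>) $ 1) \<le> norm \<tau> + norm \<zeta> + 1"
      unfolding comp by (rule bound)
    moreover have "norm ((z - \<alpha>) $ 2) \<le> norm \<tau> + norm \<zeta> + 1"
      unfolding comp using bound[of \<zeta> \<tau> x2] by linarith
    moreover have "norm (z - \<alpha>) \<le> norm ((z - \<alpha>) $ 1) + norm ((z - \<alpha>) $ 2)"
      using L2_set_le_sum[of UNIV "\<lambda>i. norm ((z - \<alpha>) $ i)"] by (simp add: norm_vec_def sum_2)
    ultimately show ?thesis by simp
  qed
  ultimately show "\<exists>\<alpha>\<in>L. norm (z - \<alpha>) \<le> 2 * (norm \<tau> + norm \<zeta> + 1)" by blast
qed

lemma periodic_bounded:
  assumes cont: "continuous_on UNIV f" and per: "\<And>z \<alpha>. \<alpha> \<in> L \<Longrightarrow> f (z + \<alpha>) = f z"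
  shows "\<exists>K. \<forall>z. norm (f z) \<le> K"
proof -
  from lattice_cobounded obtain R where R: "\<forall>z. \<exists>\<alpha>\<in>L. norm (z - \<alpha>) \<le> R" ..
  have "compact (f ` cball 0 R)"
    by (intro compact_continuous_image continuous_on_subset[OF cont]) auto
  then have "bounded (f ` cball 0 R)" by (rule compact_imp_bounded)
  then obtain K where "\<forall>x\<in>f ` cball 0 R. norm x \<le> K" unfolding bounded_iff ..
  then have K: "\<And>w. w \<in> cball 0 R \<Longrightarrow> norm (f w) \<le> K" by blast
  have "norm (f z) \<le> K" for z
  proof -
    obtain \<alpha> where \<alpha>: "\<alpha> \<in> L" "norm (z - \<alpha>) \<le> R" using R by blast
    from \<alpha>(2) have "norm (f (z - \<alpha>)) \<le> K" by (intro K) simp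
    then show ?thesis using per[OF \<alpha>(1), of "z - \<alpha>"] by simp
  qed
  then show ?thesis by blast
qed

text \<open>A real-linear functional that vanishes on the lattice is bounded, hence zero.\<close>

lemma linear_zero_on_lattice:
  assumes g: "linear g" and zero: "\<And>\<alpha>. \<alpha> \<in> L \<Longrightarrow> g \<alpha> = (0::real)"
  shows "g z = 0"
proof (rule ccontr)
  assume ne: "g z \<noteq> 0"
  have "continuous_on UNIV g" using g by (simp add: linear_continuous_on linear_conv_bounded_linear)
  then obtain K where K: "\<And>z. norm (g z) \<le> K"
    using periodic_bounded[of g] g zero by (auto simp: linear_add)
  have "norm (g (((\<bar>K\<bar> + 1) / g z) *\<^sub>R z)) = \<bar>K\<bar> + 1"
    using ne by (simp add: linear_scale[OF g])
  then show False using K[of "((\<bar>K\<bar> + 1) / g z) *\<^sub>R z"] by simp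
qed

lemma periodic_entire_constant:
  assumes f: "holomorphic_on2 f UNIV" and per: "\<And>z \<alpha>. \<alpha> \<in> L \<Longrightarrow> f (z + \<alpha>) = f z"
  shows "f z = f w"
proof -
  obtain K where "\<And>z. norm (f z) \<le> K"
    using periodic_bounded[OF holomorphic_on2_continuous_on[OF f] per] by blast
  then show ?thesis by (rule bounded_entire_constant[OF f])
qed


subsection \<open>Products of translates\<close>

lemma Jf_translate: "Jf \<alpha> (z + a) = Jf \<alpha> z * exp (of_real pi * H_Omega a \<alpha>)"
  by (simp add: Jf_def J_factor_def H_Omega_add exp_add distrib_left mult_ac)

lemma section_shift: "\<theta> \<in> V 1 \<Longrightarrow> \<alpha> \<in> L \<Longrightarrow> \<theta> (z + \<alpha>) = Jf \<alpha> z * \<theta> z"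
  and section_holomorphic: "\<theta> \<in> V N \<Longrightarrow> holomorphic_on2 \<theta> UNIV"
  by (auto simp: sections_def tensor_power_def)

text \<open>
  The theorem of the square: translating by \<open>a\<close> multiplies the automorphy factor by
  \<open>exp (\<pi> H(a, \<alpha>))\<close>, and these factors cancel when the translations add up to zero.
\<close>

lemma product_section:
  assumes \<theta>: "\<theta> \<in> V 1"
  shows "(\<lambda>z. \<theta> (z + a) * \<theta> (z + b) * \<theta> (z + (- a - b - of_nat m *s c')) * \<theta> (z + c') ^ m) \<in> V (m + 3)"
proof -
  let ?d = "- a - b - of_nat m *s c'"
  let ?s = "\<lambda>z. \<theta> (z + a) * \<theta> (z + b) * \<theta> (z + ?d) * \<theta> (z + c') ^ m"
  note hol = section_holomorphic[OF \<theta>]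
  have "holomorphic_on2 ?s UNIV"
    by (intro holomorphic_on2_mult holomorphic_on2_power holomorphic_on2_shift(1)[OF hol])
  moreover have "?s (z + \<alpha>) = tensor_power Jf (m + 3) \<alpha> z * ?s z" if \<alpha>: "\<alpha> \<in> L" for \<alpha> z
  proof -
    have sh: "\<theta> (z + \<alpha> + v) = Jf \<alpha> z * exp (of_real pi * H_Omega v \<alpha>) * \<theta> (z + v)" for v
    proof -
      have "z + \<alpha> + v = z + v + \<alpha>" by (simp add: add_ac)
      then show ?thesis by (simp only: section_shift[OF \<theta> \<alpha>] Jf_translate)
    qed
    let ?e = "\<lambda>v. exp (of_real pi * H_Omega v \<alpha>)"
    have d: "H_Omega ?d \<alpha> = - H_Omega a \<alpha> - H_Omega b \<alpha> - of_nat m * H_Omega c' \<alpha>"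
      by (simp add: H_Omega_def algebra_simps)
    have "of_real pi * H_Omega a \<alpha> + of_real pi * H_Omega b \<alpha> + of_real pi * H_Omega ?d \<alpha>
        + of_nat m * (of_real pi * H_Omega c' \<alpha>) = 0"
      unfolding d by (simp add: algebra_simps)
    then have "?e a * ?e b * ?e ?d * ?e c' ^ m = 1"
      unfolding exp_of_nat_mult[symmetric] exp_add[symmetric] by simp
    then have "tensor_power Jf (m + 3) \<alpha> z * ?s z
      = tensor_power Jf (m + 3) \<alpha> z * (?e a * ?e b * ?e ?d * ?e c' ^ m) * ?s z" by simp
    also have "\<dots> = ?s (z + \<alpha>)"
      unfolding sh by (simp only: tensor_power_def power_add power_mult_distrib power3_eq_cube mult_ac)
    finally show ?thesis ..
  qed
  ultimately show ?thesis unfolding sections_def by blast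
qed

text \<open>
  Choose the translations one after the other so that no factor of the product vanishes at \<open>z\<close>.
\<close>

lemma base_point_free:
  assumes \<theta>: "\<theta> \<in> V 1" "\<theta> u \<noteq> 0"
  shows "\<exists>s\<in>V (m + 3). s z \<noteq> 0"
proof -
  define c' where "c' = u - z"
  define a where "a = c'"
  obtain b where b: "\<theta> (z + b) \<noteq> 0" "\<theta> (z + (- a - of_nat m *s c') - b) \<noteq> 0"
    using avoid_zeros[OF section_holomorphic[OF \<theta>(1)] \<theta>(2), of z z "z + (- a - of_nat m *s c')" "z + (- a - of_nat m *s c')"]
    by blast
  have eq: "z + (- a - of_nat m *s c') - b = z + (- a - b - of_nat m *s c')" by (simp add: algebra_simps)
  have "\<theta> (z + a) \<noteq> 0" "\<theta> (z + c') \<noteq> 0" using \<theta>(2) by (simp_all add: a_def c'_def)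
  with b(1) b(2)[unfolded eq] show ?thesis
    by (intro bexI[OF _ product_section[OF \<theta>(1), of a b m c']]) simp
qed


subsection \<open>Separation of points\<close>

text \<open>
  If no section of the \<open>n\<close>-th power separates \<open>z\<^sub>1\<close> and \<open>z\<^sub>2\<close>, then products of translates show
  that \<open>\<theta> (z\<^sub>1 + a) / \<theta> (z\<^sub>2 + a)\<close> has neither zeros nor poles.
\<close>

lemma unseparated_quotient:
  assumes \<theta>: "\<theta> \<in> V 1" "\<theta> u \<noteq> 0" and c0: "c0 \<noteq> 0"
    and uns: "\<And>s. s \<in> V (m + 3) \<Longrightarrow> s z1 = c0 * s z2"
  shows "\<exists>\<phi>. holomorphic_on2 \<phi> UNIV \<and> (\<forall>a. \<theta> (z1 + a) = \<phi> a * \<theta> (z2 + a)) \<and> (\<forall>a. \<phi> a \<noteq> 0)"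
proof (rule quotient_patch)
  note hol = section_holomorphic[OF \<theta>(1)]
  show "holomorphic_on2 (\<lambda>a. \<theta> (z2 + a)) UNIV" by (rule holomorphic_on2_shift[OF hol])
  show "\<theta> (z2 + (u - z2)) \<noteq> 0" using \<theta>(2) by simp
  obtain c' where c': "\<theta> (z1 + c') \<noteq> 0" "\<theta> (z2 + c') \<noteq> 0" using avoid_zeros[OF hol \<theta>(2)] by blast
  fix a0
  let ?e = "\<lambda>z. z + (- a0 - of_nat m *s c')"
  obtain b where b: "\<theta> (z1 + b) \<noteq> 0" "\<theta> (z2 + b) \<noteq> 0" "\<theta> (?e z1 - b) \<noteq> 0" "\<theta> (?e z2 - b) \<noteq> 0"
    using avoid_zeros[OF hol \<theta>(2), of z1 z2 "?e z1" "?e z2"] by blast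
  define Q where "Q z a = \<theta> (z + b) * \<theta> ((z + (- b - of_nat m *s c')) - a) * \<theta> (z + c') ^ m" for z a
  have Q: "holomorphic_on2 (Q z) S" for z S
    unfolding Q_def by (intro holomorphic_on2_mult holomorphic_on2_const holomorphic_on2_shift[OF hol])
  have Q0: "Q z1 a0 \<noteq> 0" "Q z2 a0 \<noteq> 0"
    using b c' by (simp_all add: Q_def algebra_simps)
  have key: "\<theta> (z1 + a) * Q z1 a = c0 * (\<theta> (z2 + a) * Q z2 a)" for a
  proof -
    have eq: "(z + (- b - of_nat m *s c')) - a = z + (- a - b - of_nat m *s c')" for z by (simp add: algebra_simps)
    show ?thesis
      using uns[OF product_section[OF \<theta>(1), of a b m c']] unfolding Q_def eq by (simp add: mult_ac)
  qed
  define W where "W = {a. Q z1 a \<noteq> 0} \<inter> {a. Q z2 a \<noteq> 0}"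
  have "open W"
    unfolding W_def by (intro open_Int open_Collect_neq holomorphic_on2_continuous_on Q continuous_on_const)
  moreover have "holomorphic_on2 (\<lambda>a. c0 * Q z2 a / Q z1 a) W"
    by (intro holomorphic_on2_divide holomorphic_on2_mult holomorphic_on2_const Q) (simp add: W_def)
  moreover have "\<theta> (z1 + a) = c0 * Q z2 a / Q z1 a * \<theta> (z2 + a)" if "a \<in> W" for a
    using key[of a] that by (simp add: W_def field_simps)
  ultimately show "\<exists>W g. open W \<and> a0 \<in> W \<and> holomorphic_on2 g W \<and>
      (\<forall>a\<in>W. \<theta> (z1 + a) = g a * \<theta> (z2 + a)) \<and> g a0 \<noteq> 0"
    using Q0 c0 by (intro exI[of _ W] exI[of _ "\<lambda>a. c0 * Q z2 a / Q z1 a"]) (auto simp: W_def)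
qed

text \<open>
  That quotient has constant multipliers under the lattice. Its own translation quotients are
  therefore periodic, hence constant, and it is the exponential of a linear form, which the
  multipliers identify.
\<close>

lemma unseparated_translation:
  assumes \<theta>: "\<theta> \<in> V 1" "\<theta> u \<noteq> 0" and c0: "c0 \<noteq> 0"
    and uns: "\<And>s. s \<in> V (m + 3) \<Longrightarrow> s z1 = c0 * s z2"
  shows "\<exists>C. \<forall>v. \<theta> (v + (z1 - z2)) = C * exp (of_real pi * H_Omega v (z1 - z2)) * \<theta> v"
    and "\<And>\<alpha>. \<alpha> \<in> L \<Longrightarrow> exp (of_real pi * H_Omega \<alpha> (z1 - z2)) = exp (of_real pi * H_Omega (z1 - z2) \<alpha>)"
proof -
  define w where "w = z1 - z2"
  note hol = section_holomorphic[OF \<theta>(1)]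
  obtain \<phi> where \<phi>: "holomorphic_on2 \<phi> UNIV" "\<And>a. \<theta> (z1 + a) = \<phi> a * \<theta> (z2 + a)" "\<And>a. \<phi> a \<noteq> 0"
    using unseparated_quotient[of \<theta> u c0 m z1 z2, OF \<theta> c0 uns] by blast
  have mult: "\<phi> (a + \<alpha>) = exp (of_real pi * H_Omega w \<alpha>) * \<phi> a" if \<alpha>: "\<alpha> \<in> L" for a \<alpha>
  proof (rule quotient_unique[of "\<lambda>a. \<theta> (z2 + a)" "u - z2" UNIV a "\<lambda>a. \<phi> (a + \<alpha>)"
        "\<lambda>a. exp (of_real pi * H_Omega w \<alpha>) * \<phi> a"])
    show "holomorphic_on2 (\<lambda>a. \<theta> (z2 + a)) UNIV" by (rule holomorphic_on2_shift[OF hol])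
    show "\<theta> (z2 + (u - z2)) \<noteq> 0" using \<theta>(2) by simp
    show "holomorphic_on2 (\<lambda>a. \<phi> (a + \<alpha>)) UNIV" by (rule holomorphic_on2_shift[OF \<phi>(1)])
    show "holomorphic_on2 (\<lambda>a. exp (of_real pi * H_Omega w \<alpha>) * \<phi> a) UNIV"
      by (intro holomorphic_on2_mult holomorphic_on2_const \<phi>(1))
    fix a
    have "Jf \<alpha> (z2 + a) * (\<phi> (a + \<alpha>) * \<theta> (z2 + a)) = \<theta> (z1 + a + \<alpha>)"
      using section_shift[OF \<theta>(1) \<alpha>, of "z2 + a"] \<phi>(2)[of "a + \<alpha>"] by (simp add: add.assoc)
    also have "\<dots> = Jf \<alpha> (z2 + a + w) * \<theta> (z1 + a)"
      using section_shift[OF \<theta>(1) \<alpha>, of "z1 + a"] by (simp add: w_def algebra_simps)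
    also have "\<dots> = Jf \<alpha> (z2 + a) * (exp (of_real pi * H_Omega w \<alpha>) * \<phi> a * \<theta> (z2 + a))"
      unfolding Jf_translate \<phi>(2) by (simp only: mult_ac)
    finally show "\<phi> (a + \<alpha>) * \<theta> (z2 + a) = exp (of_real pi * H_Omega w \<alpha>) * \<phi> a * \<theta> (z2 + a)"
      using Jf_nonzero[OF \<alpha>] by simp
  qed auto
  define \<psi> where "\<psi> a = \<phi> a / \<phi> 0" for a
  have \<psi>_hol: "holomorphic_on2 \<psi> UNIV"
    unfolding \<psi>_def by (intro holomorphic_on2_divide holomorphic_on2_const \<phi>)
  have "\<psi> (x + y) = \<psi> x * \<psi> y" for x y
  proof -
    have "\<phi> (x + y) / \<phi> x = \<phi> (0 + y) / \<phi> 0"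
    proof (rule periodic_entire_constant[of "\<lambda>x. \<phi> (x + y) / \<phi> x"])
      show "holomorphic_on2 (\<lambda>x. \<phi> (x + y) / \<phi> x) UNIV"
        by (intro holomorphic_on2_divide holomorphic_on2_shift \<phi>)
      fix z \<alpha> assume \<alpha>: "\<alpha> \<in> L"
      have "\<phi> (z + \<alpha> + y) = exp (of_real pi * H_Omega w \<alpha>) * \<phi> (z + y)"
        using mult[OF \<alpha>, of "z + y"] by (simp add: add_ac)
      then show "\<phi> (z + \<alpha> + y) / \<phi> (z + \<alpha>) = \<phi> (z + y) / \<phi> z"
        by (simp add: mult[OF \<alpha>, of z])
    qed
    then show ?thesis using \<phi>(3) by (simp add: \<psi>_def field_simps)
  qed
  moreover have "\<psi> 0 = 1" using \<phi>(3) by (simp add: \<psi>_def)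
  ultimately obtain D where D: "\<And>u v. D (u + v) = D u + D v" "\<And>c v. D (c *s v) = c * D v"
    "\<And>u. \<psi> u = exp (D u)"
    using entire_multiplicative[OF \<psi>_hol] by blast
  have expD: "exp (D \<alpha>) = exp (of_real pi * H_Omega w \<alpha>)" if "\<alpha> \<in> L" for \<alpha>
    using mult[OF that, of 0] \<phi>(3) unfolding D(3)[symmetric] by (simp add: \<psi>_def)
  have "linear (\<lambda>z. Re (D z - of_real pi * H_Omega w z))"
    by (rule linearI) (simp_all add: D H_Omega_add H_Omega_smult scaleR_eq_smult algebra_simps)
  moreover have "Re (D \<alpha> - of_real pi * H_Omega w \<alpha>) = 0" if "\<alpha> \<in> L" for \<alpha>
    using arg_cong[OF expD[OF that], of norm] by simp
  ultimately have "Re (D z - of_real pi * H_Omega w z) = 0" for z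
    by (rule linear_zero_on_lattice)
  then have re: "Re (D z) = pi * Re (H_Omega z w)" for z
    by (simp add: H_Omega_commute[of w z])
  \<comment> \<open>Two \<open>\<complex>\<close>-linear forms with the same real part agree.\<close>
  have Dw: "D z = of_real pi * H_Omega z w" for z
    using re[of z] re[of "\<i> *s z"] by (simp add: D H_Omega_smult complex_eq_iff)
  show "\<exists>C. \<forall>v. \<theta> (v + (z1 - z2)) = C * exp (of_real pi * H_Omega v (z1 - z2)) * \<theta> v"
  proof (intro exI allI)
    fix v
    have "\<theta> (v + (z1 - z2)) = \<phi> (v - z2) * \<theta> v"
      using \<phi>(2)[of "v - z2"] by (simp add: algebra_simps)
    also have "\<phi> (v - z2) = \<phi> 0 * \<psi> (v - z2)" using \<phi>(3) by (simp add: \<psi>_def)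
    also have "\<psi> (v - z2) = exp (- D z2) * exp (D v)"
      using D(3)[of "v + (-1) *s z2"] unfolding D(1,2) exp_add by simp
    finally show "\<theta> (v + (z1 - z2)) = (\<phi> 0 * exp (- D z2)) * exp (of_real pi * H_Omega v (z1 - z2)) * \<theta> v"
      by (simp add: Dw w_def)
  qed
  show "exp (of_real pi * H_Omega \<alpha> (z1 - z2)) = exp (of_real pi * H_Omega (z1 - z2) \<alpha>)" if "\<alpha> \<in> L" for \<alpha>
    using expD[OF that] unfolding Dw w_def .
qed

text \<open>In Fourier coefficients, such a translation shifts the index by \<open>Im w\<close>.\<close>

lemma translation_coefficients:
  assumes a: "theta_coefficients 1 a" and w: "\<And>i. Im (w $ i) = Re (ivec k0 $ i)"
    and tr: "\<And>v. theta_series 1 a (v + w) = C * exp (of_real pi * H_Omega v w) * theta_series 1 a v"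
  shows "\<exists>C'. \<forall>k. a k = e2pi (- dotc (freq 1 k) w) * C' * a (k + k0)"
proof (intro exI allI)
  fix k
  define f where "f = nrm 1 (theta_series 1 a)"
  define C' where "C' = C * exp (- (of_real pi / 2 * dotc w w))"
  have sec: "theta_series 1 a \<in> V 1" by (rule theta_series_section[OF _ a]) simp
  have hol: "holomorphic_on2 f UNIV" and qp: "quasi_periodic 1 f"
    using sec holomorphic_on2_nrm unfolding sections_iff f_def by blast+
  have co: "fcoeff 1 f = a" unfolding f_def by (rule coeff_theta_series[OF _ a]) simp
  have fw: "f (v + w) = C' * e2pi (- dotc (ivec k0) v) * f v" for v
  proof -
    have cw: "cnj (w $ i) - w $ i = - 2 * \<i> * ivec k0 $ i" for i
      using w[of i] exhaust_2[of i] by (auto simp: complex_eq_iff)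
    have "H_Omega v w - dotc v w = v $ 1 * (cnj (w $ 1) - w $ 1) + v $ 2 * (cnj (w $ 2) - w $ 2)"
      by (simp add: H_Omega_def dotc_def algebra_simps)
    also have "\<dots> = - 2 * \<i> * dotc (ivec k0) v"
      unfolding cw by (simp add: dotc_def algebra_simps)
    finally have H: "H_Omega v w = dotc v w - 2 * \<i> * dotc (ivec k0) v" by (simp add: algebra_simps)
    have "f (v + w) = C * (exp (- (of_real pi / 2 * dotc (v + w) (v + w))) * exp (of_real pi * H_Omega v w))
        * theta_series 1 a v"
      unfolding f_def nrm_def tr by (simp add: mult_ac)
    also have "exp (- (of_real pi / 2 * dotc (v + w) (v + w))) * exp (of_real pi * H_Omega v w)
      = exp (- (of_real pi / 2 * dotc w w)) * e2pi (- dotc (ivec k0) v) * exp (- (of_real pi / 2 * dotc v v))"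
      unfolding e2pi_def exp_add[symmetric] H
      by (rule arg_cong[where f = exp]) (simp add: dotc_add dotc_commute[of w v] field_simps)
    finally show ?thesis unfolding f_def nrm_def C'_def by (simp add: mult_ac)
  qed
  define F where "F v = f v * e2pi (- dotc (freq 1 k) v)" for v
  have "holomorphic_on2 F UNIV"
    unfolding F_def dotc_minus(1)[symmetric] by (intro holomorphic_on2_mult hol holomorphic_on2_character)
  moreover have per: "F (v + ivec n) = F v" for v n
    unfolding F_def by (rule quasi_periodic_character[OF qp])
  ultimately have shift: "mean (\<lambda>v. F (v + w)) = mean F"
    using per[of _ "(1, 0)"] per[of _ "(0, 1)"] unfolding ivec_unit by (intro mean_shift)
  have pt: "F (v + w) = (e2pi (- dotc (freq 1 k) w) * C') * (f v * e2pi (- dotc (freq 1 (k + k0)) v))" for v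
  proof -
    have "e2pi (- dotc (ivec k0) v) * e2pi (- dotc (freq 1 k) (v + w))
      = e2pi (- dotc (freq 1 k) w) * e2pi (- dotc (freq 1 (k + k0)) v)"
      unfolding e2pi_add[symmetric] by (rule arg_cong[where f = e2pi]) (simp add: freq_add dotc_add)
    then show ?thesis unfolding F_def fw by (metis mult.assoc mult.left_commute)
  qed
  have "fcoeff 1 f k = mean F" unfolding fcoeff_def F_def ..
  also have "\<dots> = e2pi (- dotc (freq 1 k) w) * C' * fcoeff 1 f (k + k0)"
    unfolding shift[symmetric] pt mean_cmult fcoeff_def ..
  finally have "fcoeff 1 f k = e2pi (- dotc (freq 1 k) w) * C' * fcoeff 1 f (k + k0)" .
  then show "a k = e2pi (- dotc (freq 1 k) w) * C' * a (k + k0)" unfolding co .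
qed

text \<open>
  A series supported on one class of indices forces \<open>Im w\<close> into the imaginary lattice, and a
  series without vanishing coefficient then forces \<open>w\<close> into \<open>L\<close>.
\<close>

lemma translation_in_lattice:
  assumes w: "\<And>i. Im (w $ i) = Re (ivec k0 $ i)"
    and tr: "\<And>\<theta>. \<theta> \<in> V 1 \<Longrightarrow> \<exists>C. \<forall>v. \<theta> (v + w) = C * exp (of_real pi * H_Omega v w) * \<theta> v"
  shows "w \<in> L"
proof -
  have one: "(1::nat) > 0" by simp
  have *: "\<exists>C'. \<forall>k. a k = e2pi (- dotc (freq 1 k) w) * C' * a (k + k0)" if a: "theta_coefficients 1 a" for a
  proof -
    obtain C where "\<And>v. theta_series 1 a (v + w) = C * exp (of_real pi * H_Omega v w) * theta_series 1 a v"
      using tr[OF theta_series_section[OF one a]] by blast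
    then show ?thesis by (rule translation_coefficients[OF a w])
  qed
  obtain r where r: "r \<in> reps 1" using reps_nonempty[OF one] by blast
  have "basis_coefficients 1 r r = 1" using basis_coefficients_rep[OF one r, of r] by simp
  then have "basis_coefficients 1 r (r + k0) \<noteq> 0"
    using *[OF theta_coefficients_basis[OF one, of r]] by (metis mult_zero_right zero_neq_one)
  then have "fst (decomp 1 (r + k0)) = r"
    unfolding basis_coefficients_def[OF one] by metis
  then obtain m where "r + k0 = r + circN 1 m" using decomp(2)[OF one, of "r + k0"] by metis
  then have m: "k0 = circN 1 m" by simp
  \<comment> \<open>The coefficients of the sum of all basis sections; none of them vanishes.\<close>
  define full where "full k = multiplier 1 (snd (decomp 1 k)) (fst (decomp 1 k))" for k
  have full: "theta_coefficients 1 full"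
    unfolding theta_coefficients_def
  proof (intro allI)
    fix m k
    have "fst (decomp 1 k) + circN 1 (snd (decomp 1 k)) = k" using decomp(2)[OF one, of k] by (rule sym)
    then show "full (k + circN 1 m) = multiplier 1 m k * full k"
      unfolding full_def decomp_shift[OF one] fst_conv snd_conv add.commute[of _ m] multiplier_add
      by (rule arg_cong)
  qed
  obtain C' where C': "\<And>k. full k = e2pi (- dotc (freq 1 k) w) * C' * full (k + k0)"
    using *[OF full] by blast
  \<comment> \<open>The recursion also expresses the shift by \<open>k0\<close>, so \<open>per m - w\<close> pairs with all frequencies to the
    same value modulo 1.\<close>
  define K where "K = C' * e2pi (1 / 2 * dotc (per m) (ivec (circ A B m))) / chi (per m)"
  have K: "K * e2pi (dotc (freq 1 k) (per m - w)) = 1" for k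
  proof -
    have "full (k + circN 1 m) = multiplier 1 m k * full k"
      using full unfolding theta_coefficients_def by blast
    with C'[of k] have "full k = full k * (e2pi (- dotc (freq 1 k) w) * C' * multiplier 1 m k)"
      unfolding m by (simp only: mult_ac)
    moreover have "full k \<noteq> 0" by (simp add: full_def multiplier_nonzero)
    ultimately have "e2pi (- dotc (freq 1 k) w) * C' * multiplier 1 m k = 1" by simp
    moreover have "multiplier 1 m k = e2pi (dotc (freq 1 k) (per m))
        * e2pi (1 / 2 * dotc (per m) (ivec (circ A B m))) / chi (per m)"
      unfolding multiplier_def e2pi_add by simp
    ultimately show ?thesis
      unfolding K_def dotc_diff e2pi_diff e2pi_minus by (simp only: divide_inverse mult_ac)
  qed
  have int: "dotc (ivec k) (per m - w) \<in> \<int>" for k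
  proof -
    have "K * e2pi (dotc (freq 1 (0 + k)) (per m - w)) = K * e2pi (dotc (freq 1 0) (per m - w))"
      unfolding K ..
    moreover have "K \<noteq> 0" using K[of 0] by auto
    ultimately have "e2pi (dotc (ivec k) (per m - w)) = 1"
      unfolding freq_add dotc_add e2pi_add by simp
    then show ?thesis by (simp add: e2pi_eq_1_iff)
  qed
  obtain n1 n2 :: int where "(per m - w) $ 1 = of_int n1" "(per m - w) $ 2 = of_int n2"
    using int[of "(1, 0)"] int[of "(0, 1)"] by (auto simp: dotc_def elim!: Ints_cases)
  then have "w = per m + ivec (- n1, - n2)"
    by (simp add: vec_eq_iff forall_2 algebra_simps)
  then show "w \<in> L" unfolding L_eq by blast
qed

lemma nonzero_section:
  obtains a u where "theta_coefficients 1 a" "theta_series 1 a \<in> V 1" "theta_series 1 a u \<noteq> 0"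
proof -
  have one: "(1::nat) > 0" by simp
  obtain r where r: "r \<in> reps 1" using reps_nonempty[OF one] by blast
  let ?a = "basis_coefficients 1 r"
  have a: "theta_coefficients 1 ?a" by (rule theta_coefficients_basis[OF one])
  have "theta_series 1 ?a \<noteq> 0"
  proof
    assume 0: "theta_series 1 ?a = 0"
    have "fcoeff 1 (nrm 1 (theta_series 1 ?a)) r = 1"
      unfolding coeff_theta_series[OF one a] using basis_coefficients_rep[OF one r, of r] by simp
    then show False unfolding 0 by (simp add: fcoeff_def nrm_def mean_def)
  qed
  then obtain u where "theta_series 1 ?a u \<noteq> 0" by (auto simp: fun_eq_iff)
  then show ?thesis using that a theta_series_section[OF one a] by blast
qed

theorem sections_separate_points:
  assumes c0: "c0 \<noteq> 0" and uns: "\<And>s. s \<in> V (m + 3) \<Longrightarrow> s z1 = c0 * s z2"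
  shows "z1 - z2 \<in> L"
proof -
  define w where "w = z1 - z2"
  obtain a u where \<theta>: "theta_series 1 a \<in> V 1" "theta_series 1 a u \<noteq> 0" by (rule nonzero_section)
  have int: "\<exists>k. dotc (ivec n) (\<chi> i. of_real (Im (w $ i))) = of_int k" for n
  proof -
    have "exp (of_real pi * H_Omega (ivec n) w) = exp (of_real pi * H_Omega w (ivec n))"
      unfolding w_def by (rule unseparated_translation(2)[OF \<theta> c0 uns ivec_in_L])
    then have "exp (of_real pi * H_Omega w (ivec n) - of_real pi * H_Omega (ivec n) w) = 1"
      by (simp add: exp_diff)
    also have "of_real pi * H_Omega w (ivec n) - of_real pi * H_Omega (ivec n) w
      = 2 * of_real pi * \<i> * dotc (ivec n) (\<chi> i. of_real (Im (w $ i)))"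
      by (simp add: H_Omega_def dotc_def complex_eq_iff algebra_simps)
    finally show ?thesis using e2pi_eq_1_iff[unfolded e2pi_def] by (metis Ints_cases)
  qed
  obtain k1 k2 :: int where k: "Im (w $ 1) = of_int k1" "Im (w $ 2) = of_int k2"
    using int[of "(1, 0)"] int[of "(0, 1)"] by (auto simp: dotc_def complex_eq_iff)
  have "w \<in> L"
  proof (rule translation_in_lattice)
    show "Im (w $ i) = Re (ivec (k1, k2) $ i)" for i
      using exhaust_2[of i] k by auto
    show "\<exists>C. \<forall>v. \<eta> (v + w) = C * exp (of_real pi * H_Omega v w) * \<eta> v" if "\<eta> \<in> V 1" for \<eta>
    proof (cases "\<exists>u. \<eta> u \<noteq> 0")
      case True
      then obtain u where "\<eta> u \<noteq> 0" by blast
      from unseparated_translation(1)[OF that this c0 uns] show ?thesis by (simp add: w_def)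
    next
      case False
      then show ?thesis by simp
    qed
  qed
  then show ?thesis by (simp add: w_def)
qed


subsection \<open>Separation of tangent vectors\<close>

lemma theta_series_directional_derivative:
  assumes a: "theta_coefficients 1 a"
  shows "\<exists>D. holomorphic_on2 D UNIV \<and>
    (\<forall>z. ((\<lambda>t. theta_series 1 a (z + t *s h)) has_field_derivative D z) (at 0))"
proof -
  have one: "(1::nat) > 0" by simp
  note rapid = theta_coefficients_rapid[OF one a]
  let ?a' = "\<lambda>k. a k * (2 * of_real pi * \<i> * dotc (freq 1 k) h)"
  have rapid': "rapid ?a' (freq 1)" by (rule rapid_derivative[OF rapid])
  define q where "q z = exp (of_real pi / 2 * dotc z z)" for z
  define D where "D z = q z * (of_real pi * dotc z h) * fseries a (freq 1) z + q z * fseries ?a' (freq 1) z" for z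
  have th: "theta_series 1 a z = q z * fseries a (freq 1) z" for z
    unfolding theta_series_def[OF one] q_def by simp
  have "holomorphic_on2 q UNIV"
    unfolding q_def by (intro holomorphic_on2_exp holomorphic_on2_mult holomorphic_on2_const holomorphic_on2_dotc_self)
  then have "holomorphic_on2 D UNIV"
    unfolding D_def
    by (intro holomorphic_on2_add holomorphic_on2_mult holomorphic_on2_const holomorphic_on2_dotc
        holomorphic_on2_fseries rapid rapid')
  moreover have "((\<lambda>t. theta_series 1 a (z + t *s h)) has_field_derivative D z) (at 0)" for z
  proof -
    define T where "T v = fseries (\<lambda>k. a k * (2 * of_real pi * \<i> * dotc (freq 1 k) v)) (freq 1) z" for v
    have T_lin: "T (c *s v) = c * T v" for c v
      unfolding T_def fseries_def infsum_cmult_right'[symmetric] by (simp add: dotc_smult mult_ac)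
    have "(fseries a (freq 1) has_derivative T) (at (z + 0 *s h))"
      using fseries_has_derivative[OF rapid, of z] by (simp only: T_def[abs_def] vector_smult_lzero add_0_right)
    from has_field_derivative_on_line[OF this T_lin]
    have f: "((\<lambda>t. fseries a (freq 1) (z + t *s h)) has_field_derivative fseries ?a' (freq 1) z) (at 0)"
      unfolding T_def .
    have "dotc (z + t *s h) (z + t *s h) = dotc z z + 2 * t * dotc z h + t\<^sup>2 * dotc h h" for t
      by (simp add: dotc_add dotc_smult dotc_commute[of h z] power2_eq_square algebra_simps)
    then have "((\<lambda>t. q (z + t *s h)) has_field_derivative q z * (of_real pi * dotc z h)) (at 0)"
      unfolding q_def by (auto intro!: derivative_eq_intros)
    from DERIV_mult[OF this f] show ?thesis
      unfolding th D_def by (simp add: add.commute mult.commute)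
  qed
  ultimately show ?thesis by blast
qed

text \<open>
  If a tangent vector \<open>h\<close> at \<open>z\<^sub>0\<close> is not separated, the logarithmic derivative of \<open>\<theta>\<close> along \<open>h\<close> has no
  poles. It is additive up to a constant by the same periodicity argument, so \<open>H(h, \<cdot>)\<close> would be
  both \<open>\<complex>\<close>-linear and antilinear.
\<close>

theorem sections_separate_tangents:
  assumes uns: "\<And>s. s \<in> V (m + 3) \<Longrightarrow> ((\<lambda>t. s (z0 + t *s h)) has_field_derivative \<mu> * s z0) (at 0)"
  shows "h = 0"
proof -
  obtain a u where "theta_coefficients 1 a" "theta_series 1 a \<in> V 1" "theta_series 1 a u \<noteq> 0"
    by (rule nonzero_section)
  then obtain \<theta> Dh where \<theta>: "\<theta> \<in> V 1" "\<theta> u \<noteq> 0" and Dh: "holomorphic_on2 Dh UNIV"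
    "\<And>z. ((\<lambda>t. \<theta> (z + t *s h)) has_field_derivative Dh z) (at 0)"
    using theta_series_directional_derivative by blast
  note hol = section_holomorphic[OF \<theta>(1)]
  have shifted: "((\<lambda>t. \<theta> (z0 + t *s h + v)) has_field_derivative Dh (z0 + v)) (at 0)" for v
    using Dh(2)[of "z0 + v"] by (simp add: add_ac)
  have "\<exists>\<xi>. holomorphic_on2 \<xi> UNIV \<and> (\<forall>a. Dh (z0 + a) = \<xi> a * \<theta> (z0 + a)) \<and> (\<forall>a::complex^2. True)"
  proof (rule quotient_patch[where P = "\<lambda>_. True"])
    show "holomorphic_on2 (\<lambda>a. \<theta> (z0 + a)) UNIV" by (rule holomorphic_on2_shift[OF hol])
    show "\<theta> (z0 + (u - z0)) \<noteq> 0" using \<theta>(2) by simp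
    obtain c' where c': "\<theta> (z0 + c') \<noteq> 0" using avoid_zeros[OF hol \<theta>(2)] by blast
    fix a0
    let ?e = "z0 + (- a0 - of_nat m *s c')"
    obtain b where b: "\<theta> (z0 + b) \<noteq> 0" "\<theta> (?e - b) \<noteq> 0"
      using avoid_zeros[OF hol \<theta>(2), of z0 z0 ?e ?e] by blast
    define w where "w = z0 + (- b - of_nat m *s c')"
    define K where "K = \<theta> (z0 + c') ^ m"
    define K' where "K' = of_nat m * \<theta> (z0 + c') ^ (m - 1) * Dh (z0 + c')"
    define g where "g a = \<mu> - Dh (z0 + b) / \<theta> (z0 + b) - Dh (w - a) / \<theta> (w - a) - K' / K" for a
    define W where "W = {a. \<theta> (w - a) \<noteq> 0}"
    have "open W"
      unfolding W_def by (intro open_Collect_neq holomorphic_on2_continuous_on holomorphic_on2_shift[OF hol] continuous_on_const)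
    moreover have "a0 \<in> W" using b(2) by (simp add: W_def w_def algebra_simps)
    moreover have "holomorphic_on2 g W"
      unfolding g_def
      by (intro holomorphic_on2_diff holomorphic_on2_divide holomorphic_on2_const holomorphic_on2_shift[OF hol]
          holomorphic_on2_shift[OF Dh(1)]) (use b c' in \<open>auto simp: W_def K_def\<close>)
    moreover have "Dh (z0 + a) = g a * \<theta> (z0 + a)" if a: "a \<in> W" for a
    proof -
      have eq: "z0 + (- a - b - of_nat m *s c') = w - a" by (simp add: w_def algebra_simps)
      have "((\<lambda>t. \<theta> (z0 + t *s h + c') ^ m) has_field_derivative K') (at 0)"
        unfolding K'_def using DERIV_power[OF shifted[of c'], of m] by (simp add: mult_ac)
      from DERIV_mult[OF DERIV_mult[OF DERIV_mult[OF shifted[of a] shifted[of b]]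
          shifted[of "- a - b - of_nat m *s c'"]] this]
      have "\<mu> * (\<theta> (z0 + a) * \<theta> (z0 + b) * \<theta> (w - a) * K) =
        ((Dh (z0 + a) * \<theta> (z0 + b) + Dh (z0 + b) * \<theta> (z0 + a)) * \<theta> (w - a)
          + Dh (w - a) * (\<theta> (z0 + a) * \<theta> (z0 + b))) * K + K' * (\<theta> (z0 + a) * \<theta> (z0 + b) * \<theta> (w - a))"
        using DERIV_unique[OF uns[OF product_section[OF \<theta>(1), of a b m c']]] by (simp add: eq K_def)
      moreover have "\<theta> (z0 + b) \<noteq> 0" "\<theta> (w - a) \<noteq> 0" "K \<noteq> 0" using b c' a by (auto simp: W_def K_def)
      ultimately show ?thesis unfolding g_def by (simp add: field_simps)
    qed
    ultimately show "\<exists>W g. open W \<and> a0 \<in> W \<and> holomorphic_on2 g W \<and>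
        (\<forall>a\<in>W. Dh (z0 + a) = g a * \<theta> (z0 + a)) \<and> True"
      by blast
  qed
  then obtain \<xi> where \<xi>: "holomorphic_on2 \<xi> UNIV" "\<And>a. Dh (z0 + a) = \<xi> a * \<theta> (z0 + a)" by blast
  have per: "\<xi> (a + \<alpha>) = \<xi> a + of_real pi * H_Omega h \<alpha>" if \<alpha>: "\<alpha> \<in> L" for a \<alpha>
  proof (rule quotient_unique[of "\<lambda>a. \<theta> (z0 + a)" "u - z0" UNIV a "\<lambda>a. \<xi> (a + \<alpha>)"
        "\<lambda>a. \<xi> a + of_real pi * H_Omega h \<alpha>"])
    show "holomorphic_on2 (\<lambda>a. \<theta> (z0 + a)) UNIV" by (rule holomorphic_on2_shift[OF hol])
    show "\<theta> (z0 + (u - z0)) \<noteq> 0" using \<theta>(2) by simp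
    show "holomorphic_on2 (\<lambda>a. \<xi> (a + \<alpha>)) UNIV" by (rule holomorphic_on2_shift[OF \<xi>(1)])
    show "holomorphic_on2 (\<lambda>a. \<xi> a + of_real pi * H_Omega h \<alpha>) UNIV"
      by (intro holomorphic_on2_add holomorphic_on2_const \<xi>(1))
    fix a
    define z where "z = z0 + a"
    have "Dh (z + \<alpha>) = Jf \<alpha> z * (Dh z + of_real pi * H_Omega h \<alpha> * \<theta> z)"
    proof (rule DERIV_unique)
      show "((\<lambda>t. \<theta> (z + \<alpha> + t *s h)) has_field_derivative Dh (z + \<alpha>)) (at 0)" by (rule Dh(2))
      have "\<theta> (z + \<alpha> + t *s h) = Jf \<alpha> z * (exp (t * (of_real pi * H_Omega h \<alpha>)) * \<theta> (z + t *s h))" for t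
      proof -
        have eq: "z + \<alpha> + t *s h = z + t *s h + \<alpha>" by (simp add: add_ac)
        show ?thesis
          unfolding eq section_shift[OF \<theta>(1) \<alpha>] Jf_translate H_Omega_smult by (simp only: mult_ac)
      qed
      moreover have "((\<lambda>t. Jf \<alpha> z * (exp (t * (of_real pi * H_Omega h \<alpha>)) * \<theta> (z + t *s h)))
        has_field_derivative Jf \<alpha> z * (Dh z + of_real pi * H_Omega h \<alpha> * \<theta> z)) (at 0)"
        by (auto intro!: derivative_eq_intros Dh(2) simp: algebra_simps)
      ultimately show "((\<lambda>t. \<theta> (z + \<alpha> + t *s h)) has_field_derivative
          Jf \<alpha> z * (Dh z + of_real pi * H_Omega h \<alpha> * \<theta> z)) (at 0)" by simp
    qed
    moreover have "Dh (z + \<alpha>) = \<xi> (a + \<alpha>) * (Jf \<alpha> z * \<theta> z)"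
      using \<xi>(2)[of "a + \<alpha>"] section_shift[OF \<theta>(1) \<alpha>, of z] by (simp add: z_def add.assoc)
    moreover have "Dh z = \<xi> a * \<theta> z" unfolding z_def by (rule \<xi>(2))
    ultimately have "Jf \<alpha> z * (\<xi> (a + \<alpha>) * \<theta> z) = Jf \<alpha> z * ((\<xi> a + of_real pi * H_Omega h \<alpha>) * \<theta> z)"
      by (simp add: algebra_simps)
    then show "\<xi> (a + \<alpha>) * \<theta> (z0 + a) = (\<xi> a + of_real pi * H_Omega h \<alpha>) * \<theta> (z0 + a)"
      using Jf_nonzero[OF \<alpha>] by (simp add: z_def)
  qed auto
  define l where "l a = \<xi> a - \<xi> 0" for a
  have l_hol: "holomorphic_on2 l UNIV"
    unfolding l_def by (intro holomorphic_on2_diff holomorphic_on2_const \<xi>(1))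
  have l_add: "l (x + y) = l x + l y" for x y
  proof -
    have "\<xi> (x + y) - \<xi> x = \<xi> (0 + y) - \<xi> 0"
    proof (rule periodic_entire_constant[of "\<lambda>x. \<xi> (x + y) - \<xi> x"])
      show "holomorphic_on2 (\<lambda>x. \<xi> (x + y) - \<xi> x) UNIV"
        by (intro holomorphic_on2_diff holomorphic_on2_shift \<xi>(1))
      fix z \<alpha> assume \<alpha>: "\<alpha> \<in> L"
      have "\<xi> (z + \<alpha> + y) = \<xi> (z + y) + of_real pi * H_Omega h \<alpha>"
        using per[OF \<alpha>, of "z + y"] by (simp add: add_ac)
      then show "\<xi> (z + \<alpha> + y) - \<xi> (z + \<alpha>) = \<xi> (z + y) - \<xi> z"
        by (simp add: per[OF \<alpha>, of z])
    qed
    then show ?thesis by (simp add: l_def algebra_simps)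
  qed
  have l_smult: "l (c *s v) = c * l v" for c v by (rule entire_additive[OF l_hol l_add])
  have l_lattice: "l \<alpha> = of_real pi * H_Omega h \<alpha>" if "\<alpha> \<in> L" for \<alpha>
    using per[OF that, of 0] by (simp add: l_def)
  have lin: "linear (\<lambda>z. Re (l z - of_real pi * H_Omega h z))" "linear (\<lambda>z. Im (l z - of_real pi * H_Omega h z))"
    by (rule linearI; simp add: l_add l_smult H_Omega_add H_Omega_smult scaleR_eq_smult algebra_simps)+
  have lH: "l z = of_real pi * H_Omega h z" for z
    using linear_zero_on_lattice[OF lin(1), of z] linear_zero_on_lattice[OF lin(2), of z] l_lattice
    by (simp add: complex_eq_iff)
  have "of_real pi * H_Omega h (\<i> *s h) = \<i> * (of_real pi * H_Omega h h)"
    using l_smult[of "\<i>" h] unfolding lH .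
  then have "H_Omega h h = 0" by (simp add: H_Omega_smult)
  then show "h = 0" by (simp add: H_Omega_self)
qed

end


section \<open>The embedding into projective space\<close>

lemma mem_proj_point: "v \<in> proj_point v"
  unfolding proj_point_def by (auto intro!: exI[of _ 1] simp: fscale_def)

lemma proj_point_scale:
  assumes "s \<noteq> 0"
  shows "proj_point (fscale s v) = proj_point v"
proof -
  have 1: "fscale t (fscale s v) = fscale (t * s) v" for t by (simp add: fscale_def mult_ac)
  have 2: "fscale t v = fscale (t / s) (fscale s v)" for t using assms by (simp add: fscale_def)
  show ?thesis
  proof
    show "proj_point (fscale s v) \<subseteq> proj_point v"
    proof
      fix w assume "w \<in> proj_point (fscale s v)"
      then obtain t where t: "t \<noteq> 0" "w = fscale (t * s) v" unfolding proj_point_def using 1 by blast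
      then have "t * s \<noteq> 0" using assms by simp
      then show "w \<in> proj_point v" unfolding proj_point_def using t(2) by blast
    qed
    show "proj_point v \<subseteq> proj_point (fscale s v)"
    proof
      fix w assume "w \<in> proj_point v"
      then obtain t where t: "t \<noteq> 0" "w = fscale (t / s) (fscale s v)" unfolding proj_point_def using 2 by blast
      then have "t / s \<noteq> 0" using assms by simp
      then show "w \<in> proj_point (fscale s v)" unfolding proj_point_def using t(2) by blast
    qed
  qed
qed

lemma proj_point_eqD: "proj_point v = proj_point w \<Longrightarrow> \<exists>s. s \<noteq> 0 \<and> v = fscale s w"
  using mem_proj_point[of v] unfolding proj_point_def by auto

lemma chart_proj_point:
  assumes "v i \<noteq> 0"
  shows "chart i (proj_point v) j = v j / v i"
proof -
  have "(\<lambda>w. w j / w i) ` proj_point v = {v j / v i}"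
  proof
    show "(\<lambda>w. w j / w i) ` proj_point v \<subseteq> {v j / v i}"
      unfolding proj_point_def fscale_def by auto
    show "{v j / v i} \<subseteq> (\<lambda>w. w j / w i) ` proj_point v" using mem_proj_point by blast
  qed
  then show ?thesis by (simp add: chart_def)
qed

lemma proj_point_in_chart_domain:
  assumes "v \<in> homog_vectors N"
  shows "proj_point v \<in> chart_domain N i \<longleftrightarrow> v i \<noteq> 0"
  using assms unfolding chart_domain_def by (auto simp: fscale_def dest!: proj_point_eqD)

lemma topspace_proj_top: "topspace (proj_top N) = proj_point ` homog_vectors N"
  by (simp add: proj_top_def topspace_quotient_top)

text \<open>
  Projective space is Hausdorff: a line is determined by the orthogonal projection onto it, whose
  matrix entries \<open>v i * cnj (v j) / |v|\<^sup>2\<close> depend continuously on the line.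
\<close>

lemma Hausdorff_proj_top: "Hausdorff_space (proj_top N)"
proof -
  define nrm2 where "nrm2 v = (\<Sum>k\<le>N. v k * cnj (v k))" for v :: "nat \<Rightarrow> complex"
  define P where "P v = (\<lambda>(i, j). v i * cnj (v j) / nrm2 v)" for v
  define g where "g p = P (SOME v. v \<in> p)" for p
  have nz: "nrm2 v \<noteq> 0" if v: "v \<in> homog_vectors N" for v
  proof
    assume 0: "nrm2 v = 0"
    have e: "nrm2 v = of_real (\<Sum>k\<le>N. (norm (v k))\<^sup>2)"
      by (simp add: nrm2_def complex_norm_square del: of_real_power)
    then have "(\<Sum>k\<le>N. (norm (v k))\<^sup>2) = 0" using 0 unfolding e of_real_eq_0_iff by blast
    then have "\<forall>k\<le>N. v k = 0" by (simp add: sum_nonneg_eq_0_iff)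
    moreover obtain i where "v i \<noteq> 0" "\<not> i > N" using v unfolding homog_vectors_def by blast
    ultimately show False by simp
  qed
  have scale: "P (fscale s v) = P v" if "s \<noteq> 0" for s v
  proof -
    have "nrm2 (fscale s v) = (s * cnj s) * nrm2 v"
      by (simp add: nrm2_def fscale_def sum_distrib_left mult_ac)
    then show ?thesis using that by (simp add: P_def fscale_def fun_eq_iff)
  qed
  have gP: "g (proj_point v) = P v" for v
  proof -
    have "(SOME w. w \<in> proj_point v) \<in> proj_point v"
      by (rule someI[of "\<lambda>w. w \<in> proj_point v", OF mem_proj_point])
    then show ?thesis unfolding g_def using scale by (auto simp: proj_point_def)
  qed
  have "continuous_on (homog_vectors N) P"
  proof (rule continuous_on_coordinatewise_then_product)
    fix p :: "nat \<times> nat"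
    have comp: "continuous_on (homog_vectors N) (\<lambda>v. v k)" for k :: nat
      by (rule continuous_on_subset[OF continuous_on_product_coordinates]) simp
    have "continuous_on (homog_vectors N) (\<lambda>v. v (fst p) * cnj (v (snd p)) / nrm2 v)"
      unfolding nrm2_def using nz by (intro continuous_intros comp) (auto simp: nrm2_def)
    then show "continuous_on (homog_vectors N) (\<lambda>v. P v p)"
      by (simp add: P_def case_prod_unfold)
  qed
  then have "continuous_map (top_of_set (homog_vectors N)) euclidean (g \<circ> proj_point)"
    by (simp add: o_def gP)
  then have cont: "continuous_map (proj_top N) euclidean g"
    unfolding proj_top_def by (rule continuous_compose_quotient_map[OF quotient_map_quotient_top])
  have inj: "inj_on g (topspace (proj_top N))"
    unfolding topspace_proj_top
  proof (rule inj_onI)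
    fix p q assume "p \<in> proj_point ` homog_vectors N" "q \<in> proj_point ` homog_vectors N" and eq: "g p = g q"
    then obtain v w where v: "v \<in> homog_vectors N" "p = proj_point v"
      and w: "w \<in> homog_vectors N" "q = proj_point w" by blast
    have P: "v i * cnj (v j) / nrm2 v = w i * cnj (w j) / nrm2 w" for i j
      using fun_cong[OF eq[unfolded v(2) w(2) gP], of "(i, j)"] by (simp add: P_def)
    obtain k where k: "v k \<noteq> 0" using v(1) by (auto simp: homog_vectors_def)
    then have wk: "w k \<noteq> 0" using P[of k k] nz[OF v(1)] by auto
    define s where "s = nrm2 v * cnj (w k) / (nrm2 w * cnj (v k))"
    have "s \<noteq> 0" using k wk nz[OF v(1)] nz[OF w(1)] by (simp add: s_def)
    moreover have "v = fscale s w"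
      using P[of _ k] k nz[OF v(1)] nz[OF w(1)] by (simp add: s_def fscale_def fun_eq_iff field_simps)
    ultimately show "p = q" unfolding v(2) w(2) by (simp add: proj_point_scale)
  qed
  have "Hausdorff_space (euclidean :: (nat \<times> nat \<Rightarrow> complex) topology)"
    unfolding euclidean_product_topology[symmetric] Hausdorff_space_product_topology by simp
  then show ?thesis using cont inj by (rule Hausdorff_space_injective_preimage)
qed

context circulant_torus
begin

lemma L_add: "\<alpha> \<in> L \<Longrightarrow> \<beta> \<in> L \<Longrightarrow> \<alpha> + \<beta> \<in> L"
proof -
  assume \<alpha>: "\<alpha> \<in> L" and \<beta>: "\<beta> \<in> L"
  obtain m n where "\<alpha> = per m + ivec n" using \<alpha> by (rule L_cases)
  moreover obtain m' n' where "\<beta> = per m' + ivec n'" using \<beta> by (rule L_cases)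
  ultimately have "\<alpha> + \<beta> = per (m + m') + ivec (n + n')" by (simp add: per_add ivec_add)
  then show ?thesis unfolding L_eq by blast
qed

lemma L_minus: "\<alpha> \<in> L \<Longrightarrow> - \<alpha> \<in> L"
proof -
  assume "\<alpha> \<in> L"
  then obtain m n where "\<alpha> = per m + ivec n" by (rule L_cases)
  then have "- \<alpha> = per (- m) + ivec (- n)" by (simp add: vec_eq_iff forall_2)
  then show ?thesis unfolding L_eq by blast
qed

lemma mem_coset: "z \<in> coset L z"
  using ivec_in_L[of 0] by (auto simp: coset_def intro!: image_eqI[of _ _ 0])

lemma coset_eqI:
  assumes "z - w \<in> L"
  shows "coset L z = coset L w"
proof -
  have "coset L z \<subseteq> coset L w" if "z - w \<in> L" for z w
  proof
    fix x assume "x \<in> coset L z"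
    then obtain \<alpha> where "\<alpha> \<in> L" "x = z + \<alpha>" by (auto simp: coset_def)
    then have "x = w + ((z - w) + \<alpha>)" "(z - w) + \<alpha> \<in> L" using L_add[OF that] by auto
    then show "x \<in> coset L w" unfolding coset_def by blast
  qed
  from this[OF assms] this[of w z] L_minus[OF assms] show ?thesis by simp
qed

lemma topspace_torus: "topspace (torus_top L) = range (coset L)"
  by (simp add: torus_top_def topspace_quotient_top)

lemma quotient_map_coset: "quotient_map euclidean (torus_top L) (coset L)"
  unfolding torus_top_def by (rule quotient_map_quotient_top)

lemma compact_torus: "compact_space (torus_top L)"
proof -
  from lattice_cobounded obtain R where R: "\<forall>z. \<exists>\<alpha>\<in>L. norm (z - \<alpha>) \<le> R" ..
  have "coset L ` cball 0 R = range (coset L)"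
  proof
    show "range (coset L) \<subseteq> coset L ` cball 0 R"
    proof
      fix C assume "C \<in> range (coset L)"
      then obtain z where z: "C = coset L z" by blast
      obtain \<alpha> where \<alpha>: "\<alpha> \<in> L" "norm (z - \<alpha>) \<le> R" using R by blast
      have "C = coset L (z - \<alpha>)" unfolding z by (rule coset_eqI) (use \<alpha> in simp)
      then show "C \<in> coset L ` cball 0 R" using \<alpha>(2) by simp
    qed
  qed blast
  moreover have "compactin (torus_top L) (coset L ` cball 0 R)"
    by (rule image_compactin[OF _ quotient_imp_continuous_map[OF quotient_map_coset]]) simp
  ultimately show ?thesis by (simp add: compact_space_def topspace_torus)
qed

text \<open>
  Conditions at one or two points that are linear in the section hold for all sections as soon as
  they hold for a basis. This turns a failure of the map to be defined, injective or immersive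
  into a statement about all sections, which the separation results exclude.
\<close>

lemma section_map_embedding:
  assumes basis: "section_basis (V (m + 3)) M \<theta>"
  shows "closed_embedding L M (section_map M \<theta>)"
proof -
  have span: "cfun.span (\<theta> ` {..M}) = V (m + 3)" using basis by (simp add: section_basis_def)
  have sec: "\<theta> i \<in> V (m + 3)" if "i \<le> M" for i
    unfolding span[symmetric] by (rule cfun.span_base) (use that in simp)
  have all: "s \<in> T" if "s \<in> V (m + 3)" "cfun.subspace T" "\<And>i. i \<le> M \<Longrightarrow> \<theta> i \<in> T" for s T
    using cfun.span_minimal[of "\<theta> ` {..M}" T] that unfolding span by blast
  define coords where "coords z = (\<lambda>i. if i \<le> M then \<theta> i z else 0)" for z
  have hol: "holomorphic_on2 (\<theta> i) S" if "i \<le> M" for i S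
    using section_holomorphic[OF sec[OF that]] by (rule holomorphic_on2_subset) simp

  have coords_homog: "coords z \<in> homog_vectors M" for z
  proof -
    have "\<exists>i\<le>M. \<theta> i z \<noteq> 0"
    proof (rule ccontr)
      assume none: "\<not> (\<exists>i\<le>M. \<theta> i z \<noteq> 0)"
      have sub: "cfun.subspace {s. s z = 0}"
        unfolding cfun.subspace_def by (simp add: fscale_def)
      obtain a u where "theta_series 1 a \<in> V 1" "theta_series 1 a u \<noteq> 0" by (rule nonzero_section)
      then obtain s where "s \<in> V (m + 3)" "s z \<noteq> 0" using base_point_free by blast
      then show False using all[OF _ sub, of s] none by auto
    qed
    then show ?thesis unfolding homog_vectors_def coords_def by auto
  qed

  have smap: "section_map M \<theta> (coset L z) = proj_point (coords z)" for z
  proof -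
    have "proj_point (coords (z + \<alpha>)) = proj_point (coords z)" if \<alpha>: "\<alpha> \<in> L" for \<alpha>
    proof -
      have "coords (z + \<alpha>) = fscale (tensor_power Jf (m + 3) \<alpha> z) (coords z)"
        using sec \<alpha> unfolding coords_def fscale_def sections_def by (auto simp: fun_eq_iff)
      moreover have "tensor_power Jf (m + 3) \<alpha> z \<noteq> 0"
        using Jf_nonzero[OF \<alpha>] by (simp add: tensor_power_def)
      ultimately show ?thesis by (simp add: proj_point_scale)
    qed
    then have "(\<lambda>z. proj_point (coords z)) ` coset L z = {proj_point (coords z)}"
      using mem_coset[of z] by (auto simp: coset_def)
    then show ?thesis unfolding section_map_def coords_def by simp
  qed
  have F: "section_map M \<theta> \<circ> coset L = (\<lambda>z. proj_point (coords z))"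
    by (simp add: fun_eq_iff smap)

  have dom: "(\<lambda>z. proj_point (coords z)) -` chart_domain M i = {z. \<theta> i z \<noteq> 0}" if "i \<le> M" for i
    using that proj_point_in_chart_domain[OF coords_homog, of _ i] by (auto simp: coords_def)
  have chart: "chart i (proj_point (coords z)) j = \<theta> j z / \<theta> i z" if "i \<le> M" "j \<le> M" "\<theta> i z \<noteq> 0" for i j z
    using chart_proj_point[of "coords z" i j] that by (simp add: coords_def)
  have dom_open: "open {z. \<theta> i z \<noteq> 0}" if "i \<le> M" for i
    by (intro open_Collect_neq holomorphic_on2_continuous_on hol that continuous_on_const)

  have holo: "holomorphic_to_proj M (\<lambda>z. proj_point (coords z))"
    unfolding holomorphic_to_proj_def topspace_proj_top
  proof (intro conjI allI impI)
    show "range (\<lambda>z. proj_point (coords z)) \<subseteq> proj_point ` homog_vectors M" using coords_homog by blast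
    fix i assume i: "i \<le> M"
    show "open ((\<lambda>z. proj_point (coords z)) -` chart_domain M i)" unfolding dom[OF i] by (rule dom_open[OF i])
    fix j assume j: "j \<le> M"
    show "holomorphic_on2 (\<lambda>z. chart i (proj_point (coords z)) j) ((\<lambda>z. proj_point (coords z)) -` chart_domain M i)"
      unfolding dom[OF i]
    proof (rule holomorphic_on2_cong[OF dom_open[OF i]])
      show "holomorphic_on2 (\<lambda>z. \<theta> j z / \<theta> i z) {z. \<theta> i z \<noteq> 0}"
        by (intro holomorphic_on2_divide hol i j) simp
    qed (simp add: chart i j)
  qed

  have imm: "immersion_to_proj M (\<lambda>z. proj_point (coords z))"
    unfolding immersion_to_proj_def
  proof (intro conjI holo allI impI ballI)
    fix i z h assume i: "i \<le> M" and z: "z \<in> (\<lambda>z. proj_point (coords z)) -` chart_domain M i"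
      and zero: "\<forall>j\<le>M. frechet_derivative (\<lambda>w. chart i (proj_point (coords w)) j) (at z) h = 0"
    have \<theta>i: "\<theta> i z \<noteq> 0" using z unfolding dom[OF i] by simp
    obtain Di where Di: "(\<theta> i has_derivative Di) (at z)" "\<And>c v. Di (c *s v) = c * Di v"
      using hol[OF i, of UNIV] by (rule holomorphic_on2E) auto
    define \<mu> where "\<mu> = Di h / \<theta> i z"
    define T where "T = {s. ((\<lambda>t. s (z + t *s h)) has_field_derivative \<mu> * s z) (at 0)}"
    have sub: "cfun.subspace T"
      unfolding cfun.subspace_def T_def
    proof (intro conjI ballI allI, goal_cases)
      case 1
      then show ?case by simp
    next
      case (2 f g)
      then show ?case by (auto intro!: derivative_eq_intros simp: distrib_left)
    next
      case (3 k f)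
      then show ?case by (auto intro!: derivative_eq_intros simp: fscale_def)
    qed
    have gen: "\<theta> j \<in> T" if j: "j \<le> M" for j
    proof -
      obtain Dj where Dj: "(\<theta> j has_derivative Dj) (at z)" "\<And>c v. Dj (c *s v) = c * Dj v"
        using hol[OF j, of UNIV] by (rule holomorphic_on2E) auto
      have "((\<lambda>w. \<theta> j w / \<theta> i w) has_derivative
          (\<lambda>h. (Dj h * \<theta> i z - \<theta> j z * Di h) / (\<theta> i z * \<theta> i z))) (at z)"
        by (rule has_derivative_divide'[OF Dj(1) Di(1) \<theta>i])
      then have "((\<lambda>w. chart i (proj_point (coords w)) j) has_derivative
          (\<lambda>h. (Dj h * \<theta> i z - \<theta> j z * Di h) / (\<theta> i z * \<theta> i z))) (at z)"
        by (rule has_derivative_transform_within_open[OF _ dom_open[OF i]]) (simp_all add: \<theta>i chart i j)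
      from fun_cong[OF frechet_derivative_at[OF this], of h] zero j
      have "(Dj h * \<theta> i z - \<theta> j z * Di h) / (\<theta> i z * \<theta> i z) = 0" by simp
      then have "Dj h = \<mu> * \<theta> j z" using \<theta>i by (simp add: \<mu>_def field_simps)
      then show ?thesis
        using has_field_derivative_on_line[of "\<theta> j" Dj z 0 h] Dj by (simp add: T_def)
    qed
    show "h = 0"
    proof (rule sections_separate_tangents)
      show "((\<lambda>t. s (z + t *s h)) has_field_derivative \<mu> * s z) (at 0)" if "s \<in> V (m + 3)" for s
        using all[OF that sub gen] by (simp add: T_def)
    qed
  qed

  have cont: "continuous_map (torus_top L) (proj_top M) (section_map M \<theta>)"
  proof (rule continuous_compose_quotient_map[OF quotient_map_coset])
    have "continuous_on UNIV coords"
    proof (rule continuous_on_coordinatewise_then_product)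
      show "continuous_on UNIV (\<lambda>z. coords z i)" for i
        by (cases "i \<le> M") (simp_all add: coords_def holomorphic_on2_continuous_on hol)
    qed
    then have "continuous_map euclidean (top_of_set (homog_vectors M)) coords"
      using coords_homog by (auto simp: continuous_map_in_subtopology)
    then have "continuous_map euclidean (proj_top M) (proj_point \<circ> coords)"
      using quotient_imp_continuous_map[OF quotient_map_quotient_top]
      unfolding proj_top_def by (rule continuous_map_compose)
    then show "continuous_map euclidean (proj_top M) (section_map M \<theta> \<circ> coset L)"
      unfolding F by (simp add: o_def)
  qed
  have inj: "inj_on (section_map M \<theta>) (topspace (torus_top L))"
    unfolding topspace_torus
  proof (rule inj_onI)
    fix C C' assume "C \<in> range (coset L)" "C' \<in> range (coset L)" and eq: "section_map M \<theta> C = section_map M \<theta> C'"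
    then obtain z z' where C: "C = coset L z" "C' = coset L z'" by blast
    obtain k where k: "k \<noteq> 0" "coords z = fscale k (coords z')"
      using proj_point_eqD eq unfolding C smap by blast
    have "cfun.subspace {s. s z = k * s z'}"
      unfolding cfun.subspace_def by (simp add: fscale_def algebra_simps)
    moreover have "\<theta> i \<in> {s. s z = k * s z'}" if "i \<le> M" for i
      using fun_cong[OF k(2), of i] that by (simp add: coords_def fscale_def)
    ultimately have "s z = k * s z'" if "s \<in> V (m + 3)" for s
      using all[OF that] by blast
    then have "z - z' \<in> L" by (rule sections_separate_points[OF k(1)])
    then show "C = C'" unfolding C by (rule coset_eqI)
  qed
  have "embedding_map (torus_top L) (proj_top M) (section_map M \<theta>)"
    by (rule continuous_imp_embedding_map[OF cont compact_torus Hausdorff_proj_top inj])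
  moreover have "closedin (proj_top M) (section_map M \<theta> ` topspace (torus_top L))"
    using compact_torus unfolding compact_space_def
    by (intro compactin_imp_closedin[OF Hausdorff_proj_top] image_compactin[OF _ cont])
  ultimately show ?thesis
    unfolding closed_embedding_def F using imm by blast
qed

lemma powers_give_embedding:
  assumes "n \<ge> 3"
  shows "sections_give_embedding L (tensor_power Jf n)"
proof -
  define m where "m = n - 3"
  have n: "n = m + 3" using assms by (simp add: m_def)
  have "\<exists>M \<theta>. section_basis (V (m + 3)) M \<theta>" by (rule section_basis_exists) simp
  then show ?thesis
    unfolding sections_give_embedding_def n using section_map_embedding by blast
qed

end


section \<open>The determinant of an alternating form on a lattice\<close>

lemma det_Ints:
  fixes P :: "real^'n^'n"
  assumes "\<And>i j. P $ i $ j \<in> \<int>"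
  shows "det P \<in> \<int>"
  unfolding det_def by (intro Ints_sum Ints_mult Ints_prod assms) simp

lemma det_integer_inverse:
  fixes P Q :: "real^'n^'n"
  assumes "P ** Q = mat 1" "\<And>i j. P $ i $ j \<in> \<int>" "\<And>i j. Q $ i $ j \<in> \<int>"
  shows "(det P)\<^sup>2 = 1"
proof -
  obtain p where p: "det P = of_int p" using det_Ints[OF assms(2)] by (rule Ints_cases)
  obtain q where q: "det Q = of_int q" using det_Ints[OF assms(3)] by (rule Ints_cases)
  have "det P * det Q = 1" using det_mul[of P Q] assms(1) by simp
  then have "real_of_int (p * q) = 1" by (simp add: p q)
  then have "p * q = 1" by linarith
  then have "p = 1 \<or> p = -1" by (rule pos_zmult_eq_1_iff_lemma)
  then show ?thesis by (auto simp: p)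
qed

lemma zbasis_coordinates:
  fixes e e' :: "'n::finite \<Rightarrow> complex^2"
  assumes e: "zbasis L e" and e': "zbasis L e'"
  shows "\<exists>k :: 'n \<Rightarrow> 'n \<Rightarrow> int. \<forall>i. e' i = (\<Sum>j\<in>UNIV. of_int (k i j) *s e j)"
proof -
  have "\<exists>k :: 'n \<Rightarrow> int. e' i = (\<Sum>j\<in>UNIV. of_int (k j) *s e j)" for i
  proof -
    have "(\<Sum>j\<in>UNIV. of_int (if j = i then 1 else 0) *s e' j) = (\<Sum>j\<in>UNIV. if j = i then e' j else 0)"
      by (intro sum.cong) auto
    also have "\<dots> = e' i" by simp
    finally have "e' i = (\<lambda>k::'n \<Rightarrow> int. \<Sum>j\<in>UNIV. of_int (k j) *s e' j) (\<lambda>j. if j = i then 1 else 0)" by simp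
    then have "e' i \<in> range (\<lambda>k::'n \<Rightarrow> int. \<Sum>j\<in>UNIV. of_int (k j) *s e' j)"
      by (rule range_eqI[where x = "\<lambda>j. if j = i then 1 else 0"])
    then have "e' i \<in> range (\<lambda>k::'n \<Rightarrow> int. \<Sum>j\<in>UNIV. of_int (k j) *s e j)"
      using e e' unfolding zbasis_def bij_betw_def by simp
    then show ?thesis by blast
  qed
  then show ?thesis by (intro choice allI)
qed

text \<open>
  The matrices of the two base changes are integral and inverse to each other, so their
  determinants are \<open>1\<close> or \<open>-1\<close>, and the determinant of the Gram matrix is multiplied by the square.
\<close>

lemma gram_det_unique:
  fixes e e' :: "'n::finite \<Rightarrow> complex^2" and E :: "complex^2 \<Rightarrow> complex^2 \<Rightarrow> real"
  assumes e: "zbasis L e" and e': "zbasis L e'"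
    and E: "\<And>(k::'n \<Rightarrow> int) (l::'n \<Rightarrow> int). E (\<Sum>i\<in>UNIV. of_int (k i) *s e i) (\<Sum>j\<in>UNIV. of_int (l j) *s e j)
      = (\<Sum>i\<in>UNIV. \<Sum>j\<in>UNIV. of_int (k i) * of_int (l j) * E (e i) (e j))"
  shows "det (\<chi> i j. E (e' i) (e' j)) = det (\<chi> i j. E (e i) (e j))"
proof -
  obtain p :: "'n \<Rightarrow> 'n \<Rightarrow> int" where p: "\<And>i. e' i = (\<Sum>j\<in>UNIV. of_int (p i j) *s e j)"
    using zbasis_coordinates[OF e e'] by blast
  obtain q :: "'n \<Rightarrow> 'n \<Rightarrow> int" where q: "\<And>i. e i = (\<Sum>j\<in>UNIV. of_int (q i j) *s e' j)"
    using zbasis_coordinates[OF e' e] by blast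
  define P :: "real^'n^'n" where "P = (\<chi> i j. of_int (p i j))"
  define Q :: "real^'n^'n" where "Q = (\<chi> i j. of_int (q i j))"
  define G :: "real^'n^'n" where "G = (\<chi> i j. E (e i) (e j))"
  have inj: "inj (\<lambda>k::'n \<Rightarrow> int. \<Sum>i\<in>UNIV. of_int (k i) *s e i)"
    using e by (simp add: zbasis_def bij_betw_def)
  have "(\<Sum>j\<in>UNIV. q i j * p j l) = (if i = l then 1 else 0)" for i l
  proof -
    have "(\<Sum>l\<in>UNIV. of_int (\<Sum>j\<in>UNIV. q i j * p j l) *s e l)
      = (\<Sum>l\<in>UNIV. \<Sum>j\<in>UNIV. of_int (q i j) *s (of_int (p j l) *s e l))"
      by (simp add: vec.scale_sum_left)
    also have "\<dots> = (\<Sum>j\<in>UNIV. of_int (q i j) *s e' j)"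
      by (subst sum.swap) (simp add: p vec.scale_sum_right)
    also have "\<dots> = e i" by (rule q[symmetric])
    also have "\<dots> = (\<Sum>l\<in>UNIV. if i = l then e l else 0)" by simp
    also have "\<dots> = (\<Sum>l\<in>UNIV. of_int (if i = l then 1 else 0) *s e l)"
      by (intro sum.cong) auto
    finally have "(\<lambda>l. \<Sum>j\<in>UNIV. q i j * p j l) = (\<lambda>l. if i = l then 1 else 0)"
      by (rule injD[OF inj])
    then show ?thesis by (rule fun_cong)
  qed
  then have "Q ** P = mat 1"
    by (simp add: matrix_matrix_mult_def mat_def vec_eq_iff P_def Q_def flip: of_int_mult of_int_sum)
  then have "P ** Q = mat 1" by (simp add: matrix_left_right_inverse)
  then have detP: "(det P)\<^sup>2 = 1"
    by (rule det_integer_inverse) (simp_all add: P_def Q_def)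
  have "(\<chi> i j. E (e' i) (e' j)) = P ** G ** transpose P"
  proof -
    have "E (e' i) (e' j) = (\<Sum>l\<in>UNIV. (\<Sum>k\<in>UNIV. of_int (p i k) * E (e k) (e l)) * of_int (p j l))" for i j
      unfolding p E by (subst sum.swap) (simp add: sum_distrib_right sum_distrib_left mult_ac)
    then show ?thesis
      by (simp add: matrix_matrix_mult_def transpose_def vec_eq_iff P_def G_def)
  qed
  then show ?thesis
    using detP by (simp add: det_mul det_transpose G_def power2_eq_square mult_ac)
qed

lemma det_4_block:
  fixes a b :: real and G :: "real^4^4"
  assumes G: "\<And>i j. G $ i $ j =
    (if i = 1 \<and> j = 3 \<or> i = 2 \<and> j = 4 then a else if i = 1 \<and> j = 4 \<or> i = 2 \<and> j = 3 then b
     else if i = 3 \<and> j = 1 \<or> i = 4 \<and> j = 2 then - a else if i = 3 \<and> j = 2 \<or> i = 4 \<and> j = 1 then - b else 0)"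
  shows "det G = (a\<^sup>2 - b\<^sup>2)\<^sup>2"
proof -
  have f1: "finite {2::4, 3, 4}" "1 \<notin> {2::4, 3, 4}" by auto
  have f2: "finite {3::4, 4}" "2 \<notin> {3::4, 4}" by auto
  have f3: "finite {4::4}" "3 \<notin> {4::4}" by auto
  show ?thesis
    unfolding det_def UNIV_4
    unfolding sum_over_permutations_insert[OF f1]
    unfolding sum_over_permutations_insert[OF f2]
    unfolding sum_over_permutations_insert[OF f3]
    unfolding permutes_sing
    by (simp add: sign_swap_id permutation_swap_id permutation_compose sign_compose sign_id swap_id_eq G)
      (simp add: power2_eq_square algebra_simps)
qed

lemma form_det_period_lattice:
  assumes "\<bar>Im \<zeta>\<bar> < Im \<tau>"
  shows "form_det (period_lattice (period_matrix \<tau> \<zeta>)) E_Omega = ((Im \<tau>)\<^sup>2 - (Im \<zeta>)\<^sup>2)\<^sup>2"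
proof -
  let ?L = "period_lattice (period_matrix \<tau> \<zeta>)" and ?e = "period_basis (period_matrix \<tau> \<zeta>)"
  have e: "zbasis ?L ?e" by (rule zbasis_period_basis[OF assms])
  have E_sum: "E_Omega (\<Sum>i\<in>UNIV. of_int (k i) *s f i) (\<Sum>j\<in>UNIV. of_int (l j) *s f j)
      = (\<Sum>i\<in>UNIV. \<Sum>j\<in>UNIV. of_int (k i) * of_int (l j) * E_Omega (f i) (f j))"
    for k l :: "4 \<Rightarrow> int" and f :: "4 \<Rightarrow> complex^2"
    unfolding sum_4 by (simp add: E_Omega_def H_Omega_def algebra_simps)
  have det: "det (\<chi> i j. E_Omega (?e i) (?e j)) = ((Im \<tau>)\<^sup>2 - (Im \<zeta>)\<^sup>2)\<^sup>2"
  proof (rule det_4_block)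
    fix i j :: 4
    show "(\<chi> i j. E_Omega (?e i) (?e j)) $ i $ j =
      (if i = 1 \<and> j = 3 \<or> i = 2 \<and> j = 4 then Im \<tau> else if i = 1 \<and> j = 4 \<or> i = 2 \<and> j = 3 then Im \<zeta>
       else if i = 3 \<and> j = 1 \<or> i = 4 \<and> j = 2 then - Im \<tau>
       else if i = 3 \<and> j = 2 \<or> i = 4 \<and> j = 1 then - Im \<zeta> else 0)"
      using exhaust_4[of i] exhaust_4[of j]
      by (auto simp: E_Omega_def H_Omega_def period_basis_def period_matrix_def axis_def)
  qed
  show ?thesis
    unfolding form_det_def
  proof (rule the_equality)
    show "\<exists>e. zbasis ?L e \<and> ((Im \<tau>)\<^sup>2 - (Im \<zeta>)\<^sup>2)\<^sup>2 = det (\<chi> i j. E_Omega (e i) (e (j :: 4)))"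
      using e det[symmetric] by (intro exI[of _ ?e] conjI)
    fix d assume "\<exists>e :: 4 \<Rightarrow> complex^2. zbasis ?L e \<and> d = det (\<chi> i j. E_Omega (e i) (e j))"
    then obtain e' :: "4 \<Rightarrow> complex^2" where e': "zbasis ?L e'" "d = det (\<chi> i j. E_Omega (e' i) (e' j))"
      by blast
    show "d = ((Im \<tau>)\<^sup>2 - (Im \<zeta>)\<^sup>2)\<^sup>2"
      unfolding e'(2) det[symmetric] by (rule gram_det_unique[OF e e'(1) E_sum])
  qed
qed


section \<open>The restriction of a semi-character to the real periods\<close>

lemma int_character_trivial:
  fixes u :: "int \<Rightarrow> complex"
  assumes add: "\<And>a b. u (a + b) = u a * u b" and one: "u 1 = 1"
  shows "u n = 1"
proof (induction n rule: int_induct[where k = 0])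
  case base
  show ?case using add[of 0 1] one by simp
next
  case (step1 i)
  then show ?case by (simp add: add one)
next
  case (step2 i)
  then show ?case using add[of "i - 1" 1] one by simp
qed

lemma unit_circle_e2pi:
  assumes "norm w = 1"
  shows "\<exists>c::real. w = e2pi (of_real c)"
proof -
  have "w = e2pi (of_real (Arg w / (2 * pi)))"
    using Arg_eq[of w] assms by (cases "w = 0") (simp_all add: e2pi_def)
  then show ?thesis ..
qed

text \<open>
  The form \<open>E\<close> vanishes on real vectors, so on \<open>\<int>\<^sup>2\<close> a semi-character is a character, which is
  determined by its values on the unit vectors.
\<close>

lemma semicharacter_on_integers:
  assumes chi: "semicharacter L E_Omega chi" and L: "\<And>n. ivec n \<in> L"
  shows "\<exists>c :: complex^2. Im (c $ 1) = 0 \<and> Im (c $ 2) = 0 \<and> (\<forall>n. chi (ivec n) = e2pi (dotc c (ivec n)))"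
proof -
  have "norm (chi (ivec n)) = 1" for n using chi L unfolding semicharacter_def by blast
  then obtain c1 c2 :: real where c: "chi (ivec (1, 0)) = e2pi (of_real c1)" "chi (ivec (0, 1)) = e2pi (of_real c2)"
    using unit_circle_e2pi by metis
  define c where "c = cpoint (of_real c1) (of_real c2)"
  define v where "v n = chi (ivec n) / e2pi (dotc c (ivec n))" for n
  have "E_Omega (ivec n) (ivec n') = 0" for n n' by (simp add: E_Omega_def H_Omega_def)
  then have "chi (ivec n + ivec n') = chi (ivec n) * chi (ivec n')" for n n'
    using chi L unfolding semicharacter_def by simp
  then have v: "v (n + n') = v n * v n'" for n n'
    by (simp add: v_def ivec_add dotc_add e2pi_add)
  have v1: "v (k, 0) = 1" for k
    by (rule int_character_trivial[of "\<lambda>k. v (k, 0)"])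
      (use v[of "(_, 0)" "(_, 0)"] in \<open>simp_all add: v_def c c_def dotc_def\<close>)
  have v2: "v (0, k) = 1" for k
    by (rule int_character_trivial[of "\<lambda>k. v (0, k)"])
      (use v[of "(0, _)" "(0, _)"] in \<open>simp_all add: v_def c c_def dotc_def\<close>)
  have "v n = 1" for n
    using v[of "(fst n, 0)" "(0, snd n)"] v1 v2 by simp
  then have "chi (ivec n) = e2pi (dotc c (ivec n))" for n
    by (simp add: v_def)
  then show ?thesis by (intro exI[of _ c]) (simp add: c_def)
qed

lemma hermitian_H_Omega: "hermitian_form H_Omega"
  unfolding hermitian_form_def by (simp add: H_Omega_add H_Omega_smult H_Omega_def algebra_simps)

lemma pos_definite_H_Omega: "pos_definite H_Omega"
  unfolding pos_definite_def by (simp add: H_Omega_self)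

theorem theorem3p2:
  fixes \<tau> z :: complex and \<Omega> :: "complex^2^2" and L :: "(complex^2) set"
    and chi :: "complex^2 \<Rightarrow> complex"
  assumes "Im \<tau> > \<bar>Im z\<bar>" and "\<bar>Im z\<bar> \<ge> 0"
    and "Im \<tau> \<in> \<int>" and "Im z \<in> \<int>"
    and "\<Omega> = period_matrix \<tau> z" and "L = period_lattice \<Omega>"
    and "semicharacter L E_Omega chi"
  shows "(riemann_form L H_Omega \<and> pos_definite H_Omega) \<and>
         (ample_line_bundle L (J_factor H_Omega chi) \<and>
           (\<forall>n\<ge>3. sections_give_embedding L (tensor_power (J_factor H_Omega chi) n))) \<and>
         (real (cfun.dim (sections L (J_factor H_Omega chi))) = sqrt (form_det L E_Omega) \<and>
           sqrt (form_det L E_Omega) = (Im \<tau>)\<^sup>2 - (Im z)\<^sup>2)"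
proof -
  obtain A B :: int where Im_int: "Im \<tau> = of_int A" "Im z = of_int B"
    using assms(3,4) by (auto elim!: Ints_cases)
  have L: "L = period_lattice (period_matrix \<tau> z)" using assms by simp
  have "ivec n \<in> L" for n
  proof -
    have "ivec n = (\<chi> i. of_int ((0 :: int^2) $ i)) v* period_matrix \<tau> z
        + (\<chi> i. of_int ((\<chi> i. if i = 1 then fst n else snd n) $ i))"
      by (simp add: vec_eq_iff forall_2 vector_matrix_mult_def)
    then show ?thesis unfolding L period_lattice_def by blast
  qed
  then obtain c :: "complex^2" where c: "Im (c $ 1) = 0" "Im (c $ 2) = 0" "\<And>n. chi (ivec n) = e2pi (dotc c (ivec n))"
    using semicharacter_on_integers[OF assms(7)] by blast
  interpret circulant_torus \<tau> z A B chi c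
    by unfold_locales (use Im_int assms(1,7) c in \<open>simp_all add: L\<close>)
  have J: "Jf = J_factor H_Omega chi" by (rule Jf_def)
  have emb: "\<forall>n\<ge>3. sections_give_embedding L (tensor_power (J_factor H_Omega chi) n)"
    using powers_give_embedding unfolding L J by blast
  have auto: "automorphy_factor L (J_factor H_Omega chi)"
    using automorphy unfolding L J .
  have nondeg: "v = 0" if "\<forall>w. H_Omega v w = 0" for v
    using pos_definite_H_Omega that unfolding pos_definite_def by force
  have riemann: "riemann_form L H_Omega"
    unfolding riemann_form_def
    using is_lattice_period_lattice[OF assms(1)] hermitian_H_Omega nondeg E_integral
    unfolding L E_Omega_def by blast
  have pos: "(Im \<tau>)\<^sup>2 - (Im z)\<^sup>2 \<ge> 0"
    using power_mono[of "\<bar>Im z\<bar>" "Im \<tau>" 2] assms(1) by simp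
  have det: "sqrt (form_det L E_Omega) = (Im \<tau>)\<^sup>2 - (Im z)\<^sup>2"
    unfolding L form_det_period_lattice[OF assms(1)] using pos by simp
  have "tensor_power Jf 1 = Jf" by (simp add: tensor_power_def)
  then have "int (cfun.dim (sections L (J_factor H_Omega chi))) = A\<^sup>2 - B\<^sup>2"
    using dim_V[of 1] unfolding L J by simp
  then have "real (cfun.dim (sections L (J_factor H_Omega chi))) = of_int (A\<^sup>2 - B\<^sup>2)"
    by (metis of_int_of_nat_eq)
  then have dim: "real (cfun.dim (sections L (J_factor H_Omega chi))) = (Im \<tau>)\<^sup>2 - (Im z)\<^sup>2"
    by (simp add: Im_int)
  show ?thesis
    unfolding ample_line_bundle_def
    using riemann pos_definite_H_Omega auto emb det dim by simp
qed


end
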